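(* Let the group $G$ act on the hyperbolic space $X$, and let $g_1,\dots,g_n\in G$. Consider the following properties of an action of $G$ on a hyperbolic space: (1) the elements $g_i$ are loxodromic; (2) the elements $g_i$ are loxodromic WPD; (3) the elements $g_i$ are independent loxodromic elements. Then there exists a hyperbolic space $Y$ with a cobounded $G$-action such that each of the properties (1)--(3) holds for the action on $Y$ if it holds for the action on $X$.
   Context: A hyperbolic space is a geodesic Gromov hyperbolic metric space (not necessarily proper); actions on hyperbolic spaces are by isometries. An action on $Y$ is cobounded if some orbit is at finite Hausdorff distance from $Y$. An element $g$ is loxodromic if $n\mapsto g^nx$, $n\in\mathbb{Z}$, is a quasi-isometric embedding for some (equivalently any) $x\in X$; it then has exactly two fixed points $g^{\pm\infty}$ in $\partial X$. Loxodromic elements are independent if their pairs of fixed points in the boundary are pairwise disjoint. A loxodromic element $g$ is WPD (weakly properly discontinuous) if for every $R>0$ and every (equivalently some) $x\in X$ there is an integer $n>0$ such that the set $\{h\in G: d(x,hx)\le R,\ d(g^nx,hg^nx)\le R\}$ is finite. *)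

theory Defs
  imports "HOL-Analysis.Abstract_Metric_Spaces" "HOL-Algebra.Group_Action"
begin

definition (in Metric_space) geodesic_space :: bool where
  "geodesic_space \<longleftrightarrow>
     (\<forall>x\<in>M. \<forall>y\<in>M. \<exists>\<gamma> \<in> {0..d x y} \<rightarrow> M. \<gamma> 0 = x \<and> \<gamma> (d x y) = y \<and>
        (\<forall>s\<in>{0..d x y}. \<forall>t\<in>{0..d x y}. d (\<gamma> s) (\<gamma> t) = \<bar>s - t\<bar>))"

definition (in Metric_space) gromov_product :: "'a \<Rightarrow> 'a \<Rightarrow> 'a \<Rightarrow> real" where
  "gromov_product w x y = (d x w + d y w - d x y) / 2"

definition (in Metric_space) gromov_hyperbolic :: bool where
  "gromov_hyperbolic \<longleftrightarrow>
     (\<exists>\<delta>\<ge>0. \<forall>w\<in>M. \<forall>x\<in>M. \<forall>y\<in>M. \<forall>z\<in>M.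
        gromov_product w x z \<ge> min (gromov_product w x y) (gromov_product w y z) - \<delta>)"

locale hyperbolic_space = Metric_space +
  assumes geodesic: geodesic_space
      and hyperbolic: gromov_hyperbolic

text \<open>
  The boundary of a hyperbolic space that need not be proper: sequences converging to
  infinity, that is, with \<open>(s i | s j) \<longrightarrow> \<infinity>\<close> as \<open>i, j \<longrightarrow> \<infinity>\<close>, two of them being
  identified if \<open>(s i | t j) \<longrightarrow> \<infinity>\<close>. The choice of base point \<open>w\<close> is immaterial, as
  changing it alters Gromov products by a bounded amount.
\<close>

definition (in Metric_space) asymptotic :: "(nat \<Rightarrow> 'a) \<Rightarrow> (nat \<Rightarrow> 'a) \<Rightarrow> bool" where
  "asymptotic s t \<longleftrightarrow>
     (\<forall>w\<in>M. filterlim (\<lambda>(i, j). gromov_product w (s i) (t j)) at_top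
               (sequentially \<times>\<^sub>F sequentially))"

definition (in Metric_space) sequences_to_infinity :: "(nat \<Rightarrow> 'a) set" where
  "sequences_to_infinity = {s. range s \<subseteq> M \<and> asymptotic s s}"

definition (in Metric_space) asymptotic_rel :: "((nat \<Rightarrow> 'a) \<times> (nat \<Rightarrow> 'a)) set" where
  "asymptotic_rel =
     {(s, t). s \<in> sequences_to_infinity \<and> t \<in> sequences_to_infinity \<and> asymptotic s t}"

definition (in Metric_space) gromov_boundary :: "(nat \<Rightarrow> 'a) set set" where
  "gromov_boundary = sequences_to_infinity // asymptotic_rel"

definition quasi_isometric_embedding ::
    "'a set \<Rightarrow> ('a \<Rightarrow> 'a \<Rightarrow> real) \<Rightarrow> 'b set \<Rightarrow> ('b \<Rightarrow> 'b \<Rightarrow> real) \<Rightarrow> ('a \<Rightarrow> 'b) \<Rightarrow> bool" where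
  "quasi_isometric_embedding A dA B dB f \<longleftrightarrow> f \<in> A \<rightarrow> B \<and>
     (\<exists>K\<ge>1. \<exists>C\<ge>0. \<forall>x\<in>A. \<forall>y\<in>A.
        dA x y / K - C \<le> dB (f x) (f y) \<and> dB (f x) (f y) \<le> K * dA x y + C)"

definition (in Metric_space) finite_hausdorff_distance :: "'a set \<Rightarrow> 'a set \<Rightarrow> bool" where
  "finite_hausdorff_distance A B \<longleftrightarrow>
     (\<exists>C. (\<forall>a\<in>A. \<exists>b\<in>B. d a b \<le> C) \<and> (\<forall>b\<in>B. \<exists>a\<in>A. d a b \<le> C))"

locale isometric_action = group_action G M \<phi> + Metric_space M d
  for G :: "('g, 'm) monoid_scheme" (structure)
  and M :: "'a set" and d :: "'a \<Rightarrow> 'a \<Rightarrow> real" and \<phi> :: "'g \<Rightarrow> 'a \<Rightarrow> 'a" +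
  assumes isometry:
    "\<lbrakk>g \<in> carrier G; x \<in> M; y \<in> M\<rbrakk> \<Longrightarrow> d (\<phi> g x) (\<phi> g y) = d x y"
begin

definition cobounded :: bool where
  "cobounded \<longleftrightarrow> (\<exists>x\<in>M. finite_hausdorff_distance (orbit G \<phi> x) M)"

definition loxodromic :: "'g \<Rightarrow> bool" where
  "loxodromic g \<longleftrightarrow> g \<in> carrier G \<and>
     (\<exists>x\<in>M. quasi_isometric_embedding (UNIV :: int set) (\<lambda>m n. real_of_int \<bar>m - n\<bar>) M d
               (\<lambda>n. \<phi> (g [^] n) x))"

definition WPD :: "'g \<Rightarrow> bool" where
  "WPD g \<longleftrightarrow> loxodromic g \<and>
     (\<forall>R>0. \<forall>x\<in>M. \<exists>n::int. n > 0 \<and>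
        finite {h \<in> carrier G. d x (\<phi> h x) \<le> R \<and>
                               d (\<phi> (g [^] n) x) (\<phi> h (\<phi> (g [^] n) x)) \<le> R})"

definition boundary_action :: "'g \<Rightarrow> (nat \<Rightarrow> 'a) set \<Rightarrow> (nat \<Rightarrow> 'a) set" where
  "boundary_action g \<xi> = asymptotic_rel `` ((\<lambda>s. \<phi> g \<circ> s) ` \<xi>)"

definition boundary_fixed_points :: "'g \<Rightarrow> (nat \<Rightarrow> 'a) set set" where
  "boundary_fixed_points g = {\<xi> \<in> gromov_boundary. boundary_action g \<xi> = \<xi>}"

text \<open>
  Independence concerns indexed families: in an independent family, no loxodromic
  element occurs twice.
\<close>

definition independent_loxodromics :: "'i set \<Rightarrow> ('i \<Rightarrow> 'g) \<Rightarrow> bool" where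
  "independent_loxodromics I g \<longleftrightarrow> (\<forall>i\<in>I. loxodromic (g i)) \<and>
     (\<forall>i\<in>I. \<forall>j\<in>I. i \<noteq> j \<longrightarrow>
        boundary_fixed_points (g i) \<inter> boundary_fixed_points (g j) = {})"

end

text \<open>
  HOL cannot quantify existentially over types, so the points of a space that is claimed
  to exist have to be taken from a fixed type. The one below accommodates the points of
  the geometric realization of a graph with vertex set contained in \<open>'x\<close>, a point being
  an equivalence class of triples: two end points and a position on the edge between them.
\<close>

type_synonym 'x realization_point = "('x \<times> 'x \<times> real) set"

end

theory Submission
  imports Defs "HOL-Real_Asymp.Real_Asymp"
begin

text \<open>
  Fix \<open>x \<in> X\<close> and a radius \<open>r\<close>. Electrify the part of \<open>X\<close> that is far from the orbit \<open>Z = G x\<close>: join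
  \<open>p\<close> and \<open>q\<close> by an edge of length 1 if \<open>d p q \<le> 1\<close> or if every geodesic from \<open>p\<close> to \<open>q\<close> stays at
  distance at least \<open>r\<close> from \<open>Z\<close>. An almost shortest path to \<open>Z\<close> is of the second kind until it is close to
  \<open>Z\<close>, so \<open>G\<close> acts coboundedly on the resulting graph.

  Geodesics of \<open>X\<close> between adjacent vertices have diameter at most 1 in the graph metric \<open>\<rho>\<close>. Hence, by
  the proof of the Morse lemma, graph geodesics pass close to the geodesics of \<open>X\<close>, that is, \<open>\<rho>\<close>
  is additive along geodesics of \<open>X\<close> up to a constant that does not depend on \<open>r\<close>. Thin triangles
  of \<open>X\<close> are therefore thin for \<open>\<rho>\<close>, and \<open>n \<mapsto> \<rho> x (g\<^sup>n x)\<close> is superadditive up to a constant \<open>C\<close>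
  independent of \<open>r\<close>, so that \<open>g\<close> remains loxodromic once a single value exceeds \<open>C\<close>. This happens
  for large \<open>r\<close>: the axis of \<open>g\<close> lies close to \<open>Z\<close>, so a chain of few edges along it
  cannot make use of the edges of the second kind.

  An isometry that moves two distant points of the axis of \<open>g\<close> by at most \<open>R\<close> in \<open>\<rho>\<close> moves
  the points in between by a bounded amount in \<open>X\<close>, by thinness of quadrilaterals in \<open>X\<close>; this transfers WPD.
  If \<open>g\<close> and \<open>h\<close> share a boundary point of the graph, then the Gromov products of \<open>g\<^sup>m x\<close> and
  \<open>h\<^sup>k x\<close> are unbounded for \<open>\<rho>\<close>, hence in \<open>X\<close>, as \<open>\<rho>\<close>-products are at most \<open>X\<close>-products up to a constant.
  If some \<open>g i\<close> is not loxodromic on \<open>X\<close>, nothing is claimed and a point will do.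
\<close>

section \<open>Hyperbolic spaces and thin polygons\<close>

text \<open>In a geodesic space this is the union of all geodesics from \<open>a\<close> to
  \<open>b\<close>. It involves no choice of a geodesic, so that it is symmetric in the ends and
  carried along by isometries.\<close>

definition (in Metric_space) betw :: "'a \<Rightarrow> 'a \<Rightarrow> 'a set" where
  "betw a b = {m \<in> M. d a m + d m b = d a b}"

context Metric_space begin

lemma betwD: "m \<in> betw a b \<Longrightarrow> m \<in> M" "m \<in> betw a b \<Longrightarrow> d a m + d m b = d a b"
  by (auto simp: betw_def)

lemma betw_commute: "betw a b = betw b a"
  by (auto simp: betw_def commute)

lemma betw_ends: "a \<in> M \<Longrightarrow> b \<in> M \<Longrightarrow> a \<in> betw a b" "a \<in> M \<Longrightarrow> b \<in> M \<Longrightarrow> b \<in> betw a b"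
  by (auto simp: betw_def)

lemma betw_left:
  assumes "m \<in> betw a b" "p \<in> betw a m" "a \<in> M" "b \<in> M" shows "p \<in> betw a b" "m \<in> betw p b"
proof -
  have M: "m \<in> M" "p \<in> M" using assms betwD by auto
  have "d p b \<le> d p m + d m b" "d a b \<le> d a p + d p b" using M assms triangle by auto
  then show "p \<in> betw a b" "m \<in> betw p b" using assms(1,2) M by (auto simp: betw_def)
qed

lemma betw_right:
  assumes "m \<in> betw a b" "p \<in> betw m b" "a \<in> M" "b \<in> M" shows "p \<in> betw a b" "m \<in> betw a p"
  using betw_left[of m b a p] assms by (auto simp: betw_commute)

end

text \<open>\<open>four_point\<close> is the inequality for Gromov products at \<open>w\<close>,
  doubled and subtracted from \<open>d x w + d y w + d z w\<close>. The constant is a parameter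
  because later constants are built from it.\<close>

locale delta_hyperbolic = Metric_space M d for M :: "'a set" and d :: "'a \<Rightarrow> 'a \<Rightarrow> real" +
  fixes \<delta> :: real
  assumes geodesics: geodesic_space
    and delta_nonneg: "0 \<le> \<delta>"
    and four_point: "\<lbrakk>w \<in> M; x \<in> M; y \<in> M; z \<in> M\<rbrakk> \<Longrightarrow>
      d x z + d y w \<le> max (d x y + d z w) (d y z + d x w) + 2 * \<delta>"

lemma (in hyperbolic_space) delta_hyperbolic: "\<exists>\<delta>. delta_hyperbolic M d \<delta>"
proof -
  obtain \<delta> where \<delta>: "\<delta> \<ge> 0" "\<And>w x y z. w \<in> M \<Longrightarrow> x \<in> M \<Longrightarrow> y \<in> M \<Longrightarrow> z \<in> M \<Longrightarrow>
        gromov_product w x z \<ge> min (gromov_product w x y) (gromov_product w y z) - \<delta>"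
    using hyperbolic unfolding gromov_hyperbolic_def by blast
  have "delta_hyperbolic M d \<delta>"
  proof
    show geodesic_space by (rule geodesic)
    fix w x y z assume "w \<in> M" "x \<in> M" "y \<in> M" "z \<in> M"
    then show "d x z + d y w \<le> max (d x y + d z w) (d y z + d x w) + 2 * \<delta>"
      using \<delta>(2)[of w x y z] unfolding gromov_product_def min_def max_def
      by (auto split: if_splits simp: field_simps)
  qed (rule \<delta>(1))
  then show ?thesis ..
qed

lemma (in Metric_space) gromov_hyperbolicI:
  assumes "\<And>w x y z. \<lbrakk>w \<in> M; x \<in> M; y \<in> M; z \<in> M\<rbrakk> \<Longrightarrow>
        gromov_product w x z \<ge> min (gromov_product w x y) (gromov_product w y z) - \<delta>"
  shows gromov_hyperbolic
  unfolding gromov_hyperbolic_def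
proof (intro exI conjI ballI)
  fix w x y z assume "w \<in> M" "x \<in> M" "y \<in> M" "z \<in> M"
  from assms[OF this]
  show "gromov_product w x z \<ge> min (gromov_product w x y) (gromov_product w y z) - max \<delta> 0" by linarith
qed simp

context delta_hyperbolic begin

lemma hyp_product:
  assumes "w \<in> M" "x \<in> M" "y \<in> M" "z \<in> M"
  shows "gromov_product w x z \<ge> min (gromov_product w x y) (gromov_product w y z) - \<delta>"
  using four_point[OF assms] unfolding gromov_product_def min_def max_def
      by (auto split: if_splits simp: field_simps)

lemma geodesicE:
  assumes "a \<in> M" "b \<in> M"
  obtains \<gamma> where "\<gamma> 0 = a" "\<gamma> (d a b) = b" "\<And>t. 0 \<le> t \<Longrightarrow> t \<le> d a b \<Longrightarrow> \<gamma> t \<in> betw a b"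
    "\<And>t. 0 \<le> t \<Longrightarrow> t \<le> d a b \<Longrightarrow> d a (\<gamma> t) = t"
    "\<And>s t. 0 \<le> s \<Longrightarrow> s \<le> d a b \<Longrightarrow> 0 \<le> t \<Longrightarrow> t \<le> d a b \<Longrightarrow> d (\<gamma> s) (\<gamma> t) = \<bar>s - t\<bar>"
proof -
  obtain \<gamma> where \<gamma>: "\<gamma> \<in> {0..d a b} \<rightarrow> M" "\<gamma> 0 = a" "\<gamma> (d a b) = b"
      "\<And>s t. s\<in>{0..d a b} \<Longrightarrow> t\<in>{0..d a b} \<Longrightarrow> d (\<gamma> s) (\<gamma> t) = \<bar>s - t\<bar>"
    using geodesics assms unfolding geodesic_space_def by metis
  have 1: "d a (\<gamma> t) = t" "d (\<gamma> t) b = d a b - t" "\<gamma> t \<in> M" if "0 \<le> t" "t \<le> d a b" for t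
    using \<gamma>(4)[of 0 t] \<gamma>(4)[of t "d a b"] \<gamma> that by auto
  show thesis
    by (rule that[of \<gamma>]) (use \<gamma> 1 in \<open>auto simp: betw_def\<close>)
qed

lemma point_at:
  assumes "a \<in> M" "b \<in> M" "0 \<le> t" "t \<le> d a b"
  obtains m where "m \<in> betw a b" "d a m = t" "d m b = d a b - t"
proof -
  obtain \<gamma> where "\<gamma> t \<in> betw a b" "d a (\<gamma> t) = t"
    using geodesicE[OF assms(1,2)] assms by metis
  then show thesis using that[of "\<gamma> t"] betwD(2)[of "\<gamma> t" a b] by auto
qed

lemma walk:
  assumes "a \<in> M" "b \<in> M"
  obtains p J where "p 0 = a" "p J = b" "\<And>j. p j \<in> betw a b" "\<And>j. d (p j) (p (Suc j)) \<le> 1"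
      "real J \<le> d a b + 1"
proof -
  obtain \<gamma> where \<gamma>: "\<gamma> 0 = a" "\<gamma> (d a b) = b" "\<And>t. 0 \<le> t \<Longrightarrow> t \<le> d a b \<Longrightarrow> \<gamma> t \<in> betw a b"
    "\<And>s t. 0 \<le> s \<Longrightarrow> s \<le> d a b \<Longrightarrow> 0 \<le> t \<Longrightarrow> t \<le> d a b \<Longrightarrow> d (\<gamma> s) (\<gamma> t) = \<bar>s - t\<bar>"
    using geodesicE[OF assms] by metis
  show thesis
  \<comment> \<open>The geodesic is read at integer times; \<open>min\<close> keeps the sequence at
    \<open>b\<close> afterwards, so that the claims hold for every \<open>j\<close>.\<close>
  proof (rule that[of "\<lambda>j. \<gamma> (min (real j) (d a b))" "nat \<lceil>d a b\<rceil>"])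
    show "\<gamma> (min (real 0) (d a b)) = a" using \<gamma> by simp
    have "min (real (nat \<lceil>d a b\<rceil>)) (d a b) = d a b" by linarith
    then show "\<gamma> (min (real (nat \<lceil>d a b\<rceil>)) (d a b)) = b" using \<gamma> by simp
    show "real (nat \<lceil>d a b\<rceil>) \<le> d a b + 1" using nonneg[of a b] by linarith
    fix j show "\<gamma> (min (real j) (d a b)) \<in> betw a b" by (rule \<gamma>) auto
    have "d (\<gamma> (min (real j) (d a b))) (\<gamma> (min (real (Suc j)) (d a b))) = 
      \<bar>min (real j) (d a b) - min (real (Suc j)) (d a b)\<bar>" by (rule \<gamma>) auto
    then show "d (\<gamma> (min (real j) (d a b))) (\<gamma> (min (real (Suc j)) (d a b))) \<le> 1" by auto
  qed
qed

text \<open>The four-point inequality compares \<open>m\<close> with the point of a geodesic at the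
  same distance from \<open>c\<close>. If \<open>m\<close> is farther from \<open>c\<close> than
  \<open>b\<close> is, then \<open>m\<close> is within \<open>e\<close> of \<open>b\<close>
  itself.\<close>

lemma near_betw:
  assumes "c \<in> M" "b \<in> M" "m \<in> M" "d c m + d m b \<le> d c b + e"
  obtains m' where "m' \<in> betw c b" "d m m' \<le> e + 2 * \<delta>"
proof (cases "d c m \<le> d c b")
  case True
  then obtain m' where m': "m' \<in> betw c b" "d c m' = d c m" "d m' b = d c b - d c m"
    using point_at[of c b "d c m"] assms by auto
  have "d c b + d m m' \<le> max (d c m + d b m') (d m b + d c m') + 2 * \<delta>"
    using four_point[of m' c m b] m' assms betwD(1)[OF m'(1)] by (simp add: commute)
  then have "d m m' \<le> e + 2 * \<delta>" using m' assms triangle[of c m b] commute[of b m'] commute[of m b]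
      by (auto simp: max_def split: if_splits)
  then show ?thesis using that m' by blast
next
  case False
  then have "d m b \<le> e + 2 * \<delta>" using assms delta_nonneg by linarith
  then show ?thesis using that betw_ends assms by blast
qed

text \<open>Since \<open>m\<close> divides the side \<open>a b\<close> additively, the four-point
  inequality makes it divide one of the other two sides additively up to
  \<open>2 * \<delta>\<close>; \<open>near_betw\<close> costs another
  \<open>2 * \<delta>\<close>.\<close>

lemma thin:
  assumes "a \<in> M" "b \<in> M" "c \<in> M" "m \<in> betw a b"
  obtains m' where "m' \<in> betw a c \<union> betw c b" "d m m' \<le> 4 * \<delta>"
proof -
  note m = betwD[OF assms(4)]
  have "d a b + d m c \<le> max (d a m + d b c) (d m b + d a c) + 2 * \<delta>"
    using four_point[of c a m b] assms m by auto
  then consider "d c m + d m b \<le> d c b + 2 * \<delta>" | "d a m + d m c \<le> d a c + 2 * \<delta>"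
    using m commute by (smt (verit))
  then show thesis
  proof cases
    case 1
    then obtain m' where "m' \<in> betw c b" "d m m' \<le> 2*\<delta> + 2 * \<delta>" using near_betw assms m by metis
    then show ?thesis using that[of m'] by auto
  next
    case 2
    then obtain m' where "m' \<in> betw a c" "d m m' \<le> 2*\<delta> + 2 * \<delta>" using near_betw assms m by metis
    then show ?thesis using that[of m'] by auto
  qed
qed

lemma thin_quad:
  assumes "a \<in> M" "b \<in> M" "a' \<in> M" "b' \<in> M" "m \<in> betw a b"
  obtains m' where "m' \<in> betw a a' \<union> betw a' b' \<union> betw b' b" "d m m' \<le> 8 * \<delta>"
proof -
  obtain m1 where m1: "m1 \<in> betw a a' \<union> betw a' b" "d m m1 \<le> 4 * \<delta>" using thin assms by metis
  show thesis
  proof (cases "m1 \<in> betw a a'")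
    case True
    have "d m m1 \<le> 8 * \<delta>" using m1(2) delta_nonneg by linarith
    then show ?thesis using that[of m1] True by blast
  next
    case False
    then obtain m2 where m2: "m2 \<in> betw a' b' \<union> betw b' b" "d m1 m2 \<le> 4 * \<delta>" using thin assms m1
        by (metis Un_iff)
    have "d m m2 \<le> d m m1 + d m1 m2" using triangle m1 m2 assms betwD(1) by blast
    then show ?thesis using that[of m2] m1 m2 by auto
  qed
qed

text \<open>The point \<open>m\<close> plays the centre of the tripod with ends \<open>w\<close>,
  \<open>p\<close>, \<open>r\<close>. The four-point inequality bounds \<open>d m r\<close> by the
  Gromov product of \<open>w\<close> and \<open>p\<close> at \<open>r\<close> plus
  \<open>2 * \<delta>\<close>, so that \<open>m\<close> almost lies on both sides that end at
  \<open>r\<close>.\<close>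

lemma center:
  assumes "w \<in> M" "p \<in> M" "r \<in> M"
  obtains m m1 m2 where "m \<in> betw w p" "d w m = gromov_product w p r"
    "m1 \<in> betw p r" "d m m1 \<le> 4 * \<delta>" "m2 \<in> betw w r" "d m m2 \<le> 4 * \<delta>"
proof -
  define t where "t = gromov_product w p r"
  have t: "2 * t = d w p + d w r - d p r" unfolding t_def gromov_product_def by (simp add: commute)
  have "d w r \<le> d w p + d p r" "d p r \<le> d w p + d w r" using triangle triangle'' assms by auto
  then have "0 \<le> t" "t \<le> d w p"
    using t by (linarith, smt (verit) assms commute triangle)
  then obtain m where m: "m \<in> betw w p" "d w m = t" "d m p = d w p - t" using point_at assms by metis
  have mM: "m \<in> M" using betwD m by auto
  have "d w p + d m r \<le> max (d w m + d p r) (d m p + d w r) + 2 * \<delta>"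
    using four_point[of r w m p] mM assms by auto
  then have mr: "2 * d m r \<le> d w r + d p r - d w p + 4 * \<delta>" using m t by (auto simp: max_def split: if_splits)
  have "d p m + d m r \<le> d p r + 2 * \<delta>" "d w m + d m r \<le> d w r + 2 * \<delta>" using mr m t commute[of p m]
      by linarith+
  then obtain m1 m2 where "m1 \<in> betw p r" "d m m1 \<le> 2*\<delta>+2 * \<delta>" "m2 \<in> betw w r" "d m m2 \<le> 2*\<delta>+2 * \<delta>"
    using near_betw assms mM by metis
  then show thesis using that[OF m(1)] m(2) t_def by auto
qed

text \<open>Bisection: a diagonal cuts the polygon into two with at most \<open>2 ^ k\<close> edges
  each, and a thin triangle moves \<open>m\<close> to one of them. The error grows only
  logarithmically with the number of edges, which drives the Morse lemma.\<close>

lemma polygon: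
  assumes "E \<subseteq> M \<times> M" "(a, b) \<in> E ^^ N" "1 \<le> N" "N \<le> 2 ^ k" "m \<in> betw a b"
  shows "\<exists>u v m'. (u, v) \<in> E \<and> m' \<in> betw u v \<and> d m m' \<le> 4 * \<delta> * k"
  using assms(2-)
proof (induction k arbitrary: a b N m)
  case 0
  then have "N = 1" by auto
  then have "(a,b) \<in> E" using 0 by simp
  moreover have "d m m = 0" using 0 betwD by auto
  ultimately show ?case using 0 by force
next
  case (Suc k)
  show ?case
  proof (cases "N \<le> 2 ^ k")
    case True
    then obtain u v m' where "(u, v) \<in> E \<and> m' \<in> betw u v \<and> d m m' \<le> 4 * \<delta> * k" using Suc by metis
    then show ?thesis using delta_nonneg by (intro exI[of _ u] exI[of _ v] exI[of _ m']) (auto simp: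
        algebra_simps)
  next
    case False
    define N1 where "N1 = N - 2^k"
    have N1: "N = 2^k + N1" "1 \<le> N1" "N1 \<le> 2^k" "1 \<le> (2::nat)^k" using False Suc.prems
        unfolding N1_def by auto
    then obtain c where c: "(a,c) \<in> E ^^ (2^k)" "(c,b) \<in> E ^^ N1"
      using Suc.prems by (metis relcompE relpow_add prod.inject)
    have fld: "x \<in> M \<and> y \<in> M" if xy: "(x,y) \<in> E ^^ n" "1 \<le> n" for x y n
    proof -
      obtain n' where "n = Suc n'" using xy by (cases n) auto
      then show ?thesis using xy assms(1) by (blast elim: relpow_Suc_E relpow_Suc_E2)
    qed
    have M: "a \<in> M" "b \<in> M" "c \<in> M" using fld c N1 by blast+
    obtain m1 where m1: "m1 \<in> betw a c \<union> betw c b" "d m m1 \<le> 4 * \<delta>" using thin M Suc.prems by metis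
    have "\<exists>u v m'. (u, v) \<in> E \<and> m' \<in> betw u v \<and> d m1 m' \<le> 4 * \<delta> * k"
    proof (cases "m1 \<in> betw a c")
      case True
      show ?thesis by (rule Suc.IH[OF c(1)]) (use N1 True in auto)
    next
      case False
      show ?thesis by (rule Suc.IH[OF c(2)]) (use N1 False m1 in auto)
    qed
    then obtain u v m' where m': "(u, v) \<in> E" "m' \<in> betw u v" "d m1 m' \<le> 4 * \<delta> * k" by blast
    have "d m m' \<le> d m m1 + d m1 m'" using triangle m' m1 Suc.prems betwD(1) by blast
    then show ?thesis using m' m1 by (intro exI[of _ u] exI[of _ v] exI[of _ m']) (auto simp: algebra_simps)
  qed
qed

end

section \<open>Stability of quasi-geodesics\<close>

text \<open>Closes the Morse argument: a path whose number of edges is linear in \<open>B\<close> is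
  halved about \<open>log 2 B\<close> times, and any multiple of a logarithm is eventually below
  \<open>B\<close>.\<close>

lemma linear_le_power_small_exponent:
  fixes \<alpha> \<beta> \<mu> c :: real
  assumes "\<alpha> > 0" "\<mu> > 0"
  shows "\<exists>D. \<forall>B\<ge>D. \<forall>N. real N \<le> \<alpha> * B + \<beta> \<longrightarrow> (\<exists>k. N \<le> 2 ^ k \<and> \<mu> * real k + c < B)"
proof -
  \<comment> \<open>The \<open>+ 2\<close> leaves room for rounding the logarithm up to a natural
    number.\<close>
  have "eventually (\<lambda>B::real. \<mu> * (log 2 (\<alpha> * B + \<beta>) + 2) + c < B) at_top"
    using assms by real_asymp
  moreover have "eventually (\<lambda>B::real. \<alpha> * B + \<beta> \<ge> 1) at_top"
    using assms by real_asymp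
  ultimately have "eventually (\<lambda>B::real. \<mu> * (log 2 (\<alpha> * B + \<beta>) + 2) + c < B \<and> \<alpha> * B + \<beta> \<ge> 1) at_top"
    by (rule eventually_conj)
  then obtain D where D: "\<And>B. B \<ge> D \<Longrightarrow> \<mu> * (log 2 (\<alpha> * B + \<beta>) + 2) + c < B \<and> \<alpha> * B + \<beta> \<ge> 1"
    unfolding eventually_at_top_linorder by blast
  have "\<exists>k. N \<le> 2 ^ k \<and> \<mu> * real k + c < B" if B: "B \<ge> D" and N: "real N \<le> \<alpha> * B + \<beta>" for B N
  proof (intro exI conjI)
    define L where "L = log 2 (\<alpha> * B + \<beta>)"
    have L: "L \<ge> 0" "\<mu> * (L + 2) + c < B" using D[OF B] unfolding L_def by auto
    have "real N \<le> 2 powr L" using D[OF B] N unfolding L_def by simp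
    also have "\<dots> \<le> 2 powr real (nat \<lceil>L\<rceil>)" by (intro powr_mono) linarith+
    finally have "real N \<le> real (2 ^ nat \<lceil>L\<rceil>)" by (simp add: powr_realpow)
    then show "N \<le> 2 ^ nat \<lceil>L\<rceil>" by (simp only: of_nat_le_iff)
    have "real (nat \<lceil>L\<rceil>) \<le> L + 2" using L by linarith
    then have "\<mu> * real (nat \<lceil>L\<rceil>) \<le> \<mu> * (L + 2)" using assms by simp
    then show "\<mu> * real (nat \<lceil>L\<rceil>) + c < B" using L by linarith
  qed
  then show ?thesis by blast
qed

lemma relpow_sym:
  assumes "sym E" "(a, b) \<in> E ^^ n" shows "(b, a) \<in> E ^^ n"
  using assms(2)
proof (induction n arbitrary: b)
  case (Suc n)
  then obtain c where "(a,c) \<in> E ^^ n" "(c,b) \<in> E" by (auto elim: relpow_Suc_E)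
  then show ?case using Suc.IH assms(1) by (blast intro: relpow_Suc_I2 dest: symD)
qed auto

lemma relpow_append: "(a, b) \<in> E ^^ m \<Longrightarrow> (b, c) \<in> E ^^ n \<Longrightarrow> (a, c) \<in> E ^^ (m + n)"
  by (auto simp: relpow_add)

text \<open>A relation power does not record the intermediate vertices, so the hypothesis speaks of
  everything reachable within \<open>n\<close> steps.\<close>

lemma relpow_restrict:
  assumes "(a, b) \<in> E ^^ n" "\<And>j s. j \<le> n \<Longrightarrow> (a, s) \<in> E ^^ j \<Longrightarrow> s \<in> S"
  shows "(a, b) \<in> (E \<inter> S \<times> S) ^^ n"
  using assms
proof (induction n arbitrary: b)
  case (Suc n)
  then obtain c where c: "(a,c) \<in> E ^^ n" "(c,b) \<in> E" by (auto elim: relpow_Suc_E)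
  have "b \<in> S" "c \<in> S" using Suc.prems(2)[of "Suc n" b] Suc.prems(2)[of n c] Suc.prems(1) c by auto
  moreover have "(a,c) \<in> (E \<inter> S \<times> S) ^^ n" using Suc.IH[OF c(1)] Suc.prems(2) le_SucI by blast
  ultimately show ?case using c by (blast intro: relpow_Suc_I)
qed auto

lemma relpow_index:
  fixes i j :: nat
  assumes "sym E" "\<And>i. i < n \<Longrightarrow> (y i, y (Suc i)) \<in> E" "i \<le> n" "j \<le> n"
  shows "(y i, y j) \<in> E ^^ (nat \<bar>int i - int j\<bar>)"
proof -
  have *: "(y i, y (i + l)) \<in> E ^^ l" if "i + l \<le> n" for i l
    using that
  proof (induction l)
    case (Suc l)
    then show ?case using assms(2)[of "i+l"] by (auto intro: relpow_Suc_I simp del: relpow.simps)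
  qed auto
  show ?thesis
  proof (cases "i \<le> j")
    case True
    then have "nat \<bar>int i - int j\<bar> = j - i" by linarith
    then show ?thesis using *[of i "j - i"] True assms by simp
  next
    case False
    then have "nat \<bar>int i - int j\<bar> = i - j" by linarith
    then show ?thesis using *[of j "i - j"] False assms by (auto intro: relpow_sym)
  qed
qed

context Metric_space begin

text \<open>Serves two metrics: the electrified one with \<open>c = 1\<close>, and \<open>d\<close>
  itself with edges of bounded length. The bound along \<open>betw u v\<close> links \<rho> to the
  geodesics of \<open>d\<close>, although \<rho> may be far smaller than \<open>d\<close>.\<close>

definition coarse_graph_metric :: "('a \<Rightarrow> 'a \<Rightarrow> real) \<Rightarrow> ('a \<times> 'a) set \<Rightarrow> real \<Rightarrow> bool" where
  "coarse_graph_metric \<rho> E c \<longleftrightarrow> Metric_space M \<rho> \<and> (\<forall>a\<in>M. \<forall>b\<in>M. \<rho> a b \<le> d a b + 1) \<and>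
     E \<subseteq> M \<times> M \<and> sym E \<and> Id_on M \<subseteq> E \<and> (\<forall>(u, v)\<in>E. \<forall>m\<in>betw u v. \<rho> u m \<le> c) \<and>
     (\<forall>a\<in>M. \<forall>b\<in>M. \<exists>N. real N \<le> \<rho> a b + 1 \<and> (a, b) \<in> E ^^ N)"

text \<open>The upper bound is contained in the adjacency of consecutive points, as edges of a
  coarse graph metric have bounded \<rho>-length.\<close>

definition quasi_geodesic_path ::
    "('a \<Rightarrow> 'a \<Rightarrow> real) \<Rightarrow> ('a \<times> 'a) set \<Rightarrow> real \<Rightarrow> real \<Rightarrow> (nat \<Rightarrow> 'a) \<Rightarrow> nat \<Rightarrow> bool" where
  "quasi_geodesic_path \<rho> E K C y n \<longleftrightarrow> y 0 \<in> M \<and> (\<forall>i<n. (y i, y (Suc i)) \<in> E) \<and>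
     (\<forall>i\<le>n. \<forall>j\<le>n. \<bar>real i - real j\<bar> \<le> K * \<rho> (y i) (y j) + C)"

end

context delta_hyperbolic begin

text \<open>
  Provides the two ends of the detour around \<open>m0\<close> in the proof of the Morse lemma:
      if \<open>m0\<close> is a point of a geodesic
  that is almost as far as possible from the cover \<open>Q\<close>, one can walk along the geodesic from \<open>m0\<close> until one is
  much farther from \<open>m0\<close> than \<open>B\<close>, and from there to \<open>Q\<close> without coming back to \<open>m0\<close>.
\<close>

lemma path_to_cover_avoiding_ball:
  fixes B :: nat
  assumes cg: "coarse_graph_metric \<rho> E c" and c: "1 \<le> c"
    and e: "e \<in> M" "m0 \<in> M" "e \<in> Q" "Q \<subseteq> M"
    and cover: "\<And>p. p \<in> betw e m0 \<Longrightarrow> \<exists>q\<in>Q. \<rho> p q \<le> real B"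
    and far: "\<And>q. q \<in> Q \<Longrightarrow> \<rho> m0 q > real B - 1"
  defines "S \<equiv> {s \<in> M. \<rho> m0 s > real B - 1}"
  shows "\<exists>a\<in>betw e m0. \<exists>q\<in>Q. \<exists>N. real N \<le> real B + 1 \<and> (a, q) \<in> (E \<inter> S \<times> S) ^^ N \<and>
      \<rho> a m0 \<le> (c+1)*(real B+1)+2 \<and> \<rho> a q \<le> real B"
proof -
  interpret R: Metric_space M \<rho> using cg unfolding coarse_graph_metric_def by blast
  have le: "\<And>a b. a \<in> M \<Longrightarrow> b \<in> M \<Longrightarrow> \<rho> a b \<le> d a b + 1" and EM: "E \<subseteq> M \<times> M"
    and chain: "\<And>a b. a \<in> M \<Longrightarrow> b \<in> M \<Longrightarrow> \<exists>N. real N \<le> \<rho> a b + 1 \<and> (a, b) \<in> E ^^ N"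
    and edge: "\<And>u v m. (u,v) \<in> E \<Longrightarrow> m \<in> betw u v \<Longrightarrow> \<rho> u m \<le> c"
    using cg unfolding coarse_graph_metric_def by blast+
  \<comment> \<open>A path of at most \<open>B + 1\<close> edges of \<rho>-length at most
    \<open>c\<close> that starts farther than \<open>T\<close> from \<open>m0\<close> stays farther
    than \<open>B + 1\<close> from it.\<close>
  define T where "T = (c+1)*(real B+1)"
  have T: "T \<ge> 0" using c unfolding T_def by simp
  show ?thesis
  proof (cases "\<rho> e m0 \<le> T + 2")
    case True
    then show ?thesis using betw_ends[OF e(1,2)] e(3) e(1) unfolding T_def
      by (intro bexI[of _ e] exI[of _ 0]) auto
  next
    case False
    obtain p J where p: "p 0 = m0" "p J = e" "\<And>j. p j \<in> betw m0 e" "\<And>j. d (p j) (p (Suc j)) \<le> 1"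
      using walk[OF e(2,1)] by metis
    have pM: "p j \<in> M" for j using p(3) betwD(1) by blast
    \<comment> \<open>The first point of the walk beyond \<open>T\<close>. A unit step has
      \<rho>-length at most 2, whence the bound \<open>T + 2\<close>.\<close>
    define j where "j = (LEAST j. \<rho> (p j) m0 > T)"
    have ex: "\<rho> (p J) m0 > T" using False p by simp
    then have j: "\<rho> (p j) m0 > T" unfolding j_def by (rule LeastI)
    have "\<rho> (p 0) m0 = 0" using p e by simp
    then have "j \<noteq> 0" using j T by (metis not_less)
    then obtain i where i: "j = Suc i" by (cases j) auto
    have "\<not> \<rho> (p i) m0 > T" unfolding j_def by (rule not_less_Least) (use i j_def in auto)
    moreover have "\<rho> (p j) m0 \<le> \<rho> (p j) (p i) + \<rho> (p i) m0" using R.triangle pM e by auto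
    moreover have "\<rho> (p j) (p i) \<le> 2" using le[OF pM pM, of j i] p(4)[of i] commute[of "p j" "p i"] i by auto
    ultimately have j2: "\<rho> (p j) m0 \<le> T + 2" by linarith
    have pj: "p j \<in> betw e m0" using p(3) betw_commute by auto
    then obtain q where q: "q \<in> Q" "\<rho> (p j) q \<le> real B" using cover by blast
    then have qM: "q \<in> M" using e by auto
    obtain N where N: "real N \<le> \<rho> (p j) q + 1" "(p j, q) \<in> E ^^ N" using chain[OF pM qM] by blast
    have step: "\<rho> (p j) s \<le> c * real l \<and> s \<in> M" if "(p j, s) \<in> E ^^ l" for s l
      using that
    proof (induction l arbitrary: s)
      case 0 then show ?case using pM[of j] by simp
    next
      case (Suc l)
      then obtain t where t: "(p j, t) \<in> E ^^ l" "(t,s) \<in> E" by (auto elim: relpow_Suc_E)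
      have M: "t \<in> M" "s \<in> M" using t EM by auto
      have "\<rho> t s \<le> c" using edge[OF t(2)] betw_ends M by auto
      moreover have "\<rho> (p j) s \<le> \<rho> (p j) t + \<rho> t s" using R.triangle pM M by auto
      ultimately show ?case using Suc.IH[OF t(1)] M by (simp add: algebra_simps)
    qed
    have "(p j, q) \<in> (E \<inter> S \<times> S) ^^ N"
    proof (rule relpow_restrict[OF N(2)])
      fix l s assume l: "l \<le> N" "(p j, s) \<in> E ^^ l"
      have s: "s \<in> M" "\<rho> (p j) s \<le> c * real l" using step[OF l(2)] by auto
      have "c * real l \<le> c * (real B + 1)" using l N q c by (intro mult_left_mono) auto
      moreover have "\<rho> (p j) m0 \<le> \<rho> (p j) s + \<rho> s m0" using R.triangle pM s e by auto
      moreover have "T = c * (real B + 1) + (real B + 1)" unfolding T_def by (simp add: algebra_simps)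
      ultimately have "\<rho> s m0 > real B - 1" using j s by linarith
      then show "s \<in> S" using s R.commute unfolding S_def by auto
    qed
    then show ?thesis using pj q N j2 unfolding T_def by (intro bexI[of _ "p j"] bexI[of _ q] exI[of _
        N]) auto
  qed
qed

text \<open>\<open>D\<close> precedes the quantifiers over \<rho> and \<open>E\<close>, so that one
  bound serves all radii of electrification. Let \<open>B\<close> be the least natural number such
  that the \<open>B\<close>-neighbourhood of the path covers the geodesic; near a point that needs
  almost all of \<open>B\<close>, the path yields a detour that is too short unless \<open>B\<close>
  is bounded.\<close>

lemma morse:
  assumes c: "1 \<le> c" and K: "0 \<le> K"
  shows "\<exists>D\<ge>0. \<forall>\<rho> E y n. coarse_graph_metric \<rho> E c \<longrightarrow> quasi_geodesic_path \<rho> E K C y n \<longrightarrow>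
     (\<forall>m\<in>betw (y 0) (y n). \<exists>i\<le>n. \<rho> m (y i) \<le> D)"
proof -
  \<comment> \<open>\<open>\<alpha> * B + \<beta>\<close> is the length of the detour constructed
    below, with \<open>T = (c + 1) * (B + 1) + 2\<close> multiplied out.\<close>
  define \<alpha> where "\<alpha> = 2 + K * (2 * c + 4)"
  define \<beta> where "\<beta> = 3 + K * (2 * c + 6) + C"
  have "\<alpha> > 0" using c K unfolding \<alpha>_def by (intro add_pos_nonneg mult_nonneg_nonneg) auto
  \<comment> \<open>The coefficient is \<open>4 * \<delta> + 1\<close> so as to be positive even if
    \<delta> is 0. In \<open>c + 2\<close>, the length of an edge contributes \<open>c\<close>, and
    the two units come from \<open>\<rho> a b \<le> d a b + 1\<close> and from
    \<open>B - 1\<close>.\<close>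
  moreover have "4 * \<delta> + 1 > 0" using delta_nonneg by auto
  ultimately obtain D where D: "\<And>B N. B \<ge> D \<Longrightarrow> real N \<le> \<alpha> * B + \<beta> \<Longrightarrow> (\<exists>k. N \<le> 2 ^ k \<and>
      (4 * \<delta> + 1) * real k + (c + 2) < B)"
    using linear_le_power_small_exponent[of \<alpha> "4 * \<delta> + 1" \<beta> "c + 2"] by metis
  have "\<exists>i\<le>n. \<rho> m (y i) \<le> max D 0"
    if cg: "coarse_graph_metric \<rho> E c" and y0: "y 0 \<in> M" and yE: "\<forall>i<n. (y i, y (Suc i)) \<in> E"
      and qg: "\<forall>i\<le>n. \<forall>j\<le>n. \<bar>real i - real j\<bar> \<le> K * \<rho> (y i) (y j) + C" and m: "m \<in> betw (y 0) (y n)"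
    for \<rho> E y n m
  proof -
    interpret R: Metric_space M \<rho> using cg unfolding coarse_graph_metric_def by blast
    have le: "\<And>a b. a \<in> M \<Longrightarrow> b \<in> M \<Longrightarrow> \<rho> a b \<le> d a b + 1" and EM: "E \<subseteq> M \<times> M"
      and symE: "sym E" and reflE: "\<And>a. a \<in> M \<Longrightarrow> (a,a) \<in> E"
      and edge: "\<And>u v m. (u,v) \<in> E \<Longrightarrow> m \<in> betw u v \<Longrightarrow> \<rho> u m \<le> c"
      using cg unfolding coarse_graph_metric_def by blast+
    have yM: "y i \<in> M" if "i \<le> n" for i
    proof (cases i)
      case (Suc j)
      then have "(y j, y i) \<in> E" using yE that by auto
      then show ?thesis using EM by auto
    qed (use y0 in auto)
    define P where "P B \<longleftrightarrow> (\<forall>p\<in>betw (y 0) (y n). \<exists>i\<le>n. \<rho> p (y i) \<le> real B)" for B :: nat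
    \<comment> \<open>Some \<open>B\<close> is admissible: the single point \<open>y 0\<close> is
      already within bounded distance of the whole geodesic.\<close>
    have "P (nat \<lceil>d (y 0) (y n) + 1\<rceil>)" unfolding P_def
    proof (intro ballI exI[of _ 0] conjI)
      fix p assume p: "p \<in> betw (y 0) (y n)"
      have "\<rho> p (y 0) \<le> d p (y 0) + 1" using le p betwD y0 by auto
      also have "d p (y 0) \<le> d (y 0) (y n)" using betwD(2)[OF p] nonneg[of p "y n"] commute[of p
          "y 0"] by linarith
      finally show "\<rho> p (y 0) \<le> real (nat \<lceil>d (y 0) (y n) + 1\<rceil>)" by linarith
    qed auto
    then have PL: "P (LEAST B. P B)" by (rule LeastI)
    define B where "B = (LEAST B. P B)"
    have PB: "\<forall>p\<in>betw (y 0) (y n). \<exists>i\<le>n. \<rho> p (y i) \<le> real B"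
      using PL unfolding B_def[symmetric] unfolding P_def .
    show ?thesis
    proof (cases "real B \<le> max D 0")
      case True
      then show ?thesis using bspec[OF PB m] by force
    next
      case False
      then have "B > 0" "real B \<ge> D" by auto
      \<comment> \<open>By minimality of \<open>B\<close>. An integer stands in for the supremum of
        the distances, at a loss of 1.\<close>
      then have "\<not> P (B - 1)" using not_less_Least[of "B - 1" P] unfolding B_def by auto
      then obtain m0 where m0: "m0 \<in> betw (y 0) (y n)" "\<And>i. i \<le> n \<Longrightarrow> \<rho> m0 (y i) > real B - 1"
        using \<open>B > 0\<close> unfolding P_def by (force simp: of_nat_diff)
      have m0M: "m0 \<in> M" using m0 betwD by auto
      \<comment> \<open>A detour around the ball of radius \<open>B - 1\<close> at \<open>m0\<close>, of length linear in \<open>B\<close>; by thin polygons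
        it must come within a distance of order \<open>log B\<close> of \<open>m0\<close>, which bounds \<open>B\<close>.\<close>
      define S where "S = {s \<in> M. \<rho> m0 s > real B - 1}"
      define F where "F = E \<inter> S \<times> S"
      have symF: "sym F" using symE unfolding F_def sym_def by blast
      define Q where "Q = y ` {..n}"
      have Q: "Q \<subseteq> M" "\<And>q. q \<in> Q \<Longrightarrow> \<rho> m0 q > real B - 1" "y 0 \<in> Q" "y n \<in> Q"
        using yM m0 unfolding Q_def by auto
      have cover: "\<exists>q\<in>Q. \<rho> p q \<le> real B" if "p \<in> betw (y 0) m0 \<or> p \<in> betw (y n) m0" for p
        using that PB betw_left(1)[OF m0(1)] betw_right(1)[OF m0(1)] yM unfolding Q_def
        by (metis atMost_iff betw_commute image_eqI order_refl zero_le)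
      define T where "T = (c+1)*(real B+1)+2"
      obtain a qa Na where a: "a \<in> betw (y 0) m0" "qa \<in> Q" "real Na \<le> real B + 1" "(a, qa) \<in> F ^^ Na"
          "\<rho> a m0 \<le> T" "\<rho> a qa \<le> real B"
        using path_to_cover_avoiding_ball[OF cg c yM m0M Q(3,1) cover Q(2)]
            unfolding S_def[symmetric] F_def[symmetric] T_def by blast
      obtain b qb Nb where b: "b \<in> betw (y n) m0" "qb \<in> Q" "real Nb \<le> real B + 1" "(b, qb) \<in> F ^^ Nb"
          "\<rho> b m0 \<le> T" "\<rho> b qb \<le> real B"
        using path_to_cover_avoiding_ball[OF cg c yM m0M Q(4,1) cover Q(2)]
            unfolding S_def[symmetric] F_def[symmetric] T_def by blast
      obtain i j where ij: "qa = y i" "i \<le> n" "qb = y j" "j \<le> n" using a b unfolding Q_def by auto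
      have M: "a \<in> M" "b \<in> M" "qa \<in> M" "qb \<in> M" using a b betwD Q by auto
      have m0ab: "m0 \<in> betw a b"
      proof -
        have "m0 \<in> betw a (y n)" by (rule betw_left(2)[OF m0(1) a(1)]) (use yM in auto)
        then show ?thesis by (rule betw_right(2)) (use b yM M betw_commute in auto)
      qed
      define n' where "n' = nat \<bar>int i - int j\<bar>"
      have "(y i, y (Suc i)) \<in> F" if "i < n" for i
        using yE m0(2)[of i] m0(2)[of "Suc i"] yM that unfolding F_def S_def by auto
      then have mid: "(qa, qb) \<in> F ^^ n'" unfolding n'_def using relpow_index[OF symF] ij by metis
      \<comment> \<open>The loop makes the path nonempty, as \<open>polygon\<close> requires, even
        if the other three pieces are empty.\<close>
      have loop: "(qa, qa) \<in> F ^^ 1" using reflE M Q(2)[OF a(2)] unfolding F_def S_def by auto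
      define N where "N = Na + (1 + (n' + Nb))"
      have ab: "(a, b) \<in> F ^^ N" unfolding N_def
        by (intro relpow_append[OF a(4)] relpow_append[OF loop] relpow_append[OF mid] relpow_sym[OF
            symF b(4)])
      have "\<rho> qa qb \<le> \<rho> qa a + \<rho> a m0 + \<rho> m0 b + \<rho> b qb"
        using R.triangle[of qa a qb] R.triangle[of a m0 qb] R.triangle[of m0 b qb] M m0M by linarith
      also have "\<dots> \<le> 2 * real B + 2 * T" using a b R.commute[of qa a] R.commute[of m0 b] by linarith
      finally have "K * \<rho> qa qb \<le> K * (2 * real B + 2 * T)" using K by (rule mult_left_mono)
      moreover have "real n' = \<bar>real i - real j\<bar>" unfolding n'_def by linarith
      ultimately have "real n' \<le> K * (2 * real B + 2 * T) + C" using qg ij by force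
      then have "real N \<le> 2 * (real B + 1) + 1 + K * (2 * real B + 2 * T) + C" unfolding N_def
          using a b by simp
      also have "\<dots> \<le> \<alpha> * real B + \<beta>" using K c unfolding \<alpha>_def \<beta>_def T_def by (simp add: algebra_simps)
      finally obtain k where k: "N \<le> 2 ^ k" "(4 * \<delta> + 1) * real k + (c + 2) < real B"
        using D \<open>real B \<ge> D\<close> by blast
      \<comment> \<open>All edges of the detour have their ends in \<open>S\<close>, yet one of them
        comes near \<open>m0\<close>: this puts \<open>u\<close> within
        \<open>4 * \<delta> * k + 1 + c\<close> of \<open>m0\<close> and also farther than
        \<open>B - 1\<close> from it.\<close>
      obtain u v m' where uv: "(u, v) \<in> F" "m' \<in> betw u v" "d m0 m' \<le> 4 * \<delta> * k"
        using polygon[OF _ ab _ k(1) m0ab] EM unfolding F_def N_def by auto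
      have M': "u \<in> M" "m' \<in> M" using uv betwD EM unfolding F_def by auto
      have "\<rho> m0 u \<le> \<rho> m0 m' + \<rho> m' u" using R.triangle m0M M' by auto
      also have "\<rho> m0 m' \<le> 4 * \<delta> * k + 1" using le[OF m0M M'(2)] uv by linarith
      also have "\<rho> m' u \<le> c" using edge[of u v m'] uv R.commute unfolding F_def by auto
      finally have "\<rho> m0 u \<le> 4 * \<delta> * k + 1 + c" by simp
      moreover have "\<rho> m0 u > real B - 1" using uv unfolding F_def S_def by auto
      moreover have "(4 * \<delta> + 1) * real k = 4 * \<delta> * k + k" by (simp add: algebra_simps)
      ultimately have False using k(2) by linarith
      then show ?thesis ..
    qed
  qed
  then show ?thesis unfolding quasi_geodesic_path_def by (intro exI[of _ "max D 0"]) auto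
qed

end

section \<open>Electrified metrics\<close>

context Metric_space begin

definition coarsely_additive :: "('a \<Rightarrow> 'a \<Rightarrow> real) \<Rightarrow> real \<Rightarrow> bool" where
  "coarsely_additive \<rho> A \<longleftrightarrow> Metric_space M \<rho> \<and> (\<forall>a\<in>M. \<forall>b\<in>M. \<rho> a b \<le> d a b + 1) \<and>
     (\<forall>a\<in>M. \<forall>b\<in>M. \<forall>m\<in>betw a b. \<rho> a m + \<rho> m b \<le> \<rho> a b + A)"

end

lemma (in Metric_space) dist_le_relpow:
  assumes "E \<subseteq> M \<times> M" "\<And>u v. (u, v) \<in> E \<Longrightarrow> d u v \<le> c" "a \<in> M" "(a, b) \<in> E ^^ n"
  shows "d a b \<le> c * real n"
  using assms(4)
proof (induction n arbitrary: b)
  case (Suc n)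
  then obtain t where t: "(a, t) \<in> E ^^ n" "(t,b) \<in> E" by (auto elim: relpow_Suc_E)
  then have "d a b \<le> d a t + d t b" using assms triangle by auto
  then show ?case using Suc.IH[OF t(1)] assms(2)[OF t(2)] by (simp add: algebra_simps)
qed (use assms in auto)

context delta_hyperbolic begin

text \<open>A \<rho>-geodesic is a quasi-geodesic path with constants 1 and 0, so by
  \<open>morse\<close> it passes within \<rho>-distance \<open>D\<close> of \<open>m\<close>; going
  through \<open>m\<close> instead costs at most \<open>2 * D\<close>.\<close>

lemma coarse_graph_metric_additive:
  "\<exists>A\<ge>0. \<forall>\<rho> E. coarse_graph_metric \<rho> E 1 \<longrightarrow>
     (\<forall>a\<in>M. \<forall>b\<in>M. \<exists>N. \<rho> a b = real N \<and> (a, b) \<in> E ^^ N) \<longrightarrow> coarsely_additive \<rho> A"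
proof -
  obtain D where D: "D \<ge> 0" "\<And>\<rho> E y n m. coarse_graph_metric \<rho> E 1 \<Longrightarrow> quasi_geodesic_path \<rho> E 1 0 y n \<Longrightarrow>
     m \<in> betw (y 0) (y n) \<Longrightarrow> \<exists>i\<le>n. \<rho> m (y i) \<le> D" using morse[OF order_refl zero_le_one, of 0] by blast
  have "coarsely_additive \<rho> (2 * D)" if cg: "coarse_graph_metric \<rho> E 1"
    and path: "\<forall>a\<in>M. \<forall>b\<in>M. \<exists>N. \<rho> a b = real N \<and> (a, b) \<in> E ^^ N" for \<rho> E
    unfolding coarsely_additive_def
  proof (intro conjI ballI)
    interpret R: Metric_space M \<rho> using cg unfolding coarse_graph_metric_def by blast
    show "Metric_space M \<rho>" by unfold_locales
    show "\<rho> a b \<le> d a b + 1" if "a \<in> M" "b \<in> M" for a b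
      using cg that unfolding coarse_graph_metric_def by blast
    fix a b m assume ab: "a \<in> M" "b \<in> M" and m: "m \<in> betw a b"
    have EM: "E \<subseteq> M \<times> M" and symE: "sym E"
      using cg unfolding coarse_graph_metric_def by blast+
    have edge: "\<rho> u v \<le> 1" if "(u,v) \<in> E" for u v
    proof -
      have "v \<in> betw u v" using betw_ends that EM by blast
      then show ?thesis using cg that unfolding coarse_graph_metric_def by blast
    qed
    obtain N where N: "\<rho> a b = real N" "(a, b) \<in> E ^^ N" using path ab by blast
    then obtain y where y: "y 0 = a" "y N = b" "\<And>i. i < N \<Longrightarrow> (y i, y (Suc i)) \<in> E"
      unfolding relpow_fun_conv by blast
    have yM: "y i \<in> M" if "i \<le> N" for i
    proof (cases i)
      case (Suc j)
      then have "(y j, y i) \<in> E" using y that by auto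
      then show ?thesis using EM by auto
    qed (use y ab in auto)
    have up: "\<rho> (y i) (y j) \<le> \<bar>real i - real j\<bar>" if "i \<le> N" "j \<le> N" for i j
    proof -
      have "\<rho> (y i) (y j) \<le> 1 * real (nat \<bar>int i - int j\<bar>)"
        by (rule R.dist_le_relpow[OF EM edge yM[OF that(1)] relpow_index[where y = y
            and n = N, OF symE y(3) that]]) auto
      then show ?thesis by linarith
    qed
    have low: "real j - real i \<le> \<rho> (y i) (y j)" if "i \<le> N" "j \<le> N" for i j
    proof -
      have "real N \<le> \<rho> (y 0) (y i) + \<rho> (y i) (y j) + \<rho> (y j) (y N)"
        using R.triangle[of "y 0" "y i" "y N"] R.triangle[of "y i" "y j" "y N"] yM that N y by fastforce
      then show ?thesis using up[of 0 i] up[of j N] that by auto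
    qed
    have "\<exists>i\<le>N. \<rho> m (y i) \<le> D"
    proof (rule D(2)[OF cg])
      have "\<bar>real i - real j\<bar> \<le> 1 * \<rho> (y i) (y j) + 0" if "i \<le> N" "j \<le> N" for i j
        using low[of i j] low[of j i] R.commute[of "y i" "y j"] that by linarith
      then show "quasi_geodesic_path \<rho> E 1 0 y N" unfolding quasi_geodesic_path_def using y ab by blast
      show "m \<in> betw (y 0) (y N)" using y(1,2) m by simp
    qed
    then obtain i where i: "i \<le> N" "\<rho> m (y i) \<le> D" by blast
    have mM: "m \<in> M" using m betwD by auto
    have "\<rho> a m \<le> real i + D"
      using R.triangle[of a "y i" m] up[of 0 i] i y yM[OF i(1)] mM ab R.commute[of m "y i"] by auto
    moreover have "\<rho> m b \<le> real N - real i + D"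
      using R.triangle[of m "y i" b] up[of i N] i y yM[OF i(1)] mM ab by auto
    ultimately show "\<rho> a m + \<rho> m b \<le> \<rho> a b + 2 * D" using N by auto
  qed
  then show ?thesis using D(1) by (intro exI[of _ "2 * D"]) auto
qed

text \<open>Up to constants, the Gromov product for \<rho> is the \<rho>-distance from
  \<open>w\<close> to the side \<open>p r\<close>: by \<open>up\<close> no point of the side is much
  closer, and by \<open>low\<close> the centre of the triangle nearly attains the bound. Thinness
  for \<open>d\<close> then gives hyperbolicity, and \<open>\<rho> a b \<le> d a b + 1\<close> the
  comparison of products.\<close>

lemma
  assumes add: "coarsely_additive \<rho> A"
  shows coarsely_additive_hyperbolic: "Metric_space.gromov_hyperbolic M \<rho>"
    and coarsely_additive_product:
      "\<exists>B. \<forall>w\<in>M. \<forall>p\<in>M. \<forall>r\<in>M. Metric_space.gromov_product \<rho> w p r \<le> gromov_product w p r + B"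
proof -
  interpret R: Metric_space M \<rho> using add unfolding coarsely_additive_def by blast
  have le: "\<And>a b. a \<in> M \<Longrightarrow> b \<in> M \<Longrightarrow> \<rho> a b \<le> d a b + 1"
    and ad: "\<And>a b m. a \<in> M \<Longrightarrow> b \<in> M \<Longrightarrow> m \<in> betw a b \<Longrightarrow> \<rho> a m + \<rho> m b \<le> \<rho> a b + A"
    using add unfolding coarsely_additive_def by blast+
  define e where "e = 4 * \<delta> + 1"
  have near: "\<rho> a b \<le> e" if "d a b \<le> 4 * \<delta>" "a \<in> M" "b \<in> M" for a b
    using le[of a b] that unfolding e_def by auto
  have up: "R.gromov_product w p r \<le> \<rho> w u + A / 2"
    if "w \<in> M" "p \<in> M" "r \<in> M" "u \<in> betw p r" for w p r u
  proof -
    have "u \<in> M" using that betwD by auto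
    then have "\<rho> w p \<le> \<rho> w u + \<rho> u p" "\<rho> w r \<le> \<rho> w u + \<rho> u r" using that R.triangle by auto
    moreover have "\<rho> p u + \<rho> u r \<le> \<rho> p r + A" using ad that by auto
    moreover have "R.gromov_product w p r = (\<rho> w p + \<rho> w r - \<rho> p r) / 2"
      unfolding R.gromov_product_def using R.commute[of w p] R.commute[of w r] by simp
    ultimately have "2 * R.gromov_product w p r \<le> 2 * \<rho> w u + A" using R.commute[of u p] by simp
    then show ?thesis by simp
  qed
  \<comment> \<open>The centre is close to all three sides of the triangle, so that additivity along
    \<open>w p\<close> and \<open>w r\<close> and the triangle inequality for \<open>p r\<close>
    give the converse of \<open>up\<close>.\<close>
  have low: "\<exists>m u. m \<in> M \<and> d w m = gromov_product w p r \<and> u \<in> betw p r \<and> d m u \<le> 4 * \<delta> \<and> 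
      \<rho> w m \<le> R.gromov_product w p r + A + e" if M: "w \<in> M" "p \<in> M" "r \<in> M" for w p r
  proof -
    obtain m m1 m2 where m: "m \<in> betw w p" "d w m = gromov_product w p r"
    "m1 \<in> betw p r" "d m m1 \<le> 4 * \<delta>" "m2 \<in> betw w r" "d m m2 \<le> 4 * \<delta>" using center[OF M] by metis
    have mM: "m \<in> M" "m2 \<in> M" using m betwD by auto
    have "\<rho> w m + \<rho> m p \<le> \<rho> w p + A" "\<rho> w m2 + \<rho> m2 r \<le> \<rho> w r + A" using ad M m by auto
    moreover have "\<rho> w m \<le> \<rho> w m2 + \<rho> m2 m" "\<rho> m r \<le> \<rho> m m2 + \<rho> m2 r" "\<rho> m m2 \<le> e" "\<rho> p r \<le> \<rho> p m + \<rho> m r"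
      using R.triangle M mM near m by auto
    ultimately have "2 * \<rho> w m \<le> (\<rho> p w + \<rho> r w - \<rho> p r) + 2 * A + 2 * e"
      using R.commute[of m2 m] R.commute[of p m] R.commute[of p w] R.commute[of r w] by linarith
    then have "\<rho> w m \<le> R.gromov_product w p r + A + e" unfolding R.gromov_product_def
        by (simp add: field_simps)
    then show ?thesis using m mM by blast
  qed
  show "R.gromov_hyperbolic"
  proof (rule R.gromov_hyperbolicI)
    fix w x y z assume M: "w \<in> M" "x \<in> M" "y \<in> M" "z \<in> M"
    obtain m u where m: "m \<in> M" "u \<in> betw x z" "d m u \<le> 4 * \<delta>" "\<rho> w m \<le> R.gromov_product w x z + A + e"
      using low[of w x z] M by blast
    obtain u' where u': "u' \<in> betw x y \<union> betw y z" "d u u' \<le> 4 * \<delta>" using thin M m by metis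
    have M': "u \<in> M" "u' \<in> M" using m u' betwD by auto
    have "\<rho> w u' \<le> \<rho> w m + \<rho> m u + \<rho> u u'"
      using R.triangle[of w m u'] R.triangle[of m u u'] M M' m by linarith
    also have "\<dots> \<le> \<rho> w m + 2 * e" using near[of m u] near[of u u'] m M' u' by linarith
    finally have "\<rho> w u' \<le> R.gromov_product w x z + A + 3 * e" using m by linarith
    moreover have "R.gromov_product w x y \<le> \<rho> w u' + A/2 \<or> R.gromov_product w y z \<le> \<rho> w u' + A/2"
      using u' up M by auto
    ultimately show "R.gromov_product w x z \<ge> min (R.gromov_product w x y) (R.gromov_product w y z) -
        (3 * A / 2 + 3 * e)"
      by auto
  qed
  show "\<exists>B. \<forall>w\<in>M. \<forall>p\<in>M. \<forall>r\<in>M. R.gromov_product w p r \<le> gromov_product w p r + B"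
  proof (intro exI ballI)
    fix w p r assume M: "w \<in> M" "p \<in> M" "r \<in> M"
    obtain m u where m: "m \<in> M" "d w m = gromov_product w p r" "u \<in> betw p r" "d m u \<le> 4 * \<delta>"
        using low M by blast
    have "u \<in> M" using m betwD by auto
    then have "\<rho> w u \<le> \<rho> w m + \<rho> m u" using M m R.triangle by auto
    then show "R.gromov_product w p r \<le> gromov_product w p r + (A / 2 + 1 + e)"
      using up[OF M m(3)] near[of m u] le[of w m] M m \<open>u \<in> M\<close> by linarith
  qed
qed

end

section \<open>Graph metrics and electrification\<close>

definition graph_dist :: "('a \<times> 'a) set \<Rightarrow> 'a \<Rightarrow> 'a \<Rightarrow> real" where
  "graph_dist E a b = real (LEAST N. (a, b) \<in> E ^^ N)"

lemma graph_dist_le: "(a, b) \<in> E ^^ N \<Longrightarrow> graph_dist E a b \<le> real N"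
  unfolding graph_dist_def by (simp add: Least_le)

lemma graph_distE:
  assumes "(a, b) \<in> E ^^ N" obtains n where "graph_dist E a b = real n" "(a, b) \<in> E ^^ n"
  using assms LeastI[where P = "\<lambda>N. (a, b) \<in> E ^^ N" and k = N] unfolding graph_dist_def by blast

lemma graph_dist_metric:
  assumes "sym E" "\<And>a b. a \<in> M \<Longrightarrow> b \<in> M \<Longrightarrow> \<exists>N. (a, b) \<in> E ^^ N"
  shows "Metric_space M (graph_dist E)"
proof
  show "0 \<le> graph_dist E x y" for x y by (simp add: graph_dist_def)
  have "(x, y) \<in> E ^^ N \<longleftrightarrow> (y, x) \<in> E ^^ N" for x y N using relpow_sym[OF assms(1)] by blast
  then show "graph_dist E x y = graph_dist E y x" for x y unfolding graph_dist_def by simp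
  fix x y assume M: "x \<in> M" "y \<in> M"
  show "(graph_dist E x y = 0) = (x = y)"
  proof
    assume "graph_dist E x y = 0"
    then show "x = y" using assms(2)[OF M] graph_distE[where a = x and b = y and E = E]
        by (metis of_nat_eq_0_iff relpow_0_E)
  next
    assume "x = y"
    then have "(x, y) \<in> E ^^ 0" by simp
    then show "graph_dist E x y = 0" using graph_dist_le by (fastforce simp: graph_dist_def)
  qed
  fix z assume z: "z \<in> M"
  obtain m n where "graph_dist E x y = real m" "(x,y) \<in> E ^^ m" "graph_dist E y z = real n" "(y,z) \<in> E ^^ n"
    using assms(2) graph_distE M z by metis
  then show "graph_dist E x z \<le> graph_dist E x y + graph_dist E y z"
    using graph_dist_le[OF relpow_append] by fastforce
qed

text \<open>The whole of \<open>betw p q\<close> is tested rather than one geodesic, so that the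
  relation is symmetric and invariant under a group of isometries that preserves
  \<open>Z\<close>.\<close>

definition (in Metric_space) electric_edges :: "'a set \<Rightarrow> real \<Rightarrow> ('a \<times> 'a) set" where
  "electric_edges Z r = {(p, q) \<in> M \<times> M. d p q \<le> 1 \<or> (\<forall>m\<in>betw p q. \<forall>z\<in>Z. r \<le> d m z)}"

context delta_hyperbolic begin

lemma electric_path:
  assumes "a \<in> M" "b \<in> M" shows "\<exists>N. real N \<le> d a b + 1 \<and> (a, b) \<in> electric_edges Z r ^^ N"
proof -
  obtain p J where p: "p 0 = a" "p J = b" "\<And>j. p j \<in> betw a b" "\<And>j. d (p j) (p (Suc j)) \<le> 1"
      "real J \<le> d a b + 1"
    using walk[OF assms] by metis
  have "p j \<in> M" for j using p(3) betwD by blast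
  then have "\<forall>i<J. (p i, p (Suc i)) \<in> electric_edges Z r"
    using p(4) unfolding electric_edges_def by auto
  then have "(a, b) \<in> electric_edges Z r ^^ J" unfolding relpow_fun_conv using p by blast
  then show ?thesis using p by blast
qed

lemma electric_graph:
  fixes Z r
  defines "E \<equiv> electric_edges Z r"
  shows "sym E"
    and electric_metric: "Metric_space M (graph_dist E)"
    and electric_dist_le: "\<And>a b. a \<in> M \<Longrightarrow> b \<in> M \<Longrightarrow> graph_dist E a b \<le> d a b + 1"
    and electric_geodesic: "\<And>a b. a \<in> M \<Longrightarrow> b \<in> M \<Longrightarrow> \<exists>N. graph_dist E a b = real N \<and> (a, b) \<in> E ^^ N"
    and electric_coarse_graph_metric: "coarse_graph_metric (graph_dist E) E 1"
proof -
  show s: "sym E" unfolding E_def electric_edges_def sym_def by (auto simp: commute betw_commute)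
  show m: "Metric_space M (graph_dist E)" 
  proof (rule graph_dist_metric[OF s])
    show "\<exists>N. (a, b) \<in> E ^^ N" if "a \<in> M" "b \<in> M" for a b
      using electric_path[OF that, of Z r] unfolding E_def by blast
  qed
  show le: "graph_dist E a b \<le> d a b + 1" if ab: "a \<in> M" "b \<in> M" for a b
  proof -
    obtain N where "real N \<le> d a b + 1" "(a, b) \<in> E ^^ N" using electric_path[OF ab, of Z r]
        unfolding E_def by blast
    then show ?thesis using graph_dist_le[of a b N E] by linarith
  qed
  show path: "\<exists>N. graph_dist E a b = real N \<and> (a, b) \<in> E ^^ N" if ab: "a \<in> M" "b \<in> M" for a b
  proof -
    obtain N where "(a, b) \<in> E ^^ N" using electric_path[OF ab, of Z r] unfolding E_def by blast
    then show ?thesis by (rule graph_distE) blast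
  qed
  \<comment> \<open>Both kinds of edges are hereditary: if \<open>u\<close> and \<open>v\<close> are
    adjacent, then \<open>u\<close> is adjacent to every point between them.\<close>
  have edge: "graph_dist E u m \<le> 1" if uv: "(u, v) \<in> E" and m: "m \<in> betw u v" for u v m
  proof -
    have M: "u \<in> M" "v \<in> M" "m \<in> M" using uv betwD m unfolding E_def electric_edges_def by auto
    have "(u, m) \<in> E"
    proof (cases "d u v \<le> 1")
      case True
      have "d u m \<le> d u v" using betwD(2)[OF m] nonneg[of m v] by linarith
      then show ?thesis using True M unfolding E_def electric_edges_def by auto
    next
      case False
      then have "\<forall>m\<in>betw u v. \<forall>z\<in>Z. r \<le> d m z" using uv unfolding E_def electric_edges_def by auto
      then show ?thesis using M betw_left(1)[OF m] unfolding E_def electric_edges_def by auto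
    qed
    then show ?thesis using graph_dist_le[of u m 1 E] by simp
  qed
  show "coarse_graph_metric (graph_dist E) E 1" unfolding coarse_graph_metric_def
  proof (intro conjI ballI)
    show "E \<subseteq> M \<times> M" "Id_on M \<subseteq> E" unfolding E_def electric_edges_def by auto
    show "\<exists>N. real N \<le> graph_dist E a b + 1 \<and> (a, b) \<in> E ^^ N" if ab: "a \<in> M" "b \<in> M" for a b
      using path[OF ab] by force
  qed (use s m le edge in auto)
qed

text \<open>The constant comes from \<open>morse\<close> and does not see \<open>Z\<close> or
  \<open>r\<close>; this is what allows \<open>r\<close> to be chosen afterwards.\<close>

lemma electric_additive: "\<exists>A\<ge>0. \<forall>Z r. coarsely_additive (graph_dist (electric_edges Z r)) A"
proof -
  obtain A where "A \<ge> 0" "\<And>\<rho> E. coarse_graph_metric \<rho> E 1 \<Longrightarrow>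
     (\<forall>a\<in>M. \<forall>b\<in>M. \<exists>N. \<rho> a b = real N \<and> (a, b) \<in> E ^^ N) \<Longrightarrow> coarsely_additive \<rho> A"
    using coarse_graph_metric_additive by blast
  then show ?thesis using electric_coarse_graph_metric electric_geodesic by blast
qed

text \<open>Go from \<open>p\<close> towards an almost nearest point \<open>z\<close> of
  \<open>Z\<close>. Until the distance \<open>r + 1\<close> from \<open>z\<close> is reached, one
  edge suffices; the remainder costs at most \<open>r + 2\<close>. Stopping at \<open>r + 1\<close>
  instead of \<open>r\<close> pays for \<open>z\<close> being nearest only up to 1.\<close>

lemma electric_cobounded:
  assumes "p \<in> M" "Z \<subseteq> M" "Z \<noteq> {}" "0 \<le> r"
  shows "\<exists>z\<in>Z. graph_dist (electric_edges Z r) p z \<le> r + 3"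
proof -
  define E where "E = electric_edges Z r"
  interpret R: Metric_space M "graph_dist E" unfolding E_def by (rule electric_metric)
  obtain z where z: "z \<in> Z" "\<And>z'. z' \<in> Z \<Longrightarrow> d p z \<le> d p z' + 1"
  proof -
    define I where "I = Inf (d p ` Z)"
    have b: "bdd_below (d p ` Z)" by (intro bdd_belowI[of _ 0]) auto
    obtain z where "z \<in> Z" "d p z < I + 1"
      using cInf_lessD[of "d p ` Z" "I + 1"] assms unfolding I_def by auto
    moreover have "I \<le> d p z'" if "z' \<in> Z" for z' unfolding I_def
        by (rule cInf_lower[OF _ b]) (use that in auto)
    ultimately show ?thesis using that by fastforce
  qed
  have zM: "z \<in> M" using z assms by auto
  show ?thesis
  proof (cases "d p z \<le> r + 1")
    case True
    then show ?thesis using electric_dist_le[of p z Z r] assms zM z by force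
  next
    case False
    obtain m where m: "m \<in> betw p z" "d p m = d p z - (r + 1)" "d m z = r + 1"
      using point_at[of p z "d p z - (r + 1)"] assms zM False by auto
    have mM: "m \<in> M" using m betwD by auto
    have "r \<le> d u z'" if "u \<in> betw p m" "z' \<in> Z" for u z'
    proof -
      have "d p z' \<le> d p u + d u z'" using triangle betwD(1)[OF that(1)] assms that by auto
      moreover have "d p u \<le> d p m" using betwD(2)[OF that(1)] nonneg[of u m] by linarith
      ultimately show ?thesis using z(2)[OF that(2)] m by linarith
    qed
    then have "(p, m) \<in> E ^^ 1" using assms mM unfolding E_def electric_edges_def by auto
    then have "graph_dist E p m \<le> 1" using graph_dist_le by fastforce
    moreover have "graph_dist E m z \<le> r + 2" using electric_dist_le[of m z Z r] mM zM m
        unfolding E_def by auto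
    moreover have "graph_dist E p z \<le> graph_dist E p m + graph_dist E m z"
        using R.triangle assms mM zM by auto
    ultimately show ?thesis using z unfolding E_def by force
  qed
qed

end

section \<open>Orbits of loxodromic elements\<close>

sublocale isometric_action \<subseteq> grp: group G
  using group_hom group_hom.axioms(1) by auto

context isometric_action begin

lemma act_closed: "h \<in> carrier G \<Longrightarrow> x \<in> M \<Longrightarrow> \<phi> h x \<in> M"
  using element_image by blast

lemma act_one: "x \<in> M \<Longrightarrow> \<phi> \<one> x = x"
  by (metis id_eq_one restrict_apply')

lemma act_inv: "h \<in> carrier G \<Longrightarrow> x \<in> M \<Longrightarrow> \<phi> (inv h) (\<phi> h x) = x"
  using orbit_sym_aux by blast

lemma act_inv': "h \<in> carrier G \<Longrightarrow> x \<in> M \<Longrightarrow> \<phi> h (\<phi> (inv h) x) = x"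
  using act_inv[of "inv h"] by simp

lemma pow_closed: "h \<in> carrier G \<Longrightarrow> x \<in> M \<Longrightarrow> \<phi> (h [^] (n::int)) x \<in> M"
  by (simp add: act_closed)

lemma pow_add:
  assumes "h \<in> carrier G" "x \<in> M"
  shows "\<phi> (h [^] (m + n :: int)) x = \<phi> (h [^] m) (\<phi> (h [^] n) x)"
  using assms by (simp add: composition_rule grp.int_pow_mult)

lemma pow_isometry:
  assumes "h \<in> carrier G" "x \<in> M"
  shows "d (\<phi> (h [^] (m::int)) x) (\<phi> (h [^] (n::int)) x) = d x (\<phi> (h [^] (n - m)) x)"
proof -
  have "d (\<phi> (h [^] m) x) (\<phi> (h [^] (m + (n - m))) x) = d x (\<phi> (h [^] (n - m)) x)"
    unfolding pow_add[OF assms] using assms by (intro isometry) (auto simp: pow_closed)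
  then show ?thesis by simp
qed

lemma pow_zero: "x \<in> M \<Longrightarrow> \<phi> (h [^] (0::int)) x = x"
  by (simp add: act_one)

lemma pow_neg_dist:
  assumes "h \<in> carrier G" "x \<in> M"
  shows "d x (\<phi> (h [^] (- n :: int)) x) = d x (\<phi> (h [^] n) x)"
  using pow_isometry[OF assms, of n 0] pow_zero assms commute by simp

lemma pow_abs_dist:
  assumes "h \<in> carrier G" "x \<in> M"
  shows "d x (\<phi> (h [^] (\<bar>n\<bar> :: int)) x) = d x (\<phi> (h [^] n) x)"
  using pow_neg_dist[OF assms] by (simp add: abs_if)

lemma pow_dist_le:
  assumes "h \<in> carrier G" "x \<in> M"
  shows "d x (\<phi> (h [^] (n::int)) x) \<le> real_of_int \<bar>n\<bar> * d x (\<phi> h x)"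
proof -
  have *: "d x (\<phi> (h [^] (int n)) x) \<le> n * d x (\<phi> h x)" for n
  proof (induction n)
    case 0 then show ?case using assms pow_zero[of x h] by simp
  next
    case (Suc n)
    have "d x (\<phi> (h [^] (int (Suc n))) x) \<le> d x (\<phi> (h [^] (int n)) x) + d (\<phi> (h [^] (int n)) x) (\<phi> (h
        [^] (int (Suc n))) x)"
      using assms pow_closed by (intro triangle) auto
    moreover have "d (\<phi> (h [^] (int n)) x) (\<phi> (h [^] (int (Suc n))) x) = d x (\<phi> h x)"
      using pow_isometry[OF assms, of "int n" "int (Suc n)"] assms grp.int_pow_1[of h] by simp
    ultimately show ?case using Suc by (simp add: algebra_simps)
  qed
  have "d x (\<phi> (h [^] n) x) = d x (\<phi> (h [^] \<bar>n\<bar>) x)" using pow_abs_dist[OF assms] by simp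
  also have "\<bar>n\<bar> = int (nat \<bar>n\<bar>)" by simp
  finally show ?thesis using *[of "nat \<bar>n\<bar>"] by simp
qed

text \<open>A lower bound from the base point is enough: isometry reduces two exponents to their
  difference, and \<open>pow_dist_le\<close> supplies the upper bound.\<close>

lemma loxodromicI:
  assumes "h \<in> carrier G" "x \<in> M" "1 \<le> K" "0 \<le> C" "\<And>n::int. real_of_int \<bar>n\<bar> / K - C \<le> d x (\<phi> (h [^] n) x)"
  shows "loxodromic h"
  unfolding loxodromic_def quasi_isometric_embedding_def
proof (intro conjI bexI[OF _ assms(2)])
  define L where "L = max K (d x (\<phi> h x))"
  have L: "L \<ge> 1" "L \<ge> K" "d x (\<phi> h x) \<le> L" using assms unfolding L_def by auto
  have "real_of_int \<bar>m - n\<bar> / L - C \<le> d (\<phi> (h [^] m) x) (\<phi> (h [^] n) x) \<and>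
       d (\<phi> (h [^] m) x) (\<phi> (h [^] n) x) \<le> L * real_of_int \<bar>m - n\<bar> + C" for m n :: int
  proof -
    have e: "real_of_int \<bar>n - m\<bar> = real_of_int \<bar>m - n\<bar>" by simp
    have "real_of_int \<bar>m - n\<bar> / L \<le> real_of_int \<bar>m - n\<bar> / K" using L assms by (intro divide_left_mono) auto
    moreover have "real_of_int \<bar>m - n\<bar> * d x (\<phi> h x) \<le> L * real_of_int \<bar>m - n\<bar>" using L
        by (simp add: mult.commute mult_right_mono)
    ultimately show ?thesis unfolding pow_isometry[OF assms(1,2)]
      using assms(5)[of "n - m"] pow_dist_le[OF assms(1,2), of "n-m"] assms(4) unfolding e by linarith
  qed
  then show "\<exists>K\<ge>1. \<exists>C\<ge>0. \<forall>xa\<in>UNIV. \<forall>y\<in>UNIV. real_of_int \<bar>xa - y\<bar> / K - C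
                \<le> d (\<phi> (h [^] xa) x) (\<phi> (h [^] y) x) \<and>
                d (\<phi> (h [^] xa) x) (\<phi> (h [^] y) x) \<le> K * real_of_int \<bar>xa - y\<bar> + C"
    using L assms(4) by blast
qed (use assms pow_closed in auto)

text \<open>Frees the base point: replacing the orbit of \<open>y\<close> by that of
  \<open>x\<close> changes the distances in question by at most \<open>2 * d x y\<close>.\<close>

lemma loxodromicE:
  assumes "loxodromic h" "x \<in> M"
  obtains K C where "1 \<le> K" "0 \<le> C" "\<And>n::int. real_of_int \<bar>n\<bar> / K - C \<le> d x (\<phi> (h [^] n) x)"
proof -
  obtain y K C where h: "h \<in> carrier G" "y \<in> M" "1 \<le> K" "0 \<le> C"
    and low: "\<And>m n :: int. real_of_int \<bar>m - n\<bar> / K - C \<le> d (\<phi> (h [^] m) y) (\<phi> (h [^] n) y)"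
    using assms unfolding loxodromic_def quasi_isometric_embedding_def by blast
  have "real_of_int \<bar>n\<bar> / K - (C + 2 * d x y) \<le> d x (\<phi> (h [^] n) x)" for n :: int
  proof -
    have "real_of_int \<bar>n\<bar> / K - C \<le> d y (\<phi> (h [^] n) y)" using low[of 0 n] pow_zero h by simp
    also have "\<dots> \<le> d y x + d x (\<phi> (h [^] n) x) + d (\<phi> (h [^] n) x) (\<phi> (h [^] n) y)"
      using triangle[of y x "\<phi> (h [^] n) y"] triangle[of x "\<phi> (h [^] n) x" "\<phi> (h [^] n) y"] h assms
          pow_closed by fastforce
    also have "d (\<phi> (h [^] n) x) (\<phi> (h [^] n) y) = d x y" using h assms by (intro isometry) auto
    finally show ?thesis using commute[of x y] by linarith
  qed
  then show ?thesis using that[of K "C + 2 * d x y"] h by simp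
qed

lemma loxodromic_carrier: "loxodromic h \<Longrightarrow> h \<in> carrier G"
  unfolding loxodromic_def by simp

lemma act_betw:
  assumes "h \<in> carrier G" "a \<in> M" "b \<in> M" "m \<in> betw a b"
  shows "\<phi> h m \<in> betw (\<phi> h a) (\<phi> h b)"
  using assms act_closed isometry unfolding betw_def by auto

lemma act_betwE:
  assumes "h \<in> carrier G" "a \<in> M" "b \<in> M" "u \<in> betw (\<phi> h a) (\<phi> h b)"
  obtains m where "m \<in> betw a b" "u = \<phi> h m"
proof -
  have "\<phi> (inv h) u \<in> betw (\<phi> (inv h) (\<phi> h a)) (\<phi> (inv h) (\<phi> h b))"
    using assms act_closed by (intro act_betw) auto
  then show ?thesis using that act_inv act_inv' assms betwD(1) by metis
qed

end

section \<open>Geodesics between points of a loxodromic orbit\<close>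

locale delta_hyperbolic_action = isometric_action G M d \<phi> + delta_hyperbolic M d \<delta>
  for G :: "('g, 'm) monoid_scheme" (structure) and M :: "'a set" and d \<phi> \<delta>
begin

text \<open>The Morse lemma for \<open>d\<close> itself, with edges long enough to join consecutive
  points of the orbit.\<close>

lemma betw_near_orbit:
  assumes lox: "loxodromic h" and x: "x \<in> M"
  obtains r where "r \<ge> 0" "\<And>(n::nat) m. m \<in> betw x (\<phi> (h [^] int n) x) \<Longrightarrow> \<exists>i\<le>n. d m (\<phi> (h [^] int i) x) \<le> r"
proof -
  note h = loxodromic_carrier[OF lox]
  obtain K C where K: "1 \<le> K" "0 \<le> C" "\<And>n::int. real_of_int \<bar>n\<bar> / K - C \<le> d x (\<phi> (h [^] n) x)"
      using loxodromicE[OF lox x] by metis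
  \<comment> \<open>At least 1, so that walks by unit steps are chains in \<open>E\<close>.\<close>
  define c where "c = max 1 (d x (\<phi> h x))"
  define E where "E = {(p,q) \<in> M \<times> M. d p q \<le> c}"
  have cg: "coarse_graph_metric d E c" unfolding coarse_graph_metric_def
  proof (intro conjI ballI)
    show "Metric_space M d" by unfold_locales
    show "sym E" unfolding E_def sym_def by (auto simp: commute)
    show "E \<subseteq> M \<times> M" "Id_on M \<subseteq> E" unfolding E_def c_def by auto
    show "case uv of (u,v) \<Rightarrow> \<forall>m\<in>betw u v. d u m \<le> c" if uv: "uv \<in> E" for uv
    proof (clarify)
      fix u v m assume "uv = (u,v)" and m: "m \<in> betw u v"
      then have "d u v \<le> c" using uv unfolding E_def by auto
      then show "d u m \<le> c" using betwD(2)[OF m] nonneg[of m v] by linarith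
    qed
    fix a b assume ab: "a \<in> M" "b \<in> M"
    show "d a b \<le> d a b + 1" by simp
    obtain p J where p: "p 0 = a" "p J = b" "\<And>j. p j \<in> betw a b" "\<And>j. d (p j) (p (Suc j)) \<le> 1"
        "real J \<le> d a b + 1"
      using walk[OF ab] by metis
    have "(p i, p (Suc i)) \<in> E" for i
      using p(4)[of i] p(3) betwD unfolding E_def c_def by auto
    then have "(a, b) \<in> E ^^ J" unfolding relpow_fun_conv using p by blast
    then show "\<exists>N. real N \<le> d a b + 1 \<and> (a, b) \<in> E ^^ N" using p by blast
  qed
  have c: "1 \<le> c" unfolding c_def by simp
  have "0 \<le> K" using K by simp
  obtain D where D: "D \<ge> 0" "\<And>y n m. quasi_geodesic_path d E K (K * C) y n \<Longrightarrow>
     m \<in> betw (y 0) (y n) \<Longrightarrow> \<exists>i\<le>n. d m (y i) \<le> D" using morse[OF c \<open>0 \<le> K\<close>, of "K * C"] cg by blast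
  show thesis
  proof (rule that[OF D(1)])
    fix n m assume m: "m \<in> betw x (\<phi> (h [^] int n) x)"
    define y where "y i = \<phi> (h [^] int i) x" for i
    have yy: "d (y i) (y j) = d x (\<phi> (h [^] (int j - int i)) x)" for i j
      unfolding y_def by (rule pow_isometry[OF h x])
    have "\<exists>i\<le>n. d m (y i) \<le> D"
    proof (rule D(2))
      have y0: "y 0 = x" using x pow_zero unfolding y_def by simp
      then show "m \<in> betw (y 0) (y n)" using m unfolding y_def by simp
      have "d (y i) (y (Suc i)) \<le> c" for i unfolding yy c_def using grp.int_pow_1 h by simp
      then have yE: "\<forall>i<n. (y i, y (Suc i)) \<in> E" unfolding E_def using pow_closed h x unfolding y_def by auto
      have "\<bar>real i - real j\<bar> \<le> K * d (y i) (y j) + K * C" for i j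
      proof -
        have "real_of_int \<bar>int j - int i\<bar> / K - C \<le> d (y i) (y j)" unfolding yy by (rule K)
        then have "K * (\<bar>int j - int i\<bar> / K) \<le> K * (d (y i) (y j) + C)" using K by (intro mult_left_mono) auto
        then show ?thesis using K by (simp add: algebra_simps abs_minus_commute)
      qed
      then show "quasi_geodesic_path d E K (K * C) y n" unfolding quasi_geodesic_path_def
          using yE y0 x by blast
    qed
    then show "\<exists>i\<le>n. d m (\<phi> (h [^] int i) x) \<le> D" unfolding y_def .
  qed
qed

text \<open>The other half of the Morse lemma, by connectedness: along the geodesic, the nearby
  orbit points have index at most \<open>k\<close> at the start and at least \<open>k\<close> at the
  end. Where this changes, two orbit points with indices on either side of \<open>k\<close> are
  close together, so that both indices are close to \<open>k\<close>.\<close>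

lemma orbit_near_betw:
  assumes lox: "loxodromic h" and x: "x \<in> M"
  obtains r where "r \<ge> 0" "\<And>(k::nat) n. k \<le> n \<Longrightarrow> \<exists>p\<in>betw x (\<phi> (h [^] int n) x). d p (\<phi> (h [^] int k) x) \<le> r"
proof -
  note h = loxodromic_carrier[OF lox]
  obtain K C where K: "1 \<le> K" "0 \<le> C" "\<And>n::int. real_of_int \<bar>n\<bar> / K - C \<le> d x (\<phi> (h [^] n) x)"
      using loxodromicE[OF lox x] by metis
  obtain r0 where r0: "r0 \<ge> 0" "\<And>(n::nat) m. m \<in> betw x (\<phi> (h [^] int n) x) \<Longrightarrow>
      \<exists>i\<le>n. d m (\<phi> (h [^] int i) x) \<le> r0"
    using betw_near_orbit[OF assms] by metis
  define L where "L = d x (\<phi> h x)"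
  define y where "y i = \<phi> (h [^] int i) x" for i
  have yy: "d (y i) (y j) = d x (\<phi> (h [^] (int j - int i)) x)" for i j
    unfolding y_def by (rule pow_isometry[OF h x])
  have yM: "y i \<in> M" for i unfolding y_def using h x pow_closed by simp
  have low: "\<bar>real i - real j\<bar> \<le> K * (d (y i) (y j) + C)" for i j
  proof -
    have "real_of_int \<bar>int j - int i\<bar> / K - C \<le> d (y i) (y j)" unfolding yy by (rule K)
    then have "K * (\<bar>int j - int i\<bar> / K) \<le> K * (d (y i) (y j) + C)" using K by (intro mult_left_mono) auto
    then show ?thesis using K by (simp add: algebra_simps abs_minus_commute)
  qed
  have up: "d (y i) (y j) \<le> L * \<bar>real i - real j\<bar>" for i j
    unfolding yy L_def using pow_dist_le[OF h x, of "int j - int i"]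
        by (simp add: mult.commute abs_minus_commute)
  \<comment> \<open>The two orbit points are at distance at most \<open>2 * r0 + 1\<close>; the
    factor \<open>K\<close> turns this into a bound on indices, and \<open>L\<close> turns indices
    back into distance.\<close>
  define R where "R = r0 + L * (K * (2 * r0 + 1 + C))"
  have L: "L \<ge> 0" unfolding L_def by simp
  have "\<exists>p\<in>betw x (y n). d p (y k) \<le> R" if kn: "k \<le> n" for k n
  proof -
    obtain p J where p: "p 0 = x" "p J = y n" "\<And>j. p j \<in> betw x (y n)" "\<And>j. d (p j) (p (Suc j)) \<le> 1"
      using walk[OF x yM] by metis
    have pM: "p j \<in> M" for j using p betwD by blast
    define P where "P j \<longleftrightarrow> (\<exists>i\<ge>k. d (p j) (y i) \<le> r0)" for j
    have "d (p J) (y n) \<le> r0" using p yM r0 by simp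
    then have PJ: "P J" unfolding P_def using kn by blast
    define j where "j = (LEAST j. P j)"
    have "P j" unfolding j_def using PJ by (rule LeastI)
    then obtain i where i: "i \<ge> k" "d (p j) (y i) \<le> r0" unfolding P_def by blast
    obtain i' where i': "i' \<le> k" "d (p j) (y i') \<le> r0 + 1"
    proof (cases j)
      case 0
      have "y 0 = x" unfolding y_def using x pow_zero by simp
      then show ?thesis using that[of 0] 0 p r0 x by simp
    next
      case (Suc l)
      then have "\<not> P l" unfolding j_def using not_less_Least[of l P] by auto
      moreover obtain i' where "i' \<le> n" "d (p l) (y i') \<le> r0" using r0(2)[of "p l" n] p(3)
          unfolding y_def by blast
      ultimately have "i' < k" "d (p l) (y i') \<le> r0" unfolding P_def using not_le by blast+
      moreover have "d (p j) (y i') \<le> d (p l) (p j) + d (p l) (y i')" using triangle'' pM yM by auto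
      ultimately show ?thesis using that[of i'] p(4)[of l] Suc by auto
    qed
    have "d (y i) (y i') \<le> 2 * r0 + 1" using triangle''[of "y i" "p j" "y i'"] i i' yM pM by auto
    then have "K * (d (y i) (y i') + C) \<le> K * (2 * r0 + 1 + C)" using K by (intro mult_left_mono) auto
    then have "\<bar>real i - real k\<bar> \<le> K * (2 * r0 + 1 + C)" using low[of i i'] i i' by auto
    then have "L * \<bar>real i - real k\<bar> \<le> L * (K * (2 * r0 + 1 + C))" using L by (rule mult_left_mono)
    then have "d (y i) (y k) \<le> L * (K * (2 * r0 + 1 + C))" using up[of i k] by linarith
    moreover have "d (p j) (y k) \<le> d (p j) (y i) + d (y i) (y k)" using triangle pM yM by auto
    ultimately have "d (p j) (y k) \<le> R" using i unfolding R_def by linarith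
    then show ?thesis using p(3) by blast
  qed
  moreover have "R \<ge> 0" unfolding R_def using L K r0 by (intro add_nonneg_nonneg mult_nonneg_nonneg) auto
  ultimately show ?thesis using that unfolding y_def by blast
qed

end

text \<open>Once a value exceeds the defect \<open>C\<close> by 1, every further block of length
  \<open>n0\<close> contributes at least 1.\<close>

lemma superadditive_linear_growth:
  fixes f :: "nat \<Rightarrow> real"
  assumes f: "\<And>m n. f (m + n) \<ge> f m + f n - C" "\<And>n. f n \<ge> 0" and n0: "f n0 \<ge> C + 1" "C \<ge> 0" "n0 \<ge> 1"
  shows "real n / real n0 - (1 + C) \<le> f n"
proof -
  have k: "f (Suc k * n0) \<ge> real (Suc k) + C" for k
  proof (induction k)
    case (Suc k)
    then show ?case using f(1)[of n0 "Suc k * n0"] n0 by simp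
  qed (use n0 in simp)
  have k': "f (k * n0) \<ge> real k" for k using k[of "k-1"] f(2)[of 0] n0 by (cases k) auto
  have "f n \<ge> f (n div n0 * n0) + f (n mod n0) - C" using f(1)[of "n div n0 * n0" "n mod n0"] by simp
  moreover have "real n / real n0 \<le> real (n div n0) + 1" 
  proof -
    have "real n = real (n div n0) * real n0 + real (n mod n0)"
        by (metis div_mult_mod_eq of_nat_add of_nat_mult)
    then have "real n / real n0 = real (n div n0) + real (n mod n0) / real n0" using n0
        by (simp add: field_simps)
    moreover have "real (n mod n0) / real n0 \<le> 1" using n0 by (simp add: divide_le_eq)
    ultimately show ?thesis by linarith
  qed
  ultimately show ?thesis using k'[of "n div n0"] f(2)[of "n mod n0"] by linarith
qed

context delta_hyperbolic_action begin

lemma electric_edges_act: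
  assumes Z: "Z \<subseteq> M" "\<And>h z. h \<in> carrier G \<Longrightarrow> z \<in> Z \<Longrightarrow> \<phi> h z \<in> Z"
    and h: "h \<in> carrier G" and pq: "(p, q) \<in> electric_edges Z r"
  shows "(\<phi> h p, \<phi> h q) \<in> electric_edges Z r"
proof -
  have M: "p \<in> M" "q \<in> M" using pq unfolding electric_edges_def by auto
  have "r \<le> d u z" if ed: "\<forall>m\<in>betw p q. \<forall>z\<in>Z. r \<le> d m z" "u \<in> betw (\<phi> h p) (\<phi> h q)" "z \<in> Z" for u z
  proof -
    obtain m where m: "m \<in> betw p q" "u = \<phi> h m" using act_betwE[OF h M ed(2)] by blast
    have "\<phi> (inv h) z \<in> Z" using Z h ed by auto
    then have zi: "\<phi> (inv h) z \<in> M" "r \<le> d m (\<phi> (inv h) z)" using ed(1) m(1) Z(1) by auto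
    note zi(2)
    also have "d m (\<phi> (inv h) z) = d (\<phi> h m) (\<phi> h (\<phi> (inv h) z))"
        using isometry[OF h betwD(1)[OF m(1)] zi(1)] by simp
    also have "\<dots> = d u z" using m(2) act_inv'[OF h, of z] ed(3) Z(1) by auto
    finally show ?thesis .
  qed
  then show ?thesis using pq M h act_closed isometry unfolding electric_edges_def by auto
qed

lemma electric_action:
  assumes Z: "Z \<subseteq> M" "\<And>h z. h \<in> carrier G \<Longrightarrow> z \<in> Z \<Longrightarrow> \<phi> h z \<in> Z"
  shows "isometric_action G M (graph_dist (electric_edges Z r)) \<phi>"
proof -
  define E where "E = electric_edges Z r"
  interpret R: Metric_space M "graph_dist E" unfolding E_def by (rule electric_metric)
  have 1: "(\<phi> h p, \<phi> h q) \<in> E ^^ n" if "h \<in> carrier G" "(p,q) \<in> E ^^ n" for h p q n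
    using that(2)
  proof (induction n arbitrary: q)
    case (Suc n)
    then obtain c where "(p,c) \<in> E ^^ n" "(c,q) \<in> E" by (auto elim: relpow_Suc_E)
    then show ?case using Suc.IH electric_edges_act[OF Z that(1)] unfolding E_def
        by (blast intro: relpow_Suc_I)
  qed auto
  have 2: "(\<phi> h p, \<phi> h q) \<in> E ^^ n \<longleftrightarrow> (p,q) \<in> E ^^ n" if "h \<in> carrier G" "p \<in> M" "q \<in> M" for h p q n
    using 1[of h p q n] 1[of "inv h" "\<phi> h p" "\<phi> h q" n] that act_inv by auto
  have "isometric_action G M (graph_dist E) \<phi>"
  proof
    fix h x y assume "h \<in> carrier G" "x \<in> M" "y \<in> M"
    then show "graph_dist E (\<phi> h x) (\<phi> h y) = graph_dist E x y" unfolding graph_dist_def using 2 by simp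
  qed
  then show ?thesis unfolding E_def .
qed

text \<open>The radius may depend on \<open>B\<close>. A path of at most \<open>B\<close> edges
  closes up to a polygon, so that each point of the geodesic is within
  \<open>4 * \<delta> * B\<close> of a point between two adjacent vertices. That point is near the
  orbit, hence for large \<open>r\<close> the edge is a short one. Thus at most \<open>B\<close>
  balls about vertices cover the geodesic, which bounds its length.\<close>

lemma electric_orbit_unbounded:
  fixes B :: nat
  assumes lox: "loxodromic h" and x: "x \<in> M"
  obtains r0 where "\<And>r Z. r \<ge> r0 \<Longrightarrow> (\<And>n::int. \<phi> (h [^] n) x \<in> Z) \<Longrightarrow>
    \<exists>n\<ge>1. graph_dist (electric_edges Z r) x (\<phi> (h [^] int n) x) > real B"
proof -
  note h = loxodromic_carrier[OF lox]
  obtain K C where K: "1 \<le> K" "0 \<le> C" "\<And>n::int. real_of_int \<bar>n\<bar> / K - C \<le> d x (\<phi> (h [^] n) x)"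
      using loxodromicE[OF lox x] by metis
  obtain s0 where s0: "s0 \<ge> 0" "\<And>(n::nat) m. m \<in> betw x (\<phi> (h [^] int n) x) \<Longrightarrow>
      \<exists>i\<le>n. d m (\<phi> (h [^] int i) x) \<le> s0"
    using betw_near_orbit[OF assms] by metis
  \<comment> \<open>\<open>4 * \<delta> * B\<close> leads to a point between adjacent vertices, and
    1 from there to the first of them.\<close>
  define s where "s = 4 * \<delta> * B + 1"
  have s: "s \<ge> 1" unfolding s_def using delta_nonneg by simp
  show thesis
  proof (rule that[of "s0 + s"])
    fix r Z assume r: "r \<ge> s0 + s" and Z: "\<And>n::int. \<phi> (h [^] n) x \<in> Z"
    define E where "E = electric_edges Z r"
    \<comment> \<open>The geodesic is to have room for \<open>B + 1\<close> marks at spacing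
      \<open>3 * s\<close>.\<close>
    define n where "n = nat \<lceil>K * (3 * s * (B + 1) + C)\<rceil> + 1"
    define b where "b = \<phi> (h [^] int n) x"
    have bM: "b \<in> M" unfolding b_def using pow_closed h x by simp
    have "K * (3 * s * (B + 1) + C) \<le> real n" unfolding n_def by linarith
    then have "3 * s * (B + 1) + C \<le> real n / K" using K by (simp add: field_simps)
    then have long: "3 * s * (B + 1) \<le> d x b" using K(3)[of "int n"] unfolding b_def by simp
    obtain \<gamma> where \<gamma>: "\<And>t. 0 \<le> t \<Longrightarrow> t \<le> d x b \<Longrightarrow> \<gamma> t \<in> betw x b"
      "\<And>s t. 0 \<le> s \<Longrightarrow> s \<le> d x b \<Longrightarrow> 0 \<le> t \<Longrightarrow> t \<le> d x b \<Longrightarrow> d (\<gamma> s) (\<gamma> t) = \<bar>s - t\<bar>"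
      using geodesicE[OF x bM] by metis
    have "\<not> graph_dist E x b \<le> real B"
    proof
      assume le: "graph_dist E x b \<le> real B"
      obtain N where N: "graph_dist E x b = real N" "(x, b) \<in> E ^^ N"
        using electric_geodesic[OF x bM] unfolding E_def by blast
      have NB: "N \<le> B" using le N by simp
      have "N \<ge> 1"
      proof (rule ccontr)
        assume "\<not> 1 \<le> N"
        then have "N = 0" by simp
        then have "x = b" using N(2) by simp
        then have "d x b = 0" using x by simp
        moreover have "0 < 3 * s * real (B + 1)" using s by (intro mult_pos_pos) auto
        ultimately show False using long by linarith
      qed
      obtain y where y: "y 0 = x" "y N = b" "\<And>i. i < N \<Longrightarrow> (y i, y (Suc i)) \<in> E"
        using N(2) unfolding relpow_fun_conv by blast
      define F where "F = {(y i, y (Suc i)) | i. i < N}"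
      have xb: "(x, b) \<in> F ^^ N" unfolding relpow_fun_conv F_def using y by blast
      have FE: "F \<subseteq> E" "F \<subseteq> M \<times> M" using y unfolding F_def E_def electric_edges_def by auto
      \<comment> \<open>A crude bound is good enough: \<open>B\<close> is fixed, so \<open>B\<close>
        halvings can be afforded.\<close>
      have N2: "N \<le> 2 ^ B" using NB less_exp[of B] by linarith
      have "\<exists>i<N. d m (y i) \<le> s \<and> y i \<in> M" if m: "m \<in> betw x b" for m
      proof -
        obtain u v m' where uv: "(u, v) \<in> F" "m' \<in> betw u v" "d m m' \<le> 4 * \<delta> * B"
          using polygon[OF FE(2) xb \<open>N \<ge> 1\<close> N2 m] by blast
        obtain i where i: "i < N" "u = y i" "v = y (Suc i)" using uv unfolding F_def by auto
        have M: "u \<in> M" "v \<in> M" "m \<in> M" "m' \<in> M" using uv FE m betwD by auto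
        obtain j where j: "d m (\<phi> (h [^] int j) x) \<le> s0" using s0(2) m unfolding b_def by blast
        have "d m' (\<phi> (h [^] int j) x) \<le> d m m' + d m (\<phi> (h [^] int j) x)"
          using triangle'' M pow_closed h x by auto
        \<comment> \<open>As \<open>m'\<close> is closer than \<open>r\<close> to a point of
          \<open>Z\<close>, the edge over it is of the first kind.\<close>
        then have "\<not> r \<le> d m' (\<phi> (h [^] int j) x)" using j uv r unfolding s_def by linarith
        then have "\<not> (\<forall>m\<in>betw u v. \<forall>z\<in>Z. r \<le> d m z)" using uv(2) Z by blast
        then have "d u v \<le> 1" using uv FE unfolding E_def electric_edges_def by blast
        then have "d m' u \<le> 1" using betwD(2)[OF uv(2)] nonneg[of m' v] commute[of u m'] by linarith
        then have "d m u \<le> s" using triangle[of m m' u] M uv unfolding s_def by linarith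
        then show ?thesis using i M by auto
      qed
      note cover = this
      have gt: "\<gamma> (3 * s * real j) \<in> betw x b" and t: "0 \<le> 3 * s * real j" "3 * s * real j \<le> d x b"
          if "j \<le> N" for j
      proof -
        have "3 * s * real j \<le> 3 * s * (B + 1)" using that NB s by (intro mult_left_mono) auto
        from this long have "3 * s * real j \<le> d x b" by (rule order_trans)
        moreover have "0 \<le> 3 * s * real j" using s by simp
        ultimately show t: "0 \<le> 3 * s * real j" "3 * s * real j \<le> d x b" by blast+
        show "\<gamma> (3 * s * real j) \<in> betw x b" using \<gamma>(1)[OF t] .
      qed
      have "\<forall>j. \<exists>i. j \<le> N \<longrightarrow> i < N \<and> d (\<gamma> (3 * s * real j)) (y i) \<le> s \<and> y i \<in> M"
        using cover[OF gt] by blast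
      then obtain idx where idx: "\<And>j. j \<le> N \<Longrightarrow> idx j < N \<and> d (\<gamma> (3 * s * real j)) (y (idx j)) \<le> s \<and>
          y (idx j) \<in> M"
        using choice[of "\<lambda>j i. j \<le> N \<longrightarrow> i < N \<and> d (\<gamma> (3 * s * real j)) (y i) \<le> s \<and> y i \<in> M"] by blast
      \<comment> \<open>There is one mark more than there are vertices \<open>y i\<close> with
        \<open>i < N\<close>. Two marks at the same vertex are within \<open>2 * s\<close> of each
        other, against the spacing \<open>3 * s\<close>.\<close>
      have "\<not> inj_on idx {..N}"
      proof (rule pigeonhole)
        have "idx ` {..N} \<subseteq> {..<N}" using idx by auto
        then have "card (idx ` {..N}) \<le> N" using card_mono[of "{..<N}"] by fastforce
        then show "card {..N} > card (idx ` {..N})" by simp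
      qed
      then obtain j j' where j: "j \<le> N" "j' \<le> N" "j \<noteq> j'" "idx j = idx j'" unfolding inj_on_def by auto
      have "d (\<gamma> (3 * s * real j)) (\<gamma> (3 * s * real j')) \<le> 2 * s"
        using triangle'[of "\<gamma> (3 * s * real j)" "y (idx j)" "\<gamma> (3 * s * real j')"] idx[OF j(1)] idx[OF
            j(2)] j(4)
          betwD(1)[OF gt[OF j(1)]] betwD(1)[OF gt[OF j(2)]] by simp
      moreover have "d (\<gamma> (3 * s * real j)) (\<gamma> (3 * s * real j')) = \<bar>3 * s * real j - 3 * s * real j'\<bar>"
        using \<gamma>(2) t j by auto
      moreover have "\<dots> = 3 * s * \<bar>real j - real j'\<bar>" using s by (simp flip: right_diff_distrib add: abs_mult)
      moreover have "3 * s * 1 \<le> 3 * s * \<bar>real j - real j'\<bar>" using j s by (intro mult_left_mono) auto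
      ultimately show False using s by linarith
    qed
    then have "graph_dist (electric_edges Z r) x (\<phi> (h [^] int n) x) > real B" unfolding E_def b_def by simp
    moreover have "n \<ge> 1" unfolding n_def by simp
    ultimately show "\<exists>n\<ge>1. graph_dist (electric_edges Z r) x (\<phi> (h [^] int n) x) > real B" by blast
  qed
qed

end

section \<open>Loxodromic and WPD elements for the electrified metric\<close>

context delta_hyperbolic_action begin

lemma orbit_subset: "x \<in> M \<Longrightarrow> z \<in> orbit G \<phi> x \<Longrightarrow> z \<in> M"
  unfolding orbit_def using act_closed by auto

lemma orbit_closed:
  assumes "x \<in> M" "g \<in> carrier G" "z \<in> orbit G \<phi> x" shows "\<phi> g z \<in> orbit G \<phi> x"
proof -
  obtain f where "f \<in> carrier G" "z = \<phi> f x" using assms unfolding orbit_def by auto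
  then have "\<phi> g z = \<phi> (g \<otimes> f) x" "g \<otimes> f \<in> carrier G" using composition_rule assms by auto
  then show ?thesis unfolding orbit_def by blast
qed

text \<open>The \<open>m\<close>-th orbit point is close to a geodesic from \<open>x\<close> to the
  later one, where \<rho> is almost additive, and invariance of \<rho> identifies the second part.
  That \<open>C\<close> is fixed before \<rho> makes it uniform in the radius.\<close>

lemma orbit_superadditive:
  assumes lox: "loxodromic h" and x: "x \<in> M" and A: "A \<ge> 0"
  shows "\<exists>C\<ge>0. \<forall>\<rho>. isometric_action G M \<rho> \<phi> \<longrightarrow> coarsely_additive \<rho> A \<longrightarrow>
    (\<forall>m n. \<rho> x (\<phi> (h [^] int (m + n)) x) \<ge> \<rho> x (\<phi> (h [^] int m) x) + \<rho> x (\<phi> (h [^] int n) x) - C)"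
proof -
  note h = loxodromic_carrier[OF lox]
  obtain s where s: "s \<ge> 0" "\<And>(k::nat) n. k \<le> n \<Longrightarrow> \<exists>p\<in>betw x (\<phi> (h [^] int n) x). d p (\<phi> (h [^] int k) x) \<le> s"
    using orbit_near_betw[OF lox x] by metis
  have "\<rho> x (\<phi> (h [^] int (m + n)) x) \<ge> \<rho> x (\<phi> (h [^] int m) x) + \<rho> x (\<phi> (h [^] int n) x) - (A + 2 * (s + 1))"
    if act: "isometric_action G M \<rho> \<phi>" and add: "coarsely_additive \<rho> A" for \<rho> m n
  proof -
    interpret V: isometric_action G M \<rho> \<phi> by (rule act)
    define a where "a = \<phi> (h [^] int m) x"
    define b where "b = \<phi> (h [^] int (m + n)) x"
    have M: "a \<in> M" "b \<in> M" unfolding a_def b_def using pow_closed h x by auto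
    have ab: "\<rho> a b = \<rho> x (\<phi> (h [^] int n) x)" unfolding a_def b_def V.pow_isometry[OF h x] by simp
    obtain p where p: "p \<in> betw x b" "d p a \<le> s" using s(2)[of m "m + n"] unfolding a_def b_def by auto
    have pM: "p \<in> M" using p betwD by auto
    have "\<rho> x p + \<rho> p b \<le> \<rho> x b + A" "\<rho> p a \<le> d p a + 1"
      using add p x M pM unfolding coarsely_additive_def by auto
    moreover have "\<rho> x a \<le> \<rho> x p + \<rho> p a" "\<rho> a b \<le> \<rho> p a + \<rho> p b" using V.triangle V.triangle'' M pM x by auto
    ultimately have "\<rho> x a + \<rho> a b - (A + 2 * (d p a + 1)) \<le> \<rho> x b" by argo
    moreover have "d p a + 1 \<le> s + 1" using p(2) by simp
    ultimately show ?thesis using ab unfolding a_def[symmetric] b_def[symmetric] by argo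
  qed
  then show ?thesis using A s by (intro exI[of _ "A + 2 * (s + 1)"]) auto
qed

text \<open>The order of choices matters: \<open>A\<close> and \<open>C\<close> do not depend on
  \<open>r\<close>; then \<open>r0\<close> makes some orbit point at least \<open>C + 1\<close>
  away. The exponent \<open>n0\<close>, and with it the quasi-isometry constants, may depend on
  \<open>r\<close>.\<close>

lemma electric_loxodromic:
  assumes lox: "loxodromic h" and x: "x \<in> M"
  shows "\<exists>r0. \<forall>r\<ge>r0. isometric_action.loxodromic G M (graph_dist (electric_edges (orbit G \<phi> x) r)) \<phi> h"
proof -
  note h = loxodromic_carrier[OF lox]
  obtain A where A: "A \<ge> 0" "\<And>Z r. coarsely_additive (graph_dist (electric_edges Z r)) A"
      using electric_additive by blast
  obtain C where C: "C \<ge> 0" "\<And>\<rho> m n. isometric_action G M \<rho> \<phi> \<Longrightarrow> coarsely_additive \<rho> A \<Longrightarrow>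
    \<rho> x (\<phi> (h [^] int (m + n)) x) \<ge> \<rho> x (\<phi> (h [^] int m) x) + \<rho> x (\<phi> (h [^] int n) x) - C"
    using orbit_superadditive[OF lox x A(1)] by blast
  define Z where "Z = orbit G \<phi> x"
  have Z: "Z \<subseteq> M" "\<And>g z. g \<in> carrier G \<Longrightarrow> z \<in> Z \<Longrightarrow> \<phi> g z \<in> Z"
    unfolding Z_def by (auto intro: orbit_subset orbit_closed x)
  have hZ: "\<phi> (h [^] n) x \<in> Z" for n :: int unfolding Z_def orbit_def using h by auto
  obtain r0 where r0: "\<And>r Z. r \<ge> r0 \<Longrightarrow> (\<And>n::int. \<phi> (h [^] n) x \<in> Z) \<Longrightarrow>
    \<exists>n\<ge>1. graph_dist (electric_edges Z r) x (\<phi> (h [^] int n) x) > real (nat \<lceil>C + 1\<rceil>)"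
    using electric_orbit_unbounded[OF lox x] by blast
  have "isometric_action.loxodromic G M (graph_dist (electric_edges Z r)) \<phi> h" if r: "r \<ge> r0" for r
  proof -
    define \<rho> where "\<rho> = graph_dist (electric_edges Z r)"
    interpret V: isometric_action G M \<rho> \<phi> unfolding \<rho>_def by (rule electric_action[OF Z(1,2)])
    obtain n0 where n0: "n0 \<ge> 1" "\<rho> x (\<phi> (h [^] int n0) x) > real (nat \<lceil>C + 1\<rceil>)"
      using r0[OF r hZ] unfolding \<rho>_def by blast
    have growth: "real n / real n0 - (1 + C) \<le> \<rho> x (\<phi> (h [^] int n) x)" for n
    proof (rule superadditive_linear_growth)
      show "\<rho> x (\<phi> (h [^] int (m + n)) x) \<ge> \<rho> x (\<phi> (h [^] int m) x) + \<rho> x (\<phi> (h [^] int n) x) - C" for m n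
        by (rule C(2)[OF V.isometric_action_axioms]) (simp add: \<rho>_def A)
      show "C + 1 \<le> \<rho> x (\<phi> (h [^] int n0) x)" using n0(2) by linarith
    qed (use C n0 in auto)
    have "V.loxodromic h"
    proof (rule V.loxodromicI[OF h x])
      show "1 \<le> real n0" "0 \<le> 1 + C" using n0 C by auto
      show "real_of_int \<bar>n\<bar> / real n0 - (1 + C) \<le> \<rho> x (\<phi> (h [^] n) x)" for n
        using growth[of "nat \<bar>n\<bar>"] V.pow_abs_dist[OF h x, of n] by simp
    qed
    then show ?thesis unfolding \<rho>_def .
  qed
  then show ?thesis unfolding Z_def by blast
qed

end

section \<open>Two metrics with the same action, and the transfer of WPD\<close>

locale additive_action = delta_hyperbolic_action G M d \<phi> \<delta> + V: isometric_action G M \<rho> \<phi>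
  for G :: "('g, 'm) monoid_scheme" (structure) and M :: "'a set" and d \<phi> \<delta> \<rho> +
  fixes A :: real
  assumes A_nonneg: "0 \<le> A" and additive: "coarsely_additive \<rho> A"
begin

lemma rho_le: "a \<in> M \<Longrightarrow> b \<in> M \<Longrightarrow> \<rho> a b \<le> d a b + 1"
  using additive unfolding coarsely_additive_def by blast

lemma rho_additive: "a \<in> M \<Longrightarrow> b \<in> M \<Longrightarrow> m \<in> betw a b \<Longrightarrow> \<rho> a m + \<rho> m b \<le> \<rho> a b + A"
  using additive unfolding coarsely_additive_def by blast

text \<open>In \<open>d\<close>, take the quadrilateral formed by a segment of the axis and its
  translate under \<open>f\<close>. The two connecting sides may be long in \<open>d\<close>, but
  additivity keeps them near their ends in \<rho>, so that a point of the axis far from both ends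
  cannot be close to them. It is therefore close to the translate, and comparing \<rho>-distances
  from \<open>x\<close> bounds the shift along it.\<close>

lemma displacement_on_axis_bounded:
  assumes lox: "loxodromic h" "V.loxodromic h" and x: "x \<in> M"
  shows "\<exists>k0 R'. \<forall>n f. \<forall>k\<ge>k0. k + k0 \<le> n \<longrightarrow> f \<in> carrier G \<longrightarrow> \<rho> x (\<phi> f x) \<le> R \<longrightarrow>
     \<rho> (\<phi> (h [^] int n) x) (\<phi> f (\<phi> (h [^] int n) x)) \<le> R \<longrightarrow>
     d (\<phi> (h [^] int k) x) (\<phi> f (\<phi> (h [^] int k) x)) \<le> R'"
proof -
  note h = loxodromic_carrier[OF lox(1)]
  obtain s where s: "s \<ge> 0" "\<And>(k::nat) n. k \<le> n \<Longrightarrow> \<exists>p\<in>betw x (\<phi> (h [^] int n) x). d p (\<phi> (h [^] int k) x) \<le> s"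
    using orbit_near_betw[OF lox(1) x] by metis
  obtain s' where s': "s' \<ge> 0" "\<And>(n::nat) m. m \<in> betw x (\<phi> (h [^] int n) x) \<Longrightarrow>
      \<exists>i\<le>n. d m (\<phi> (h [^] int i) x) \<le> s'"
    using betw_near_orbit[OF lox(1) x] by metis
  obtain C where C: "C \<ge> 0" "\<And>m n. \<rho> x (\<phi> (h [^] int (m + n)) x) \<ge> \<rho> x (\<phi> (h [^] int m) x) + \<rho> x (\<phi> (h
      [^] int n) x) - C"
    using orbit_superadditive[OF lox(1) x A_nonneg] V.isometric_action_axioms additive by blast
  obtain K D where K: "1 \<le> K" "0 \<le> D" "\<And>n::int. real_of_int \<bar>n\<bar> / K - D \<le> \<rho> x (\<phi> (h [^] n) x)"
    using V.loxodromicE[OF lox(2) x] by metis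
  define L where "L = d x (\<phi> h x)"
  have L: "L \<ge> 0" unfolding L_def by simp
  define y where "y k = \<phi> (h [^] int k) x" for k :: nat
  have yM: "y k \<in> M" for k unfolding y_def using pow_closed h x by simp
  have y0: "y 0 = x" unfolding y_def using pow_zero x by simp
  have yy: "\<rho> (y i) (y (i + l)) = \<rho> x (y l)" for i l unfolding y_def V.pow_isometry[OF h x] by simp
  have C': "\<rho> x (y (m + n)) \<ge> \<rho> x (y m) + \<rho> x (y n) - C" for m n using C(2) unfolding y_def .
  have K': "real n / K - D \<le> \<rho> x (y n)" for n using K(3)[of "int n"] unfolding y_def by simp
  have ydist: "d (y i) (y j) \<le> L * \<bar>real i - real j\<bar>" for i j
    unfolding y_def pow_isometry[OF h x] L_def using pow_dist_le[OF h x, of "int j - int i"]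
    by (simp add: mult.commute abs_minus_commute)
  \<comment> \<open>An orbit point at \<rho>-distance more than \<open>T\<close> from an end is not
    near the connecting side at that end.\<close>
  define T where "T = R + A + 8 * \<delta> + s + 2"
  define e where "e = s + 8 * \<delta> + s'"
  \<comment> \<open>\<open>W\<close> bounds the shift of indices: a change of at most
    \<open>R + e + 1\<close> in \<rho>-distance, converted by the linear growth of the
    orbit.\<close>
  define W where "W = K * (R + e + 1 + C + D)"
  define k0 where "k0 = nat \<lceil>K * (T + D)\<rceil> + 1"
  define R' where "R' = e + L * W"
  have large: "\<rho> x (y k) > T" if "k \<ge> k0" for k
  proof -
    have "K * (T + D) < real k" using that unfolding k0_def by linarith
    then have "T + D < real k / K" using K by (simp add: field_simps)
    then show ?thesis using K'[of k] by linarith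
  qed
  have "d (y k) (\<phi> f (y k)) \<le> R'"
    if k: "k \<ge> k0" "k + k0 \<le> n" and f: "f \<in> carrier G"
        and R: "\<rho> x (\<phi> f x) \<le> R" "\<rho> (y n) (\<phi> f (y n)) \<le> R" for n f k
  proof -
    have fM: "\<phi> f p \<in> M" if "p \<in> M" for p using act_closed f that by blast
    obtain p where p: "p \<in> betw x (y n)" "d p (y k) \<le> s" using s(2)[of k n] k unfolding y_def by auto
    obtain u where u: "u \<in> betw x (\<phi> f x) \<union> betw (\<phi> f x) (\<phi> f (y n)) \<union> betw (\<phi> f (y n)) (y n)" "d p u \<le> 8 * \<delta>"
      using thin_quad[OF x yM fM[OF x] fM[OF yM] p(1)] by metis
    have M: "p \<in> M" "u \<in> M" using p u betwD by auto
    have uk: "d u (y k) \<le> s + 8 * \<delta>" using triangle''[of u p "y k"] M yM p u by auto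
    have uk': "\<rho> u (y k) \<le> s + 8 * \<delta> + 1" using rho_le[OF M(2) yM, of k] uk by linarith
    have "u \<notin> betw x (\<phi> f x)"
    proof
      assume "u \<in> betw x (\<phi> f x)"
      then have "\<rho> x u + \<rho> u (\<phi> f x) \<le> R + A" using rho_additive[OF x fM[OF x]] R by force
      then have "\<rho> x u \<le> R + A" using V.nonneg[of u "\<phi> f x"] by linarith
      then have "\<rho> x (y k) \<le> T" using V.triangle[of x u "y k"] x M yM uk' unfolding T_def by auto
      then show False using large[OF k(1)] by simp
    qed
    moreover have "u \<notin> betw (\<phi> f (y n)) (y n)"
    proof
      assume "u \<in> betw (\<phi> f (y n)) (y n)"
      then have "\<rho> (\<phi> f (y n)) u + \<rho> u (y n) \<le> R + A"
        using rho_additive[OF fM[OF yM] yM] R V.commute[of "y n" "\<phi> f (y n)"] by force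
      then have "\<rho> u (y n) \<le> R + A" using V.nonneg[of "\<phi> f (y n)" u] by linarith
      then have "\<rho> (y k) (y n) \<le> T" using V.triangle''[of "y k" u "y n"] x M yM uk' unfolding T_def by auto
      moreover have "\<rho> (y k) (y n) = \<rho> x (y (n - k))" using yy[of k "n - k"] k by simp
      moreover have "k0 \<le> n - k" using k by linarith
      ultimately show False using large[of "n - k"] by linarith
    qed
    ultimately obtain m where m: "m \<in> betw x (y n)" "u = \<phi> f m" using u(1) act_betwE[OF f x yM] by blast
    obtain k' where k': "k' \<le> n" "d m (y k') \<le> s'" using s'(2) m(1) unfolding y_def by blast
    have mM: "m \<in> M" using m betwD by auto
    have "d u (\<phi> f (y k')) \<le> s'" using isometry[OF f mM yM] m k' by simp
    then have close: "d (y k) (\<phi> f (y k')) \<le> e" unfolding e_def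
      using triangle''[OF yM M(2) fM[OF yM], of k k'] uk by linarith
    have "\<rho> (y k) (\<phi> f (y k')) \<le> e + 1" using rho_le[OF yM fM[OF yM], of k k'] close by linarith
    moreover have "\<rho> (\<phi> f x) (\<phi> f (y k')) = \<rho> x (y k')" using V.isometry f x yM by blast
    \<comment> \<open>\<open>f\<close> preserves \<rho> and moves \<open>x\<close> by at most
      \<open>R\<close>, and \<open>y k\<close> is close to the translate of
      \<open>y k'\<close>.\<close>
    ultimately have cmp: "\<bar>\<rho> x (y k) - \<rho> x (y k')\<bar> \<le> R + e + 1"
      using V.triangle[of x "y k" "\<phi> f (y k')"] V.triangle[of x "\<phi> f x" "\<phi> f (y k')"] V.triangle[of x
          "\<phi> f x" "y k"]
        V.triangle[of "\<phi> f x" x "\<phi> f (y k')"] V.triangle'[of x "\<phi> f (y k')" "y k"] 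
        V.triangle'[of "\<phi> f x" "y k" "\<phi> f (y k')"] V.triangle''[of "\<phi> f x" x "y k"] x yM fM R
            V.commute[of x "\<phi> f x"]
      by (smt (verit))
    have shift: "\<bar>real k - real k'\<bar> \<le> W"
    proof -
      have *: "real j - real i \<le> W" if "i \<le> j" "\<bar>\<rho> x (y i) - \<rho> x (y j)\<bar> \<le> R + e + 1" for i j
      proof -
        have "\<rho> x (y i) + \<rho> x (y (j - i)) - C \<le> \<rho> x (y j)" using C'[of i "j - i"] that by simp
        then have "real (j - i) / K \<le> R + e + 1 + C + D" using K'[of "j - i"] that by linarith
        then show ?thesis using K that unfolding W_def by (simp add: field_simps of_nat_diff)
      qed
      show ?thesis
      proof (cases "k \<le> k'")
        case True then show ?thesis using *[of k k'] cmp by simp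
      next
        case False then show ?thesis using *[of k' k] cmp by (simp add: abs_minus_commute)
      qed
    qed
    have "d (\<phi> f (y k')) (\<phi> f (y k)) = d (y k') (y k)" using isometry[OF f yM yM] .
    also have "\<dots> \<le> L * \<bar>real k - real k'\<bar>" using ydist[of k' k] by (simp add: abs_minus_commute)
    also have "\<dots> \<le> L * W" using shift L by (rule mult_left_mono)
    finally show ?thesis unfolding R'_def using close triangle[OF yM fM[OF yM] fM[OF yM], of k k k']
        by linarith
  qed
  then show ?thesis unfolding y_def by blast
qed

text \<open>The displacement bound excludes the first and the last \<open>k0\<close> points.
  Conjugation by \<open>h [^] int k0\<close> moves the admissible window back to the base point,
  where WPD for \<open>d\<close> gives finiteness.\<close>

lemma WPD_transfer:
  assumes wpd: "WPD h" and lox: "V.loxodromic h" and x: "x \<in> M" and R: "R > 0"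
  shows "\<exists>n::int. n > 0 \<and> finite {f \<in> carrier G. \<rho> x (\<phi> f x) \<le> R \<and> \<rho> (\<phi> (h [^] n) x) (\<phi> f (\<phi> (h [^] n)
      x)) \<le> R}"
proof -
  have loxd: "loxodromic h" using wpd unfolding WPD_def by blast
  note h = loxodromic_carrier[OF loxd]
  obtain k0 R' where qc: "\<And>n f k. k \<ge> k0 \<Longrightarrow> k + k0 \<le> n \<Longrightarrow> f \<in> carrier G \<Longrightarrow> \<rho> x (\<phi> f x) \<le> R \<Longrightarrow>
     \<rho> (\<phi> (h [^] int n) x) (\<phi> f (\<phi> (h [^] int n) x)) \<le> R \<Longrightarrow>
     d (\<phi> (h [^] int k) x) (\<phi> f (\<phi> (h [^] int k) x)) \<le> R'"
    using displacement_on_axis_bounded[OF loxd lox x, of R] by blast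
  have "max R' 1 > 0" by simp
  then obtain N :: int where N: "N > 0" "finite {f \<in> carrier G. d x (\<phi> f x) \<le> max R' 1 \<and>
      d (\<phi> (h [^] N) x) (\<phi> f (\<phi> (h [^] N) x)) \<le> max R' 1}" (is "finite ?F")
    using wpd x unfolding WPD_def by blast
  \<comment> \<open>The window has \<open>nat N\<close> steps, with a margin of \<open>k0\<close> at
    each end.\<close>
  define n where "n = nat N + 2 * k0"
  define p where "p = h [^] int k0"
  have p: "p \<in> carrier G" unfolding p_def using h by simp
  have conj: "d (\<phi> p z) (\<phi> f (\<phi> p z)) = d z (\<phi> (inv p \<otimes> f \<otimes> p) z)" if "f \<in> carrier G" "z \<in> M" for f z
  proof -
    have "\<phi> f (\<phi> p z) = \<phi> p (\<phi> (inv p \<otimes> f \<otimes> p) z)"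
      using that p act_closed composition_rule act_inv' by (simp add: act_inv')
    then show ?thesis using isometry[OF p, of z "\<phi> (inv p \<otimes> f \<otimes> p) z"] that p act_closed by simp
  qed
  have "{f \<in> carrier G. \<rho> x (\<phi> f x) \<le> R \<and> \<rho> (\<phi> (h [^] int n) x) (\<phi> f (\<phi> (h [^] int n) x)) \<le> R} \<subseteq>
      (\<lambda>f. p \<otimes> f \<otimes> inv p) ` ?F"
  proof
    fix f assume "f \<in> {f \<in> carrier G. \<rho> x (\<phi> f x) \<le> R \<and> \<rho> (\<phi> (h [^] int n) x) (\<phi> f (\<phi> (h [^] int n) x)) \<le> R}"
    then have f: "f \<in> carrier G" "\<rho> x (\<phi> f x) \<le> R" "\<rho> (\<phi> (h [^] int n) x) (\<phi> f (\<phi> (h [^] int n) x)) \<le>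
        R" by auto
    have 1: "d (\<phi> p x) (\<phi> f (\<phi> p x)) \<le> R'" using qc[OF _ _ f] unfolding p_def n_def by simp
    have "d (\<phi> (h [^] int (k0 + nat N)) x) (\<phi> f (\<phi> (h [^] int (k0 + nat N)) x)) \<le> R'"
      by (rule qc[OF _ _ f]) (auto simp: n_def)
    moreover have "\<phi> (h [^] int (k0 + nat N)) x = \<phi> p (\<phi> (h [^] N) x)"
      using pow_add[OF h x, of "int k0" N] N unfolding p_def by simp
    ultimately have 2: "d (\<phi> p (\<phi> (h [^] N) x)) (\<phi> f (\<phi> p (\<phi> (h [^] N) x))) \<le> R'" by simp
    have "inv p \<otimes> f \<otimes> p \<in> ?F" using 1 2 f p conj x pow_closed[OF h x] by auto
    moreover have "f = p \<otimes> (inv p \<otimes> f \<otimes> p) \<otimes> inv p"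
      using f p by (simp add: grp.m_assoc) (simp add: grp.m_assoc[symmetric])
    ultimately show "f \<in> (\<lambda>f. p \<otimes> f \<otimes> inv p) ` ?F" by blast
  qed
  then have "finite {f \<in> carrier G. \<rho> x (\<phi> f x) \<le> R \<and> \<rho> (\<phi> (h [^] int n) x) (\<phi> f (\<phi> (h [^] int n) x)) \<le> R}"
    using N(2) by (meson finite_imageI finite_subset)
  moreover have "int n > 0" using N unfolding n_def by simp
  ultimately show ?thesis by blast
qed

end

section \<open>Fixed points at infinity\<close>

context Metric_space begin

lemma gromov_product_commute: "gromov_product w a b = gromov_product w b a"
  unfolding gromov_product_def by (simp add: commute add.commute)

lemma gromov_product_le: 
  assumes "w \<in> M" "a \<in> M" "b \<in> M" shows "gromov_product w a b \<le> d w a"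
  using triangle[of b a w] assms commute[of a w] commute[of b a] unfolding gromov_product_def by auto

lemma gromov_product_base:
  assumes "w \<in> M" "x \<in> M" "a \<in> M" "b \<in> M" shows "gromov_product x a b \<le> gromov_product w a b + d w x"
  using triangle[of a w x] triangle[of b w x] assms unfolding gromov_product_def by (simp add: field_simps)

lemma gromov_product_arg:
  assumes "w \<in> M" "a \<in> M" "b \<in> M" "c \<in> M" shows "gromov_product w a b \<le> gromov_product w a c + d b c"
  using triangle[of b c w] triangle[of a b c] assms commute unfolding gromov_product_def
      by (simp add: field_simps)

text \<open>A single base point suffices, because changing it alters products by at most the
  distance of the two base points.\<close>

lemma asymptotic_iff:
  assumes x: "x \<in> M" and s: "range s \<subseteq> M" and t: "range t \<subseteq> M"
  shows "asymptotic s t \<longleftrightarrow> (\<forall>C. \<exists>k. \<forall>i\<ge>k. \<forall>j\<ge>k. C \<le> gromov_product x (s i) (t j))"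
proof -
  have M: "s i \<in> M" "t i \<in> M" for i using s t by auto
  have "asymptotic s t \<longleftrightarrow> (\<forall>w\<in>M. \<forall>C. \<exists>k. \<forall>i\<ge>k. \<forall>j\<ge>k. C \<le> gromov_product w (s i) (t j))"
    unfolding asymptotic_def filterlim_at_top eventually_prod_sequentially by simp blast
  moreover have "\<exists>k. \<forall>i\<ge>k. \<forall>j\<ge>k. C \<le> gromov_product w (s i) (t j)" 
    if w: "w \<in> M" and *: "\<forall>C. \<exists>k. \<forall>i\<ge>k. \<forall>j\<ge>k. C \<le> gromov_product x (s i) (t j)" for w C
  proof -
    obtain k where k: "\<And>i j. i \<ge> k \<Longrightarrow> j \<ge> k \<Longrightarrow> C + d w x \<le> gromov_product x (s i) (t j)" using * by blast
    have "C \<le> gromov_product w (s i) (t j)" if "i \<ge> k" "j \<ge> k" for i j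
      using k[OF that] gromov_product_base[OF w x M(1)[of i] M(2)[of j]] by linarith
    then show ?thesis by blast
  qed
  ultimately show ?thesis using x by blast
qed

lemma asymptotic_sym: "asymptotic s t \<Longrightarrow> asymptotic t s"
  unfolding asymptotic_def filterlim_at_top eventually_prod_sequentially
  by (auto simp: gromov_product_commute) metis

lemma sequences_to_infinityD: "s \<in> sequences_to_infinity \<Longrightarrow> range s \<subseteq> M" "s \<in> sequences_to_infinity \<Longrightarrow> s i \<in> M"
  "s \<in> sequences_to_infinity \<Longrightarrow> asymptotic s s"
  unfolding sequences_to_infinity_def by auto

end

context delta_hyperbolic begin

lemma asymptotic_trans:
  assumes r: "range s \<subseteq> M" "range t \<subseteq> M" "range u \<subseteq> M" and st: "asymptotic s t" and tu: "asymptotic t u"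
  shows "asymptotic s u"
  unfolding asymptotic_def
proof
  fix w assume w: "w \<in> M"
  have M: "s i \<in> M" "t i \<in> M" "u i \<in> M" for i using r by auto
  have "\<exists>k. \<forall>i\<ge>k. \<forall>j\<ge>k. C \<le> gromov_product w (s i) (u j)" for C
  proof -
    obtain k where k: "\<forall>i\<ge>k. \<forall>j\<ge>k. C + \<delta> \<le> gromov_product w (s i) (t j)"
      using st asymptotic_iff[OF w r(1,2)] by blast
    obtain l where l: "\<forall>i\<ge>l. \<forall>j\<ge>l. C + \<delta> \<le> gromov_product w (t i) (u j)"
      using tu asymptotic_iff[OF w r(2,3)] by blast
    have "C \<le> gromov_product w (s i) (u j)" if "i \<ge> max k l" "j \<ge> max k l" for i j
    proof -
      have "C + \<delta> \<le> gromov_product w (s i) (t (max k l))" "C + \<delta> \<le> gromov_product w (t (max k l)) (u j)"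
        using k l that by auto
      then show ?thesis using hyp_product[OF w M(1)[of i] M(2)[of "max k l"] M(3)[of j]] by linarith
    qed
    then show ?thesis by blast
  qed
  then show "filterlim (\<lambda>(i, j). gromov_product w (s i) (u j)) at_top (sequentially \<times>\<^sub>F sequentially)"
    unfolding filterlim_at_top eventually_prod_sequentially by simp blast
qed

lemma equiv_asymptotic: "equiv sequences_to_infinity asymptotic_rel"
proof (rule equivI)
  show "refl_on sequences_to_infinity asymptotic_rel"
    unfolding refl_on_def asymptotic_rel_def sequences_to_infinity_def by auto
  show "sym asymptotic_rel" unfolding sym_def asymptotic_rel_def using asymptotic_sym by auto
  show "trans asymptotic_rel" unfolding trans_def asymptotic_rel_def
    using asymptotic_trans sequences_to_infinityD(1) by blast
  show "asymptotic_rel \<subseteq> sequences_to_infinity \<times> sequences_to_infinity" unfolding asymptotic_rel_def by auto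
qed

lemma asymptotic_bounded:
  assumes x: "x \<in> M" and s: "s \<in> sequences_to_infinity" and t: "range t \<subseteq> M" and B: "\<And>i. d (s i) (t i) \<le> B"
  shows "t \<in> sequences_to_infinity" "(s, t) \<in> asymptotic_rel"
proof -
  note sM = sequences_to_infinityD[OF s]
  have tM: "t i \<in> M" for i using t by auto
  have st: "asymptotic s t" unfolding asymptotic_iff[OF x sM(1) t]
  proof
    fix C
    obtain k where k: "\<forall>i\<ge>k. \<forall>j\<ge>k. C + B \<le> gromov_product x (s i) (s j)"
        using sM(3) asymptotic_iff[OF x sM(1,1)] by blast
    have "C \<le> gromov_product x (s i) (t j)" if "i \<ge> k" "j \<ge> k" for i j
      using k that gromov_product_arg[OF x sM(2)[of i] sM(2)[of j] tM[of j]] B[of j] by force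
    then show "\<exists>k. \<forall>i\<ge>k. \<forall>j\<ge>k. C \<le> gromov_product x (s i) (t j)" by blast
  qed
  then have "asymptotic t t" using asymptotic_trans[OF t sM(1) t asymptotic_sym] by blast
  then show "t \<in> sequences_to_infinity" using t unfolding sequences_to_infinity_def by auto
  then show "(s, t) \<in> asymptotic_rel" using s st unfolding asymptotic_rel_def by auto
qed

end

context delta_hyperbolic_action begin

lemma act_asymptotic:
  assumes h: "h \<in> carrier G" and r: "range s \<subseteq> M" "range t \<subseteq> M" and st: "asymptotic s t"
  shows "asymptotic (\<phi> h \<circ> s) (\<phi> h \<circ> t)"
  unfolding asymptotic_def
proof
  fix w assume w: "w \<in> M"
  define w' where "w' = \<phi> (inv h) w"
  have w': "w' \<in> M" "\<phi> h w' = w" unfolding w'_def using w h act_closed act_inv' by auto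
  have M: "s i \<in> M" "t i \<in> M" for i using r by auto
  have "gromov_product w (\<phi> h (s i)) (\<phi> h (t j)) = gromov_product w' (s i) (t j)" for i j
    unfolding gromov_product_def w'(2)[symmetric] by (simp add: isometry[OF h] M w'(1))
  then show "filterlim (\<lambda>(i, j). gromov_product w ((\<phi> h \<circ> s) i) ((\<phi> h \<circ> t) j)) at_top (sequentially
      \<times>\<^sub>F sequentially)"
    using st w'(1) unfolding asymptotic_def by simp
qed

lemma act_sequence:
  assumes "h \<in> carrier G" "s \<in> sequences_to_infinity" shows "\<phi> h \<circ> s \<in> sequences_to_infinity"
  using assms act_asymptotic[OF assms(1), of s s] act_closed sequences_to_infinityD[OF assms(2)]
  unfolding sequences_to_infinity_def by auto

lemma act_asymptotic_rel:
  assumes "h \<in> carrier G" "(s, t) \<in> asymptotic_rel" shows "(\<phi> h \<circ> s, \<phi> h \<circ> t) \<in> asymptotic_rel"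
  using assms act_asymptotic[OF assms(1)] act_sequence sequences_to_infinityD(1)
  unfolding asymptotic_rel_def by blast

lemma boundary_fixed_pointD:
  assumes h: "h \<in> carrier G" and \<xi>: "\<xi> \<in> boundary_fixed_points h" and s: "s \<in> \<xi>"
  shows "s \<in> sequences_to_infinity" "\<phi> h \<circ> s \<in> \<xi>" "\<And>t. t \<in> \<xi> \<Longrightarrow> asymptotic s t"
proof -
  have q: "\<xi> \<in> sequences_to_infinity // asymptotic_rel" and fx: "asymptotic_rel `` ((\<lambda>s. \<phi> h \<circ> s) ` \<xi>) = \<xi>"
    using \<xi> unfolding boundary_fixed_points_def gromov_boundary_def boundary_action_def by auto
  show sS: "s \<in> sequences_to_infinity" using q s equiv_asymptotic by (meson in_quotient_imp_subset subsetD)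
  have "\<phi> h \<circ> s \<in> sequences_to_infinity" by (rule act_sequence[OF h sS])
  then have "(\<phi> h \<circ> s, \<phi> h \<circ> s) \<in> asymptotic_rel" using equiv_asymptotic
      by (meson equiv_class_self Image_singleton_iff)
  then show "\<phi> h \<circ> s \<in> \<xi>" using fx s by blast
  show "asymptotic s t" if t: "t \<in> \<xi>" for t
    using quotient_eq_iff[OF equiv_asymptotic q q s t] unfolding asymptotic_rel_def by auto
qed

text \<open>A bounded displacement is invisible at infinity. Applied to the two rays of a loxodromic
  orbit.\<close>

lemma boundary_fixed_pointI:
  assumes h: "h \<in> carrier G" and x: "x \<in> M" and s: "s \<in> sequences_to_infinity"
      and B: "\<And>i. d (s i) (\<phi> h (s i)) \<le> B"
  shows "asymptotic_rel `` {s} \<in> boundary_fixed_points h"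
proof -
  note sM = sequences_to_infinityD[OF s]
  have hs: "(s, \<phi> h \<circ> s) \<in> asymptotic_rel"
    by (rule asymptotic_bounded(2)[OF x s _ , of _ B]) (use B act_closed[OF h] sM(2) in auto)
  have "boundary_action h (asymptotic_rel `` {s}) = asymptotic_rel `` {s}"
    unfolding boundary_action_def
  proof (intro equalityI subsetI)
    fix u assume "u \<in> asymptotic_rel `` ((\<lambda>s. \<phi> h \<circ> s) ` (asymptotic_rel `` {s}))"
    then obtain t where "(s, t) \<in> asymptotic_rel" "(\<phi> h \<circ> t, u) \<in> asymptotic_rel" by auto
    then show "u \<in> asymptotic_rel `` {s}"
      using act_asymptotic_rel[OF h] hs equiv_asymptotic unfolding equiv_def
          by (meson Image_singleton_iff transD)
  next
    fix u assume "u \<in> asymptotic_rel `` {s}"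
    then have "(\<phi> h \<circ> s, u) \<in> asymptotic_rel"
      using hs equiv_asymptotic unfolding equiv_def by (meson Image_singleton_iff symD transD)
    moreover have "s \<in> asymptotic_rel `` {s}" using equiv_class_self[OF equiv_asymptotic s] .
    ultimately show "u \<in> asymptotic_rel `` ((\<lambda>s. \<phi> h \<circ> s) ` (asymptotic_rel `` {s}))" by blast
  qed
  then show ?thesis unfolding boundary_fixed_points_def gromov_boundary_def using s by (auto intro: quotientI)
qed

text \<open>
  If all products were at most \<open>C\<close>, then \<open>x\<close> would be a coarse projection of \<open>s k\<close> to the axis of \<open>h\<close>.
  Then \<open>h\<^sup>N\<close> moves \<open>s k\<close> in the direction of \<open>h\<^sup>2\<^sup>N x\<close>, and \<open>s\<close> and \<open>h\<^sup>N s\<close> cannot converge to the same point.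
\<close>

lemma fixed_point_product_unbounded:
  assumes lox: "loxodromic h" and x: "x \<in> M" and \<xi>: "\<xi> \<in> boundary_fixed_points h" and s: "s \<in> \<xi>"
  shows "\<exists>k\<ge>k0. \<exists>m::int. gromov_product x (s k) (\<phi> (h [^] m) x) > C"
proof (rule ccontr)
  note h = loxodromic_carrier[OF lox]
  note fp = boundary_fixed_pointD[OF h \<xi>]
  note sM = sequences_to_infinityD[OF fp(1)[OF s]]
  assume "\<not> ?thesis"
  then have le: "gromov_product x (s k) (\<phi> (h [^] m) x) \<le> C" if "k \<ge> k0" for k and m :: int
    using that by (meson not_le)
  obtain K D where K: "1 \<le> K" "0 \<le> D" "\<And>n::int. real_of_int \<bar>n\<bar> / K - D \<le> d x (\<phi> (h [^] n) x)"
    using loxodromicE[OF lox x] by metis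
  \<comment> \<open>Chosen so that \<open>h [^] (2 * int N)\<close> moves \<open>x\<close> by at
    least \<open>4 * \<bar>C\<bar> + 2 * \<delta> + 1\<close>; the absolute value allows for
    negative \<open>C\<close>.\<close>
  define N where "N = nat \<lceil>K * (4 * \<bar>C\<bar> + 2 * \<delta> + 1 + D)\<rceil>"
  have "K * (4 * \<bar>C\<bar> + 2 * \<delta> + 1 + D) \<le> real N" unfolding N_def by linarith
  then have "4 * \<bar>C\<bar> + 2 * \<delta> + 1 + D \<le> real N / K" using K by (simp add: field_simps)
  also have "\<dots> \<le> real_of_int \<bar>2 * int N\<bar> / K" using K by (intro divide_right_mono) auto
  finally have N: "4 * \<bar>C\<bar> + 2 * \<delta> + 1 \<le> d x (\<phi> (h [^] (2 * int N)) x)" using K(3)[of "2 * int N"] by linarith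
  have pow_fix: "\<phi> (h [^] int n) \<circ> s \<in> \<xi>" for n
  proof (induction n)
    case 0
    have "\<phi> (h [^] (0::int)) \<circ> s = s" using pow_zero sM(2) by auto
    then show ?case using s by simp
  next
    case (Suc n)
    have eq: "\<phi> (h [^] int (Suc n)) \<circ> s = \<phi> h \<circ> (\<phi> (h [^] int n) \<circ> s)"
      using pow_add[OF h sM(2), of 1 "int n"] grp.int_pow_1[OF h] by auto
    show ?case unfolding eq by (rule fp(2)[OF Suc])
  qed
  define p where "p = h [^] int N"
  have p: "p \<in> carrier G" unfolding p_def using h by simp
  have "asymptotic s (\<phi> p \<circ> s)" using fp(3)[OF s pow_fix] unfolding p_def .
  moreover have pr: "range (\<phi> p \<circ> s) \<subseteq> M" using act_closed[OF p] sM(2) by auto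
  ultimately obtain k1 where k1: "\<forall>i\<ge>k1. \<forall>j\<ge>k1. C + \<delta> + 1 \<le> gromov_product x (s i) ((\<phi> p \<circ> s) j)"
    using asymptotic_iff[OF x sM(1) pr] by blast
  define a where "a = s (max k0 k1)"
  have aM: "a \<in> M" unfolding a_def by (rule sM(2))
  define y where "y n = \<phi> (h [^] (n * int N)) x" for n :: int
  have yM: "y n \<in> M" for n unfolding y_def using pow_closed[OF h x] .
  have py: "\<phi> p (y n) = y (n + 1)" for n
    unfolding y_def p_def using pow_add[OF h x, of "int N" "n * int N"] by (simp add: algebra_simps)
  have y0: "y 0 = x" unfolding y_def using pow_zero[OF x] by simp
  have pa: "\<phi> p a \<in> M" using act_closed[OF p aM] .
  have 1: "C + \<delta> + 1 \<le> gromov_product x a (\<phi> p a)" using k1 unfolding a_def by auto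
  have 2: "gromov_product x a (y n) \<le> C" for n unfolding y_def a_def by (rule le) simp
  have i1: "d (\<phi> p a) x = d a (y (-1))" using isometry[OF p aM yM, of "-1"] py[of "-1"] y0 by simp
  have i2: "d (\<phi> p a) (y 2) = d a (y 1)" using isometry[OF p aM yM, of 1] py[of 1] by simp
  have i3: "d x (y 1) = d x (y (-1))" using pow_neg_dist[OF h x, of "int N"] unfolding y_def by simp
  \<comment> \<open>The bound on the product with \<open>y (-1)\<close> says that the way from
    \<open>a\<close> to \<open>y (-1)\<close> leads through \<open>x\<close> up to
    \<open>2 * C\<close>.\<close>
  have "d a (y (-1)) \<ge> d a x + d x (y 1) - 2 * C"
    using 2[of "-1"] i3 commute[of x "y (-1)"] unfolding gromov_product_def by (simp add: field_simps)
  moreover have "d a (y 1) \<le> d a x + d x (y 1)" using triangle[OF aM x yM] .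
  moreover have "d (y 2) x = d x (y 2)" by (rule commute)
  moreover have "d x (y 2) \<ge> 4 * \<bar>C\<bar> + 2 * \<delta> + 1" using N unfolding y_def by simp
  ultimately have "gromov_product x (\<phi> p a) (y 2) > C + \<delta>"
    unfolding gromov_product_def i1 i2 by (simp add: field_simps)
  \<comment> \<open>\<open>\<phi> p a\<close> has a large product both with \<open>a\<close>, by
    convergence to the same boundary point, and with \<open>y 2\<close>. Hence \<open>a\<close>
    would have a product above \<open>C\<close> with \<open>y 2\<close>.\<close>
  then show False using hyp_product[OF x aM pa yM, of 2] 1 2[of 2] by linarith
qed

text \<open>Hyperbolicity along the chain that leads from one orbit through \<open>s k\<close> and
  \<open>s l\<close> to the other; two links cost \<open>2 * \<delta>\<close>. The indices
  \<open>k\<close> and \<open>l\<close> may differ, as \<open>s\<close> converges to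
  infinity.\<close>

lemma common_fixed_point_product_unbounded:
  assumes lox: "loxodromic h" "loxodromic h'" and x: "x \<in> M"
    and \<xi>: "\<xi> \<in> boundary_fixed_points h" "\<xi> \<in> boundary_fixed_points h'"
  shows "\<exists>(m::int) (m'::int). gromov_product x (\<phi> (h [^] m) x) (\<phi> (h' [^] m') x) > C"
proof -
  note h = loxodromic_carrier[OF lox(1)] loxodromic_carrier[OF lox(2)]
  have "\<xi> \<noteq> {}" using \<xi> in_quotient_imp_non_empty[OF equiv_asymptotic]
      unfolding boundary_fixed_points_def gromov_boundary_def by blast
  then obtain s where s: "s \<in> \<xi>" by blast
  note sM = sequences_to_infinityD[OF boundary_fixed_pointD(1)[OF h(1) \<xi>(1) s]]
  define C' where "C' = C + 2 * \<delta>"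
  obtain k0 where k0: "\<forall>i\<ge>k0. \<forall>j\<ge>k0. C' + 1 \<le> gromov_product x (s i) (s j)"
      using sM(3) asymptotic_iff[OF x sM(1,1)] by blast
  obtain k m where k: "k \<ge> k0" "gromov_product x (s k) (\<phi> (h [^] (m::int)) x) > C'"
    using fixed_point_product_unbounded[OF lox(1) x \<xi>(1) s] by blast
  obtain l m' where l: "l \<ge> k0" "gromov_product x (s l) (\<phi> (h' [^] (m'::int)) x) > C'"
    using fixed_point_product_unbounded[OF lox(2) x \<xi>(2) s] by blast
  have M: "\<phi> (h [^] m) x \<in> M" "\<phi> (h' [^] m') x \<in> M" using pow_closed h x by auto
  have "gromov_product x (s k) (\<phi> (h' [^] m') x) > C + \<delta>"
    using hyp_product[OF x sM(2) sM(2) M(2), of k l] k0 k l delta_nonneg unfolding C'_def by (smt (verit))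
  then have "gromov_product x (\<phi> (h [^] m) x) (\<phi> (h' [^] m') x) > C"
    using hyp_product[OF x M(1) sM(2) M(2), of k] k delta_nonneg gromov_product_commute[of x "s k"
        "\<phi> (h [^] m) x"]
    unfolding C'_def by linarith
  then show ?thesis by blast
qed

text \<open>For \<open>i \<le> j\<close> the \<open>i\<close>-th point is near a geodesic from
  \<open>x\<close> to the \<open>j\<close>-th, so that the product is about its distance from
  \<open>x\<close>. Passing to the power with exponent \<epsilon> treats both rays at once.\<close>

lemma ray_product:
  assumes lox: "loxodromic h" and x: "x \<in> M" and \<epsilon>: "\<epsilon> = 1 \<or> \<epsilon> = (-1::int)"
  obtains K C where "1 \<le> K" "\<And>i j. gromov_product x (\<phi> (h [^] (\<epsilon> * int i)) x) (\<phi> (h [^] (\<epsilon> * int j))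
      x) \<ge> real (min i j) / K - C"
proof -
  note h = loxodromic_carrier[OF lox]
  define f where "f = h [^] \<epsilon>"
  have f: "f \<in> carrier G" unfolding f_def using h by simp
  have fp: "f [^] n = h [^] (\<epsilon> * n)" for n :: int unfolding f_def using grp.int_pow_pow[OF h] .
  obtain K C where K: "1 \<le> K" "0 \<le> C" "\<And>n::int. real_of_int \<bar>n\<bar> / K - C \<le> d x (\<phi> (h [^] n) x)"
    using loxodromicE[OF lox x] by metis
  have K': "real_of_int \<bar>n\<bar> / K - C \<le> d x (\<phi> (f [^] n) x)" for n :: int
    using K(3)[of "\<epsilon> * n"] \<epsilon> unfolding fp by auto
  have loxf: "loxodromic f" by (rule loxodromicI[OF f x K(1,2) K'])
  obtain s where s: "s \<ge> 0" "\<And>(k::nat) n. k \<le> n \<Longrightarrow> \<exists>p\<in>betw x (\<phi> (f [^] int n) x). d p (\<phi> (f [^] int k) x) \<le> s"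
    using orbit_near_betw[OF loxf x] by metis
  have le: "gromov_product x (\<phi> (f [^] int i) x) (\<phi> (f [^] int j) x) \<ge> real i / K - (C + s)"
      if ij: "i \<le> j" for i j
  proof -
    define a where "a = \<phi> (f [^] int i) x"
    define b where "b = \<phi> (f [^] int j) x"
    have M: "a \<in> M" "b \<in> M" unfolding a_def b_def using pow_closed f x by auto
    obtain p where p: "p \<in> betw x b" "d p a \<le> s" using s(2)[OF ij] unfolding a_def b_def by auto
    have pM: "p \<in> M" using p betwD by auto
    have "d x a \<le> d x p + s" "d a b \<le> s + d p b"
      using triangle[OF x pM M(1)] triangle''[OF M(1) pM M(2)] p by auto
    moreover have "d x p + d p b = d x b" using betwD p by auto
    moreover have "real i / K - C \<le> d x a" using K'[of "int i"] unfolding a_def by simp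
    moreover have "2 * gromov_product x a b = d x a + d x b - d a b"
      unfolding gromov_product_def using commute[of x a] commute[of x b] by simp
    ultimately have "2 * gromov_product x a b \<ge> 2 * (real i / K - C - s)" by argo
    then show ?thesis unfolding a_def b_def by simp
  qed
  have "gromov_product x (\<phi> (f [^] int i) x) (\<phi> (f [^] int j) x) \<ge> real (min i j) / K - (C + s)" for i j
  proof (cases "i \<le> j")
    case True then show ?thesis using le[of i j] by (simp add: min_absorb1)
  next
    case False then show ?thesis using le[of j i] gromov_product_commute[of x "\<phi> (f [^] int i) x"
        "\<phi> (f [^] int j) x"]
      by (simp add: min_absorb2)
  qed
  then show thesis using that[OF K(1)] unfolding fp by blast
qed

lemma ray_to_infinity:
  assumes lox: "loxodromic h" and x: "x \<in> M" and \<epsilon>: "\<epsilon> = 1 \<or> \<epsilon> = (-1::int)"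
  defines "s \<equiv> \<lambda>i. \<phi> (h [^] (\<epsilon> * int i)) x"
  shows "s \<in> sequences_to_infinity" "asymptotic_rel `` {s} \<in> boundary_fixed_points h"
proof -
  note h = loxodromic_carrier[OF lox]
  obtain K C where K: "1 \<le> K" "\<And>i j. gromov_product x (s i) (s j) \<ge> real (min i j) / K - C"
    using ray_product[OF lox x \<epsilon>] unfolding s_def by metis
  have r: "range s \<subseteq> M" unfolding s_def using pow_closed h x by auto
  have "\<exists>k. \<forall>i\<ge>k. \<forall>j\<ge>k. B \<le> gromov_product x (s i) (s j)" for B
  proof (intro exI allI impI)
    fix i j assume ij: "i \<ge> nat \<lceil>K * (B + C)\<rceil>" "j \<ge> nat \<lceil>K * (B + C)\<rceil>"
    then have "K * (B + C) \<le> real (min i j)" by linarith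
    then have "B + C \<le> real (min i j) / K" using K by (simp add: field_simps)
    then show "B \<le> gromov_product x (s i) (s j)" using K(2)[of i j] by linarith
  qed
  then show S: "s \<in> sequences_to_infinity" unfolding sequences_to_infinity_def
      using asymptotic_iff[OF x r r] r by auto
  show "asymptotic_rel `` {s} \<in> boundary_fixed_points h"
  proof (rule boundary_fixed_pointI[OF h x S])
    fix i
    have "\<phi> h (s i) = \<phi> (h [^] (1 + \<epsilon> * int i)) x" unfolding s_def pow_add[OF h x]
        using grp.int_pow_1[OF h] by simp
    then show "d (s i) (\<phi> h (s i)) \<le> d x (\<phi> h x)" unfolding s_def
      using pow_isometry[OF h x, of "\<epsilon> * int i" "1 + \<epsilon> * int i"] grp.int_pow_1[OF h] by simp
  qed
qed

text \<open>By pigeonhole, one pair of rays already has unbounded products. A large product forces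
  both points far out along their rays, where each has a large product with all later points of its
  ray; so the two rays are asymptotic.\<close>

lemma common_fixed_point_of_unbounded_product:
  assumes lox: "loxodromic h" "loxodromic h'" and x: "x \<in> M"
    and unb: "\<And>C. \<exists>(m::int) (m'::int). gromov_product x (\<phi> (h [^] m) x) (\<phi> (h' [^] m') x) > C"
  shows "boundary_fixed_points h \<inter> boundary_fixed_points h' \<noteq> {}"
proof -
  note h = loxodromic_carrier[OF lox(1)] loxodromic_carrier[OF lox(2)]
  define P where "P C \<epsilon> \<epsilon>' \<longleftrightarrow> (\<exists>i j. gromov_product x (\<phi> (h [^] (\<epsilon> * int i)) x) (\<phi> (h' [^] (\<epsilon>' * int
      j)) x) > C)" for C \<epsilon> \<epsilon>'
  have sgn: "\<exists>\<epsilon>\<in>{1,-1}. \<exists>i. m = \<epsilon> * int i" for m :: int by (cases m rule: int_cases2) auto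
  have P: "\<exists>\<epsilon>\<in>{1,-1}. \<exists>\<epsilon>'\<in>{1,-1}. P C \<epsilon> \<epsilon>'" for C
  proof -
    obtain m m' :: int where m: "gromov_product x (\<phi> (h [^] m) x) (\<phi> (h' [^] m') x) > C" using unb by blast
    obtain \<epsilon> i where e: "\<epsilon> \<in> {1,-1}" "m = \<epsilon> * int i" using sgn by blast
    obtain \<epsilon>' j where e': "\<epsilon>' \<in> {1,-1}" "m' = \<epsilon>' * int j" using sgn by blast
    have "P C \<epsilon> \<epsilon>'" unfolding P_def using m e(2) e'(2) by blast
    then show ?thesis using e(1) e'(1) by blast
  qed
  have mono: "P C \<epsilon> \<epsilon>'" if "P C' \<epsilon> \<epsilon>'" "C \<le> C'" for C C' \<epsilon> \<epsilon>' using that unfolding P_def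
      by (meson le_less_trans)
  obtain \<epsilon> \<epsilon>' where \<epsilon>: "\<epsilon> \<in> {1,-1}" "\<epsilon>' \<in> {1,-1}" and PP: "\<And>C. P C \<epsilon> \<epsilon>'"
  proof (rule ccontr)
    assume "\<not> thesis"
    then have "\<forall>\<epsilon>\<in>{1,-1}. \<forall>\<epsilon>'\<in>{1,-1}. \<exists>C. \<not> P C \<epsilon> \<epsilon>'" using that by blast
    then obtain c where c: "\<And>\<epsilon> \<epsilon>'. \<epsilon> \<in> {1,-1} \<Longrightarrow> \<epsilon>' \<in> {1,-1} \<Longrightarrow> \<not> P (c \<epsilon> \<epsilon>') \<epsilon> \<epsilon>'" by metis
    \<comment> \<open>If each of the four pairs of signs failed for some bound, the maximum of these
      bounds would contradict \<open>P\<close>.\<close>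
    define c' where "c' = Max {c 1 1, c 1 (-1), c (-1) 1, c (-1) (-1)}"
    obtain \<epsilon> \<epsilon>' where e: "\<epsilon> \<in> {1,-1}" "\<epsilon>' \<in> {1,-1}" "P c' \<epsilon> \<epsilon>'" using P[of c'] by blast
    then have "c \<epsilon> \<epsilon>' \<le> c'" unfolding c'_def by auto
    then show False using c[OF e(1,2)] mono[OF e(3)] by blast
  qed
  define s where "s = (\<lambda>i. \<phi> (h [^] (\<epsilon> * int i)) x)"
  define t where "t = (\<lambda>i. \<phi> (h' [^] (\<epsilon>' * int i)) x)"
  have s: "s \<in> sequences_to_infinity" "asymptotic_rel `` {s} \<in> boundary_fixed_points h"
    using ray_to_infinity[OF lox(1) x, of \<epsilon>] \<epsilon> unfolding s_def by auto
  have t: "t \<in> sequences_to_infinity" "asymptotic_rel `` {t} \<in> boundary_fixed_points h'"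
    using ray_to_infinity[OF lox(2) x, of \<epsilon>'] \<epsilon> unfolding t_def by auto
  note sM = sequences_to_infinityD[OF s(1)]
  note tM = sequences_to_infinityD[OF t(1)]
  have "asymptotic s t" unfolding asymptotic_iff[OF x sM(1) tM(1)]
  proof
    fix C
    obtain k where k: "\<forall>i\<ge>k. \<forall>j\<ge>k. C + 2 * \<delta> \<le> gromov_product x (s i) (s j)"
        using sM(3) asymptotic_iff[OF x sM(1,1)] by blast
    obtain l where l: "\<forall>i\<ge>l. \<forall>j\<ge>l. C + 2 * \<delta> \<le> gromov_product x (t i) (t j)"
        using tM(3) asymptotic_iff[OF x tM(1,1)] by blast
    define q where "q = max k l"
    \<comment> \<open>A product is at most the distance of either point from \<open>x\<close>.
      Exceeding \<open>q\<close> times both displacements therefore forces both indices to be at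
      least \<open>q\<close>.\<close>
    define B where "B = max (C + 2 * \<delta>) (max (real q * d x (\<phi> h x)) (real q * d x (\<phi> h' x)))"
    obtain i j where ij: "gromov_product x (s i) (t j) > B" using PP[of B] unfolding P_def s_def t_def
        by blast
    have "real i * d x (\<phi> h x) \<ge> d x (s i)" using pow_dist_le[OF h(1) x, of "\<epsilon> * int i"] \<epsilon>
        unfolding s_def by auto
    then have "real q * d x (\<phi> h x) < real i * d x (\<phi> h x)"
        using ij gromov_product_le[OF x sM(2) tM(2), of i j] unfolding B_def by linarith
    then have iq: "i \<ge> q" using mult_right_mono[of "real i" "real q" "d x (\<phi> h x)"] by fastforce
    have "real j * d x (\<phi> h' x) \<ge> d x (t j)" using pow_dist_le[OF h(2) x, of "\<epsilon>' * int j"] \<epsilon>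
        unfolding t_def by auto
    then have "real q * d x (\<phi> h' x) < real j * d x (\<phi> h' x)"
      using ij gromov_product_le[OF x tM(2) sM(2), of j i] gromov_product_commute[of x "s i" "t j"]
          unfolding B_def by linarith
    then have jq: "j \<ge> q" using mult_right_mono[of "real j" "real q" "d x (\<phi> h' x)"] by fastforce
    have "C \<le> gromov_product x (s i') (t j')" if "i' \<ge> q" "j' \<ge> q" for i' j'
    proof -
      have "C + 2 * \<delta> \<le> gromov_product x (s i') (s i)" "C + 2 * \<delta> \<le> gromov_product x (t j) (t j')"
        using k l that iq jq unfolding q_def by auto
      moreover have "C + 2 * \<delta> \<le> gromov_product x (s i) (t j)" using ij unfolding B_def by linarith
      ultimately show ?thesis using delta_nonneg hyp_product[OF x sM(2) sM(2) tM(2), of i' i j']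
          hyp_product[OF x sM(2) tM(2) tM(2), of i j j'] by linarith
    qed
    then show "\<exists>k. \<forall>i\<ge>k. \<forall>j\<ge>k. C \<le> gromov_product x (s i) (t j)" by blast
  qed
  then have "(s, t) \<in> asymptotic_rel" using s t unfolding asymptotic_rel_def by auto
  then have "asymptotic_rel `` {s} = asymptotic_rel `` {t}" by (rule equiv_class_eq[OF equiv_asymptotic])
  then show ?thesis using s t by auto
qed

end

section \<open>Geometric realization of a graph metric\<close>

context Metric_space begin

text \<open>Isolates the condition of \<open>geodesic_space\<close> for one pair, so that geodesics
  can be reversed and concatenated.\<close>

definition joined :: "'a \<Rightarrow> 'a \<Rightarrow> bool" where
  "joined a b \<longleftrightarrow> (\<exists>\<gamma> \<in> {0..d a b} \<rightarrow> M. \<gamma> 0 = a \<and> \<gamma> (d a b) = b \<and>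
     (\<forall>s\<in>{0..d a b}. \<forall>t\<in>{0..d a b}. d (\<gamma> s) (\<gamma> t) = \<bar>s - t\<bar>))"

lemma geodesic_space_joined: "geodesic_space \<longleftrightarrow> (\<forall>a\<in>M. \<forall>b\<in>M. joined a b)"
  unfolding geodesic_space_def joined_def by simp

lemma joined_sym: assumes "joined a b" shows "joined b a"
proof -
  obtain \<gamma> where \<gamma>: "\<gamma> \<in> {0..d a b} \<rightarrow> M" "\<gamma> 0 = a" "\<gamma> (d a b) = b"
     "\<And>s t. s\<in>{0..d a b} \<Longrightarrow> t\<in>{0..d a b} \<Longrightarrow> d (\<gamma> s) (\<gamma> t) = \<bar>s - t\<bar>"
    using assms unfolding joined_def by blast
  show ?thesis unfolding joined_def commute[of b a]
  proof (intro bexI conjI ballI)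
    show "(\<lambda>t. \<gamma> (d a b - t)) \<in> {0..d a b} \<rightarrow> M" using \<gamma>(1) by auto
    fix s t assume "s \<in> {0..d a b}" "t \<in> {0..d a b}"
    then show "d (\<gamma> (d a b - s)) (\<gamma> (d a b - t)) = \<bar>s - t\<bar>" using \<gamma>(4)[of "d a b - s" "d a b - t"] by auto
  qed (use \<gamma> in auto)
qed

text \<open>A shortcut between two points of the concatenation would shorten the way from
  \<open>a\<close> to \<open>c\<close>.\<close>

lemma joined_trans:
  assumes M: "a \<in> M" "b \<in> M" "c \<in> M" and j: "joined a b" "joined b c" and le: "d a b + d b c \<le> d a c"
  shows "joined a c"
proof -
  obtain \<gamma> where \<gamma>: "\<gamma> \<in> {0..d a b} \<rightarrow> M" "\<gamma> 0 = a" "\<gamma> (d a b) = b"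
     "\<And>s t. s\<in>{0..d a b} \<Longrightarrow> t\<in>{0..d a b} \<Longrightarrow> d (\<gamma> s) (\<gamma> t) = \<bar>s - t\<bar>"
    using j(1) unfolding joined_def by blast
  obtain \<eta> where \<eta>: "\<eta> \<in> {0..d b c} \<rightarrow> M" "\<eta> 0 = b" "\<eta> (d b c) = c"
     "\<And>s t. s\<in>{0..d b c} \<Longrightarrow> t\<in>{0..d b c} \<Longrightarrow> d (\<eta> s) (\<eta> t) = \<bar>s - t\<bar>"
    using j(2) unfolding joined_def by blast
  have eq: "d a c = d a b + d b c" using le triangle[OF M] by linarith
  define \<theta> where "\<theta> t = (if t \<le> d a b then \<gamma> t else \<eta> (t - d a b))" for t
  have seg1: "\<theta> t = \<gamma> t \<and> \<gamma> t \<in> M \<and> d a (\<gamma> t) = t \<and> d (\<gamma> t) b = d a b - t" if "0 \<le> t" "t \<le> d a b" for t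
    using that \<gamma>(1) \<gamma>(2,3) \<gamma>(4)[of 0 t] \<gamma>(4)[of t "d a b"] unfolding \<theta>_def by auto
  have seg2: "\<theta> t = \<eta> (t - d a b) \<and> \<eta> (t - d a b) \<in> M \<and> d b (\<eta> (t - d a b)) = t - d a b \<and>
      d (\<eta> (t - d a b)) c = d a c - t" 
    if "d a b < t" "t \<le> d a c" for t
    using that \<eta>(1) \<eta>(2,3) \<eta>(4)[of 0 "t - d a b"] \<eta>(4)[of "t - d a b" "d b c"] unfolding \<theta>_def
        by (auto simp: eq)
  have \<theta>M: "\<theta> t \<in> M" if "0 \<le> t" "t \<le> d a c" for t using seg1[of t] seg2[of t] that by (cases "t \<le> d a b") auto
  have main: "d (\<theta> s) (\<theta> t) = t - s" if st: "0 \<le> s" "s \<le> t" "t \<le> d a c" for s t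
  proof -
    consider "t \<le> d a b" | "s \<le> d a b" "d a b < t" | "d a b < s" using st by linarith
    then show ?thesis
    proof cases
      case 1 then show ?thesis using st \<gamma>(4)[of s t] unfolding \<theta>_def by auto
    next
      case 3 then show ?thesis using st \<eta>(4)[of "s - d a b" "t - d a b"] eq unfolding \<theta>_def by auto
    next
      case 2
      note s = seg1[OF st(1) 2(1)] and t = seg2[OF 2(2) st(3)]
      have "d (\<theta> s) (\<theta> t) \<le> d (\<theta> s) b + d b (\<theta> t)" using triangle[of "\<theta> s" b "\<theta> t"] s t M by auto
      moreover have "d a c \<le> d a (\<theta> s) + d (\<theta> s) (\<theta> t) + d (\<theta> t) c"
        using triangle[of a "\<theta> s" c] triangle[of "\<theta> s" "\<theta> t" c] s t M by auto
      ultimately show ?thesis using s t by simp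
    qed
  qed
  show ?thesis unfolding joined_def
  proof (intro bexI[of _ \<theta>] conjI ballI)
    show "\<theta> \<in> {0..d a c} \<rightarrow> M" using \<theta>M by auto
    show "\<theta> 0 = a" using \<gamma> unfolding \<theta>_def by simp
    show "\<theta> (d a c) = c"
    proof (cases "d b c = 0")
      case True
      then have "b = c" using M by simp
      then show ?thesis using \<gamma> unfolding \<theta>_def by simp
    next
      case False
      then have "\<not> d a c \<le> d a b" using eq nonneg[of b c] by linarith
      then show ?thesis using \<eta> eq unfolding \<theta>_def by simp
    qed
    fix s t assume "s \<in> {0..d a c}" "t \<in> {0..d a c}"
    then show "d (\<theta> s) (\<theta> t) = \<bar>s - t\<bar>" using main[of s t] main[of t s] commute[of "\<theta> s" "\<theta> t"]
        by (cases "s \<le> t") auto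
  qed
qed

lemma joinedI:
  assumes "d a b = l" "\<gamma> \<in> {0..l} \<rightarrow> M" "\<gamma> 0 = a" "\<gamma> l = b"
    "\<And>s t. 0 \<le> s \<Longrightarrow> s \<le> l \<Longrightarrow> 0 \<le> t \<Longrightarrow> t \<le> l \<Longrightarrow> d (\<gamma> s) (\<gamma> t) = \<bar>s - t\<bar>"
  shows "joined a b"
  unfolding joined_def assms(1) using assms(2-) by (intro bexI[of _ \<gamma>]) auto

text \<open>
  Every ordered pair \<open>(u, v)\<close> of adjacent vertices contributes its own edge, \<open>t\<close> being the distance from
  \<open>u\<close>: thus \<open>(u, v, t)\<close> and \<open>(v, u, d u v - t)\<close> are different points unless they are end points.
\<close>

definition edge_points :: "('a \<times> 'a \<times> real) set" where
  "edge_points = {(u, v, t). u \<in> M \<and> v \<in> M \<and> d u v \<le> 1 \<and> 0 \<le> t \<and> t \<le> d u v}"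

definition vertex_dist :: "'a \<times> 'a \<times> real \<Rightarrow> 'a \<Rightarrow> real" where
  "vertex_dist = (\<lambda>(u, v, t) w. min (t + d u w) (d u v - t + d v w))"

text \<open>On a common edge no detour through the ends is shorter, because the edge is as long as
  the distance of its ends.\<close>

definition edge_point_dist :: "'a \<times> 'a \<times> real \<Rightarrow> 'a \<times> 'a \<times> real \<Rightarrow> real" where
  "edge_point_dist p = (\<lambda>(u, v, t). if fst p = u \<and> fst (snd p) = v then \<bar>snd (snd p) - t\<bar>
     else min (vertex_dist p u + t) (vertex_dist p v + (d u v - t)))"

lemma edge_point_dist_same: "edge_point_dist (u, v, s) (u, v, t) = \<bar>s - t\<bar>"
  unfolding edge_point_dist_def by simp

lemma vertex_dist_nonneg: "p \<in> edge_points \<Longrightarrow> 0 \<le> vertex_dist p w"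
  unfolding edge_points_def vertex_dist_def by auto

lemma vertex_dist_triangle:
  assumes "p \<in> edge_points" "w \<in> M" "w' \<in> M"
  shows "vertex_dist p w \<le> vertex_dist p w' + d w w'" "d w w' \<le> vertex_dist p w + vertex_dist p w'"
proof -
  obtain u v t where p: "p = (u,v,t)" by (cases p) auto
  have M: "u \<in> M" "v \<in> M" "0 \<le> t" "t \<le> d u v" using assms unfolding p edge_points_def by auto
  have "d u w \<le> d u w' + d w w'" "d v w \<le> d v w' + d w w'" using triangle' M assms by auto
  then show "vertex_dist p w \<le> vertex_dist p w' + d w w'" unfolding p vertex_dist_def by (auto simp: min_def)
  have "d w w' \<le> d u w + d u w'" "d w w' \<le> d v w + d v w'" using triangle'' M assms by auto
  moreover have "d w w' \<le> d u w + d u v + d v w'" "d w w' \<le> d v w + d u v + d u w'"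
    using triangle''[of w u w'] triangle''[of w v w'] triangle[of u v w'] triangle''[of v u w'] M
        assms by linarith+
  ultimately show "d w w' \<le> vertex_dist p w + vertex_dist p w'" using M unfolding p vertex_dist_def
      by (auto simp: min_def)
qed

lemma vertex_dist_same_edge: "vertex_dist (u, v, s) w \<le> vertex_dist (u, v, t) w + \<bar>s - t\<bar>"
  unfolding vertex_dist_def by (auto simp: min_def)

lemma edge_point_dist_le:
  assumes p: "p \<in> edge_points" and q: "q \<in> edge_points" and w: "w \<in> M"
  shows "edge_point_dist p q \<le> vertex_dist p w + vertex_dist q w"
proof -
  obtain u v t where q': "q = (u,v,t)" by (cases q) auto
  have M: "u \<in> M" "v \<in> M" "0 \<le> t" "t \<le> d u v" using q unfolding q' edge_points_def by auto
  show ?thesis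
  proof (cases "fst p = u \<and> fst (snd p) = v")
    case True
    then obtain s where p': "p = (u,v,s)" by (cases p) auto
    have s: "0 \<le> s" "s \<le> d u v" using p unfolding p' edge_points_def by auto
    have "d u v \<le> d u w + d v w" using triangle' M w by auto
    moreover have "\<bar>s - t\<bar> \<le> min (s + a) (l - s + b) + min (t + a) (l - t + b)"
      if "0 \<le> a" "0 \<le> b" "l \<le> a + b" "s \<le> l" "t \<le> l" for a b l
      using that s(1) M(3) by (auto simp: min_def abs_le_iff)
    ultimately show ?thesis unfolding p' q' edge_point_dist_same using s M unfolding vertex_dist_def by simp
  next
    case False
    then have "edge_point_dist p q = min (vertex_dist p u + t) (vertex_dist p v + (d u v - t))"
      unfolding q' edge_point_dist_def by auto
    moreover have "vertex_dist p u \<le> vertex_dist p w + d u w" "vertex_dist p v \<le> vertex_dist p w + d v w"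
      using vertex_dist_triangle(1)[OF p] M w by auto
    ultimately show ?thesis unfolding q' vertex_dist_def by (auto simp: min_def)
  qed
qed

text \<open>With \<open>edge_point_dist_le\<close> this says that off a common edge the distance is
  a minimum over ways through a vertex. Symmetry, the triangle inequality and the existence of
  geodesics all reduce to these two cases.\<close>

lemma edge_point_dist_cases:
  assumes p: "p \<in> edge_points" and q: "q \<in> edge_points"
  obtains (same) u v s t where "p = (u, v, s)" "q = (u, v, t)" "edge_point_dist p q = \<bar>s - t\<bar>"
  | (vertex) w where "w \<in> {fst q, fst (snd q)}" "w \<in> M" "edge_point_dist p q = vertex_dist p w +
      vertex_dist q w"
proof -
  obtain u v t where q': "q = (u,v,t)" by (cases q) auto
  have M: "u \<in> M" "v \<in> M" "0 \<le> t" "t \<le> d u v" using q unfolding q' edge_points_def by auto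
  show thesis
  proof (cases "fst p = u \<and> fst (snd p) = v")
    case True
    then obtain s where "p = (u,v,s)" by (cases p) auto
    then show ?thesis using same q' edge_point_dist_same by metis
  next
    case False
    then have "edge_point_dist p q = min (vertex_dist p u + t) (vertex_dist p v + (d u v - t))"
      unfolding q' edge_point_dist_def by auto
    moreover have "vertex_dist q u \<le> t" "vertex_dist q v \<le> d u v - t" unfolding q' vertex_dist_def
        using M by auto
    moreover have "edge_point_dist p q \<le> vertex_dist p u + vertex_dist q u" "edge_point_dist p q \<le>
        vertex_dist p v + vertex_dist q v"
      using edge_point_dist_le[OF p q] M by auto
    ultimately have "edge_point_dist p q = vertex_dist p u + vertex_dist q u \<or>
        edge_point_dist p q = vertex_dist p v + vertex_dist q v"
      by linarith
    then show ?thesis using vertex[of u] vertex[of v] M unfolding q' by auto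
  qed
qed

lemma edge_point_dist_self: "edge_point_dist p p = 0"
  unfolding edge_point_dist_def by (auto split: prod.splits)

lemma edge_point_dist_nonneg:
  assumes "p \<in> edge_points" "q \<in> edge_points" shows "0 \<le> edge_point_dist p q"
  using edge_point_dist_cases[OF assms] vertex_dist_nonneg assms by (metis abs_ge_zero add_nonneg_nonneg)

lemma edge_point_dist_commute:
  assumes "p \<in> edge_points" "q \<in> edge_points" shows "edge_point_dist p q = edge_point_dist q p"
proof -
  have "edge_point_dist q p \<le> edge_point_dist p q" if pq: "p \<in> edge_points" "q \<in> edge_points" for p q
    using pq
  proof (cases rule: edge_point_dist_cases)
    case (same u v s t) then show ?thesis using edge_point_dist_same by simp
  next
    case (vertex w) then show ?thesis using edge_point_dist_le[OF pq(2,1), of w] by simp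
  qed
  then show ?thesis using assms by (meson antisym)
qed

lemma edge_point_dist_triangle:
  assumes p: "p \<in> edge_points" and q: "q \<in> edge_points" and r: "r \<in> edge_points"
  shows "edge_point_dist p r \<le> edge_point_dist p q + edge_point_dist q r"
  using p q
proof (cases rule: edge_point_dist_cases)
  case (same u v s t)
  note pq = same
  show ?thesis
    using q r
  proof (cases rule: edge_point_dist_cases)
    case (same u' v' s' t') then show ?thesis using pq by (auto simp: edge_point_dist_same)
  next
    case (vertex w)
    have "vertex_dist p w \<le> vertex_dist q w + \<bar>s - t\<bar>" unfolding pq by (rule vertex_dist_same_edge)
    then show ?thesis using edge_point_dist_le[OF p r vertex(2)] vertex pq by linarith
  qed
next
  case (vertex w)
  note pq = vertex
  show ?thesis
    using q r
  proof (cases rule: edge_point_dist_cases)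
    case (same u' v' s' t')
    have "vertex_dist r w \<le> vertex_dist q w + \<bar>t' - s'\<bar>" unfolding same by (rule vertex_dist_same_edge)
    then show ?thesis using edge_point_dist_le[OF p r pq(2)] same pq by linarith
  next
    case (vertex w')
    have "edge_point_dist p r \<le> vertex_dist p w' + vertex_dist r w'"
        using edge_point_dist_le[OF p r vertex(2)] .
    moreover have "vertex_dist p w' \<le> vertex_dist p w + d w' w" "d w' w \<le> vertex_dist q w' + vertex_dist q w"
      using vertex_dist_triangle p q pq vertex by auto
    ultimately show ?thesis using pq vertex by linarith
  qed
qed

text \<open>Points at distance 0 are glued, in particular all copies of a vertex at the ends of its
  edges.\<close>

definition edge_point_class :: "'a \<times> 'a \<times> real \<Rightarrow> 'a realization_point" where
  "edge_point_class p = {q \<in> edge_points. edge_point_dist p q = 0}"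

definition realization :: "'a realization_point set" where
  "realization = edge_point_class ` edge_points"

text \<open>The value outside the realization matters: \<^locale>\<open>Metric_space\<close> demands symmetry for all arguments.\<close>

definition realization_dist :: "'a realization_point \<Rightarrow> 'a realization_point \<Rightarrow> real" where
  "realization_dist A B = (if A \<in> realization \<and> B \<in> realization
     then edge_point_dist (SOME p. p \<in> A) (SOME q. q \<in> B) else 0)"

lemma realization_dist_class:
  assumes p: "p \<in> edge_points" and q: "q \<in> edge_points"
  shows "realization_dist (edge_point_class p) (edge_point_class q) = edge_point_dist p q"
proof -
  have some: "(SOME p'. p' \<in> edge_point_class p) \<in> edge_point_class p" if "p \<in> edge_points" for p
    by (rule someI[of _ p]) (use that edge_point_dist_self in \<open>simp add: edge_point_class_def\<close>)
  define p' where "p' = (SOME p'. p' \<in> edge_point_class p)"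
  define q' where "q' = (SOME q'. q' \<in> edge_point_class q)"
  have p1: "p' \<in> edge_points" "edge_point_dist p p' = 0"
    using some[OF p] unfolding p'_def[symmetric] unfolding edge_point_class_def by auto
  note p' = p1 edge_point_dist_commute[OF p p1(1), unfolded p1(2), symmetric]
  have q1: "q' \<in> edge_points" "edge_point_dist q q' = 0"
    using some[OF q] unfolding q'_def[symmetric] unfolding edge_point_class_def by auto
  note q' = q1 edge_point_dist_commute[OF q q1(1), unfolded q1(2), symmetric]
  have "edge_point_dist p' q' = edge_point_dist p q"
    using edge_point_dist_triangle[OF p'(1) p q'(1)] edge_point_dist_triangle[OF p q q'(1)]
      edge_point_dist_triangle[OF p p'(1) q] edge_point_dist_triangle[OF p'(1) q'(1) q] p' q' by linarith
  then show ?thesis unfolding realization_dist_def p'_def q'_def realization_def using p q by auto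
qed

lemma edge_point_class_eq:
  assumes p: "p \<in> edge_points" and q: "q \<in> edge_points" and pq: "edge_point_dist p q = 0"
  shows "edge_point_class p = edge_point_class q"
proof -
  have "edge_point_dist p r = edge_point_dist q r" if r: "r \<in> edge_points" for r
    using edge_point_dist_triangle[OF p q r] edge_point_dist_triangle[OF q p r] pq
        edge_point_dist_commute[OF p q] by linarith
  then show ?thesis unfolding edge_point_class_def by auto
qed

lemma realization_metric: "Metric_space realization realization_dist"
proof
  show "0 \<le> realization_dist A B" for A B
  proof (cases "A \<in> realization \<and> B \<in> realization")
    case True
    then obtain p q where "p \<in> edge_points" "q \<in> edge_points" "A = edge_point_class p"
        "B = edge_point_class q"
      unfolding realization_def by auto
    then show ?thesis using realization_dist_class edge_point_dist_nonneg by simp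
  qed (auto simp: realization_dist_def)
  show "realization_dist A B = realization_dist B A" for A B
  proof (cases "A \<in> realization \<and> B \<in> realization")
    case True
    then obtain p q where "p \<in> edge_points" "q \<in> edge_points" "A = edge_point_class p"
        "B = edge_point_class q"
      unfolding realization_def by auto
    then show ?thesis using realization_dist_class edge_point_dist_commute by simp
  qed (auto simp: realization_dist_def)
  fix A B assume AB: "A \<in> realization" "B \<in> realization"
  then obtain p q where p: "p \<in> edge_points" "A = edge_point_class p"
      and q: "q \<in> edge_points" "B = edge_point_class q"
    unfolding realization_def by auto
  show "(realization_dist A B = 0) = (A = B)"
    using realization_dist_class p q edge_point_class_eq edge_point_dist_self by metis
  fix C assume "C \<in> realization"
  then obtain r where r: "r \<in> edge_points" "C = edge_point_class r" unfolding realization_def by auto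
  show "realization_dist A C \<le> realization_dist A B + realization_dist B C"
    using realization_dist_class p q r edge_point_dist_triangle by simp
qed

text \<open>The pair \<open>(u, u)\<close> counts as an edge of length 0 and thus supplies a
  canonical representative of a vertex.\<close>

definition vertex_point :: "'a \<Rightarrow> 'a realization_point" where
  "vertex_point u = edge_point_class (u, u, 0)"

lemma vertex_edge_point: "u \<in> M \<Longrightarrow> (u, u, 0) \<in> edge_points"
  unfolding edge_points_def by simp

lemma vertex_point_closed: "u \<in> M \<Longrightarrow> vertex_point u \<in> realization"
  unfolding vertex_point_def realization_def using vertex_edge_point by blast

lemma edge_point_dist_vertex:
  assumes "p \<in> edge_points" "w \<in> M" shows "edge_point_dist p (w, w, 0) = vertex_dist p w"
proof (cases "fst p = w \<and> fst (snd p) = w")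
  case True
  then obtain t where "p = (w,w,t)" by (cases p) auto
  then have "p = (w,w,0)" using assms unfolding edge_points_def by auto
  then show ?thesis using assms unfolding edge_point_dist_def vertex_dist_def by simp
next
  case False
  then show ?thesis using assms unfolding edge_point_dist_def by auto
qed

lemma realization_dist_vertex:
  assumes "p \<in> edge_points" "w \<in> M"
  shows "realization_dist (edge_point_class p) (vertex_point w) = vertex_dist p w"
  unfolding vertex_point_def using realization_dist_class[OF assms(1) vertex_edge_point[OF assms(2)]]
    edge_point_dist_vertex[OF assms] by simp

lemma vertex_point_dist:
  assumes "u \<in> M" "v \<in> M" shows "realization_dist (vertex_point u) (vertex_point v) = d u v"
  using realization_dist_vertex[OF vertex_edge_point[OF assms(1)] assms(2)] assms
  unfolding vertex_point_def[symmetric] vertex_dist_def by simp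

lemma near_vertex_point:
  assumes "A \<in> realization" shows "\<exists>u\<in>M. realization_dist A (vertex_point u) \<le> 1"
proof -
  obtain u v t where p: "(u,v,t) \<in> edge_points" "A = edge_point_class (u,v,t)" using assms
      unfolding realization_def by auto
  then have "u \<in> M" "t \<le> 1" unfolding edge_points_def by auto
  moreover have "realization_dist A (vertex_point u) \<le> 1"
    unfolding p(2) realization_dist_vertex[OF p(1) \<open>u \<in> M\<close>] using \<open>t \<le> 1\<close> \<open>u \<in> M\<close>
        unfolding vertex_dist_def by simp
  ultimately show ?thesis by blast
qed

text \<open>\<open>path\<close> expresses that \<open>d\<close> is a graph metric. Geodesics are
  concatenated from pieces: inside an edge, along a path of vertices, and from a point to that end
  of its edge through which the distance to a vertex is attained.\<close>

lemma realization_geodesic: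
  assumes path: "\<And>a b. a \<in> M \<Longrightarrow> b \<in> M \<Longrightarrow> \<exists>y n. y 0 = a \<and> y n = b \<and> d a b = real n \<and>
     (\<forall>i\<le>n. y i \<in> M) \<and> (\<forall>i<n. d (y i) (y (Suc i)) \<le> 1)"
  shows "Metric_space.geodesic_space realization realization_dist"
proof -
  interpret Y: Metric_space realization realization_dist by (rule realization_metric)
  have cl: "edge_point_class p \<in> realization" if "p \<in> edge_points" for p using that
      unfolding realization_def by blast
  have edge: "Y.joined (edge_point_class (u,v,s)) (edge_point_class (u,v,t))"
    if p: "(u,v,s) \<in> edge_points" "(u,v,t) \<in> edge_points" for u v s t
  proof -
    have *: "Y.joined (edge_point_class (u,v,s)) (edge_point_class (u,v,t))"
      if p: "(u,v,s) \<in> edge_points" "(u,v,t) \<in> edge_points" "s \<le> t" for s t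
    proof (rule Y.joinedI)
      show "realization_dist (edge_point_class (u,v,s)) (edge_point_class (u,v,t)) = t - s"
        using realization_dist_class[OF p(1,2)] p(3) by (simp add: edge_point_dist_same)
      have r: "(u,v,s + r) \<in> edge_points" if "0 \<le> r" "r \<le> t - s" for r using p that
          unfolding edge_points_def by auto
      then show "(\<lambda>r. edge_point_class (u,v,s + r)) \<in> {0..t - s} \<rightarrow> realization" using cl by auto
      show "realization_dist (edge_point_class (u,v,s + r)) (edge_point_class (u,v,s + r')) = \<bar>r - r'\<bar>"
        if "0 \<le> r" "r \<le> t - s" "0 \<le> r'" "r' \<le> t - s" for r r'
        using realization_dist_class r that by (simp add: edge_point_dist_same)
    qed auto
    show ?thesis using *[OF p] *[OF p(2,1)] Y.joined_sym by (cases "s \<le> t") auto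
  qed
  have ends: "edge_point_class (u,v,0) = vertex_point u" "edge_point_class (u,v,d u v) = vertex_point v"
    "(u,v,0) \<in> edge_points" "(u,v,d u v) \<in> edge_points" if M: "u \<in> M" "v \<in> M" "d u v \<le> 1" for u v
  proof -
    show e: "(u,v,0) \<in> edge_points" "(u,v,d u v) \<in> edge_points" using M unfolding edge_points_def by auto
    show "edge_point_class (u,v,0) = vertex_point u" unfolding vertex_point_def
      by (rule edge_point_class_eq[OF e(1) vertex_edge_point[OF M(1)]])
        (use edge_point_dist_vertex[OF e(1) M(1)] M in \<open>simp add: vertex_dist_def\<close>)
    show "edge_point_class (u,v,d u v) = vertex_point v" unfolding vertex_point_def
      by (rule edge_point_class_eq[OF e(2) vertex_edge_point[OF M(2)]])
        (use edge_point_dist_vertex[OF e(2) M(2)] M in \<open>simp add: vertex_dist_def\<close>)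
  qed
  have to_end: "Y.joined (edge_point_class p) (vertex_point w)" if p: "p \<in> edge_points"
      and w: "w \<in> {fst p, fst (snd p)}" for p w
  proof -
    obtain u v t where p': "p = (u,v,t)" by (cases p) auto
    have M: "u \<in> M" "v \<in> M" "d u v \<le> 1" using p unfolding p' edge_points_def by auto
    show ?thesis using edge[OF _ ends(3)[OF M], of t] edge[OF _ ends(4)[OF M], of t] p w ends(1,2)[OF
        M] unfolding p' by auto
  qed
  have vertices: "Y.joined (vertex_point a) (vertex_point b)" if ab: "a \<in> M" "b \<in> M" for a b
  proof -
    obtain y n where y: "y 0 = a" "y n = b" "d a b = real n" and yM: "\<And>i. i \<le> n \<Longrightarrow> y i \<in> M"
      and y1: "\<And>i. i < n \<Longrightarrow> d (y i) (y (Suc i)) \<le> 1" using path[OF ab] by blast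
    have up: "d (y i) (y (i + l)) \<le> real l" if "i + l \<le> n" for i l
      using that
    proof (induction l)
      case (Suc l)
      have "d (y i) (y (i + Suc l)) \<le> d (y i) (y (i + l)) + d (y (i + l)) (y (i + Suc l))"
        using triangle yM Suc.prems by auto
      then show ?case using Suc y1[of "i + l"] by simp
    qed (use yM in auto)
    \<comment> \<open>Initial segments of a shortest path are shortest, so that its edges can be
      appended one at a time.\<close>
    have eq: "d (y 0) (y i) = real i" if "i \<le> n" for i
      using up[of 0 i] up[of i "n - i"] that triangle[of "y 0" "y i" "y n"] yM y by (auto simp: of_nat_diff)
    have "Y.joined (vertex_point (y 0)) (vertex_point (y i))" if "i \<le> n" for i
      using that
    proof (induction i)
      case 0
      have m: "y 0 \<in> M" using yM by simp
      show ?case by (rule Y.joinedI[where \<gamma> = "\<lambda>_. vertex_point (y 0)" and l = 0])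
          (use vertex_point_closed[OF m] in auto)
    next
      case (Suc i)
      have M: "y 0 \<in> M" "y i \<in> M" "y (Suc i) \<in> M" "d (y i) (y (Suc i)) \<le> 1" using yM y1 Suc.prems by auto
      have "Y.joined (vertex_point (y i)) (vertex_point (y (Suc i)))"
        using edge[OF ends(3,4)[OF M(2-4)]] ends(1,2)[OF M(2-4)] by simp
      moreover have "d (y 0) (y i) + d (y i) (y (Suc i)) \<le> d (y 0) (y (Suc i))"
        using eq[of i] eq[of "Suc i"] M(4) Suc.prems by simp
      ultimately show ?case
        using Y.joined_trans[of "vertex_point (y 0)" "vertex_point (y i)" "vertex_point (y (Suc i))"] Suc M
        by (simp add: vertex_point_closed vertex_point_dist)
    qed
    then show ?thesis using y by auto
  qed
  have to_vertex: "Y.joined (edge_point_class p) (vertex_point w)" if p: "p \<in> edge_points"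
      and w: "w \<in> M" for p w
  proof -
    obtain u v t where p': "p = (u,v,t)" by (cases p) auto
    have M: "u \<in> M" "v \<in> M" "d u v \<le> 1" "0 \<le> t" "t \<le> d u v" using p unfolding p' edge_points_def by auto
    have "vertex_dist p w = t + d u w \<or> vertex_dist p w = (d u v - t) + d v w"
        unfolding p' vertex_dist_def by auto
    moreover have "vertex_dist p u \<le> t" "vertex_dist p v \<le> d u v - t" using M
        unfolding p' vertex_dist_def by auto
    ultimately obtain e where e: "e \<in> {u, v}" "vertex_dist p e + d e w \<le> vertex_dist p w" by force
    have eM: "e \<in> M" using e M by auto
    have "e \<in> {fst p, fst (snd p)}" using e p' by simp
    then show ?thesis
      by (rule Y.joined_trans[OF cl[OF p] vertex_point_closed[OF eM] vertex_point_closed[OF w]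
          to_end[OF p] vertices[OF eM w]])
        (use e(2) in \<open>simp only: realization_dist_vertex[OF p eM] realization_dist_vertex[OF p w]
            vertex_point_dist[OF eM w]\<close>)
  qed
  show ?thesis unfolding Y.geodesic_space_joined
  proof (intro ballI)
    fix A B assume "A \<in> realization" "B \<in> realization"
    then obtain p q where p: "p \<in> edge_points" "A = edge_point_class p"
        and q: "q \<in> edge_points" "B = edge_point_class q"
      unfolding realization_def by auto
    show "Y.joined A B" using p(1) q(1)
    proof (cases rule: edge_point_dist_cases)
      case (same u v s t)
      then show ?thesis using edge p q by simp
    next
      case (vertex w)
      show ?thesis unfolding p q
      proof (rule Y.joined_trans[OF cl[OF p(1)] vertex_point_closed[OF vertex(2)] cl[OF q(1)]
          to_vertex[OF p(1) vertex(2)]])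
        show "Y.joined (vertex_point w) (edge_point_class q)"
            using Y.joined_sym to_vertex[OF q(1) vertex(2)] by blast
        show "realization_dist (edge_point_class p) (vertex_point w) + realization_dist (vertex_point
            w) (edge_point_class q)
            \<le> realization_dist (edge_point_class p) (edge_point_class q)"
          using vertex(3) realization_dist_vertex[OF p(1) vertex(2)] realization_dist_vertex[OF q(1)
              vertex(2)]
            Y.commute[of "vertex_point w"] realization_dist_class[OF p(1) q(1)] by simp
      qed
    qed
  qed
qed

text \<open>Moving every point to a vertex within distance 1 changes distances by at most 2 and
  Gromov products by at most 3. The inequality compares two such products, which adds 6 to
  \<delta>.\<close>

lemma realization_hyperbolic:
  assumes gromov_hyperbolic
  shows "Metric_space.gromov_hyperbolic realization realization_dist"
proof -
  interpret Y: Metric_space realization realization_dist by (rule realization_metric)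
  obtain \<delta> where \<delta>: "\<And>w x y z. w \<in> M \<Longrightarrow> x \<in> M \<Longrightarrow> y \<in> M \<Longrightarrow> z \<in> M \<Longrightarrow>
        gromov_product w x z \<ge> min (gromov_product w x y) (gromov_product w y z) - \<delta>"
    using assms unfolding gromov_hyperbolic_def by blast
  define f where "f A = (SOME u. u \<in> M \<and> realization_dist A (vertex_point u) \<le> 1)" for A
  have f: "f A \<in> M" "realization_dist A (vertex_point (f A)) \<le> 1" if "A \<in> realization" for A
    using someI_ex[of "\<lambda>u. u \<in> M \<and> realization_dist A (vertex_point u) \<le> 1"] near_vertex_point[OF that]
    unfolding f_def by blast+
  have dist: "\<bar>realization_dist A B - d (f A) (f B)\<bar> \<le> 2" if AB: "A \<in> realization" "B \<in> realization" for A B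
  proof -
    note a = f[OF AB(1)] vertex_point_closed[OF f(1)[OF AB(1)]]
        and b = f[OF AB(2)] vertex_point_closed[OF f(1)[OF AB(2)]]
    show ?thesis
      using Y.triangle[OF AB(1) a(3) AB(2)] Y.triangle'[OF a(3) b(3) AB(2)] Y.triangle''[OF a(3) AB(1)
          b(3)] Y.triangle[OF AB b(3)]
        a(2) b(2) vertex_point_dist[OF a(1) b(1)] by linarith
  qed
  have prod: "\<bar>Y.gromov_product C A B - gromov_product (f C) (f A) (f B)\<bar> \<le> 3"
    if "A \<in> realization" "B \<in> realization" "C \<in> realization" for A B C
    using dist[of A C] dist[of B C] dist[of A B] that unfolding Y.gromov_product_def gromov_product_def
    by (auto simp: field_simps abs_le_iff)
  show ?thesis
  proof (rule Y.gromov_hyperbolicI)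
    fix W A B C assume Y: "W \<in> realization" "A \<in> realization" "B \<in> realization" "C \<in> realization"
    show "Y.gromov_product W A C \<ge> min (Y.gromov_product W A B) (Y.gromov_product W B C) - (\<delta> + 6)"
      using \<delta>[of "f W" "f A" "f B" "f C"] f(1) Y prod[of A C W] prod[of A B W] prod[of B C W]
      by (auto simp: min_def abs_le_iff split: if_splits)
  qed
qed

end

text \<open>Bijectivity comes from the inverse element. Extensionality enters because
  \<open>BijGroup\<close> consists of functions that are \<open>undefined\<close> off the
  set.\<close>

lemma group_actionI:
  fixes G (structure)
  assumes "group G" and cl: "\<And>g x. g \<in> carrier G \<Longrightarrow> x \<in> E \<Longrightarrow> \<psi> g x \<in> E"
    and ext: "\<And>g. g \<in> carrier G \<Longrightarrow> \<psi> g \<in> extensional E"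
    and one: "\<And>x. x \<in> E \<Longrightarrow> \<psi> \<one> x = x"
    and mult: "\<And>g h x. g \<in> carrier G \<Longrightarrow> h \<in> carrier G \<Longrightarrow> x \<in> E \<Longrightarrow> \<psi> (g \<otimes> h) x = \<psi> g (\<psi> h x)"
  shows "group_action G E \<psi>"
proof -
  interpret group G by fact
  have Bij: "\<psi> g \<in> Bij E" if g: "g \<in> carrier G" for g
  proof -
    have "bij_betw (\<psi> g) E E"
      by (rule bij_betwI[where g = "\<psi> (inv g)"]) (use g cl one mult[symmetric] in auto)
    then show ?thesis using ext[OF g] unfolding Bij_def by simp
  qed
  have "\<psi> (g \<otimes> h) = compose E (\<psi> g) (\<psi> h)" if "g \<in> carrier G" "h \<in> carrier G" for g h
    by (rule extensionalityI[OF ext compose_extensional]) (use that mult in \<open>auto simp: compose_eq\<close>)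
  then have "\<psi> \<in> hom G (BijGroup E)" using Bij by (auto simp: hom_def BijGroup_def)
  then show ?thesis
    using group_BijGroup[of E] is_group unfolding group_action_def group_hom_def group_hom_axioms_def by blast
qed

section \<open>The induced action on the realization\<close>

context isometric_action begin

definition edge_point_map :: "'g \<Rightarrow> 'a \<times> 'a \<times> real \<Rightarrow> 'a \<times> 'a \<times> real" where
  "edge_point_map h = (\<lambda>(u, v, t). (\<phi> h u, \<phi> h v, t))"

text \<open>The restriction to \<open>realization\<close> makes the map extensional, as membership
  in \<open>BijGroup\<close> demands.\<close>

definition realization_action :: "'g \<Rightarrow> 'a realization_point \<Rightarrow> 'a realization_point" where
  "realization_action h = (\<lambda>A\<in>realization. edge_point_map h ` A)"

lemma edge_point_map_closed: "h \<in> carrier G \<Longrightarrow> p \<in> edge_points \<Longrightarrow> edge_point_map h p \<in> edge_points"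
  unfolding edge_points_def edge_point_map_def using act_closed isometry by auto

lemma edge_point_map_inv:
  assumes "h \<in> carrier G" "p \<in> edge_points"
  shows "edge_point_map (inv h) (edge_point_map h p) = p" "edge_point_map h (edge_point_map (inv h) p) = p"
  using assms act_inv act_inv' unfolding edge_points_def edge_point_map_def by auto

lemma edge_point_map_dist:
  assumes h: "h \<in> carrier G" and p: "p \<in> edge_points" and q: "q \<in> edge_points"
  shows "edge_point_dist (edge_point_map h p) (edge_point_map h q) = edge_point_dist p q"
proof -
  obtain u v t where q': "q = (u,v,t)" by (cases q) auto
  obtain u' v' t' where p': "p = (u',v',t')" by (cases p) auto
  have M: "u \<in> M" "v \<in> M" "u' \<in> M" "v' \<in> M" using p q unfolding p' q' edge_points_def by auto
  then have "\<phi> h a = \<phi> h b \<longleftrightarrow> a = b" if "a \<in> M" "b \<in> M" for a b using inj_prop[OF h] that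
      by (meson inj_on_eq_iff)
  then show ?thesis unfolding p' q' edge_point_map_def edge_point_dist_def vertex_dist_def
      using M isometry[OF h] by simp
qed

lemma edge_point_map_class:
  assumes h: "h \<in> carrier G" and p: "p \<in> edge_points"
  shows "edge_point_map h ` edge_point_class p = edge_point_class (edge_point_map h p)"
proof (intro equalityI subsetI)
  fix q assume "q \<in> edge_point_map h ` edge_point_class p"
  then show "q \<in> edge_point_class (edge_point_map h p)"
    using edge_point_map_closed[OF h] edge_point_map_dist[OF h p] unfolding edge_point_class_def by auto
next
  fix q assume "q \<in> edge_point_class (edge_point_map h p)"
  then have q: "q \<in> edge_points" "edge_point_dist (edge_point_map h p) q = 0"
      unfolding edge_point_class_def by auto
  define r where "r = edge_point_map (inv h) q"
  have r: "r \<in> edge_points" "edge_point_map h r = q" unfolding r_def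
    using edge_point_map_closed h q edge_point_map_inv(2)[OF h q(1)] by auto
  then have "r \<in> edge_point_class p" unfolding edge_point_class_def
      using edge_point_map_dist[OF h p r(1)] q by auto
  then show "q \<in> edge_point_map h ` edge_point_class p" using r by blast
qed

lemma realization_action_class:
  assumes "h \<in> carrier G" "p \<in> edge_points"
  shows "realization_action h (edge_point_class p) = edge_point_class (edge_point_map h p)"
  unfolding realization_action_def using edge_point_map_class[OF assms] assms
      unfolding realization_def by auto

lemma realization_action_vertex:
  assumes "h \<in> carrier G" "u \<in> M" shows "realization_action h (vertex_point u) = vertex_point (\<phi> h u)"
  unfolding vertex_point_def using realization_action_class[OF assms(1) vertex_edge_point[OF assms(2)]]
  by (simp add: edge_point_map_def)

lemma realization_isometric_action: "isometric_action G realization realization_dist realization_action"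
proof -
  interpret Y: Metric_space realization realization_dist by (rule realization_metric)
  have "group_action G realization realization_action"
  proof (rule group_actionI[OF grp.is_group])
    show "realization_action h \<in> extensional realization" for h unfolding realization_action_def by simp
    fix A assume "A \<in> realization"
    then obtain p where p: "p \<in> edge_points" "A = edge_point_class p" unfolding realization_def by auto
    show "realization_action h A \<in> realization" if "h \<in> carrier G" for h
      using p realization_action_class[OF that p(1)] edge_point_map_closed[OF that p(1)]
          unfolding realization_def by auto
    have "edge_point_map \<one> p = p" using p act_one unfolding edge_points_def edge_point_map_def by auto
    then show "realization_action \<one> A = A" using p realization_action_class[OF grp.one_closed p(1)] by simp
    fix g h assume gh: "g \<in> carrier G" "h \<in> carrier G"
    have "edge_point_map (g \<otimes> h) p = edge_point_map g (edge_point_map h p)"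
      using p gh composition_rule unfolding edge_points_def edge_point_map_def by auto
    then show "realization_action (g \<otimes> h) A = realization_action g (realization_action h A)"
      using p gh realization_action_class edge_point_map_closed by simp
  qed
  moreover have "isometric_action_axioms G realization realization_dist realization_action"
  proof
    fix h A B assume h: "h \<in> carrier G" and "A \<in> realization" "B \<in> realization"
    then obtain p q where p: "p \<in> edge_points" "A = edge_point_class p"
        and q: "q \<in> edge_points" "B = edge_point_class q"
      unfolding realization_def by auto
    then show "realization_dist (realization_action h A) (realization_action h B) = realization_dist A B"
      using realization_action_class[OF h] realization_dist_class edge_point_map_closed[OF h]
          edge_point_map_dist[OF h] by simp
  qed
  ultimately show ?thesis using Y.Metric_space_axioms by (simp add: isometric_action_def)
qed

end

section \<open>The cobounded action\<close>

context isometric_action begin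

lemma realization_loxodromic:
  assumes "loxodromic h" "x \<in> M"
  shows "isometric_action.loxodromic G realization realization_dist realization_action h"
proof -
  note h = loxodromic_carrier[OF assms(1)]
  interpret Y: isometric_action G realization realization_dist realization_action
      by (rule realization_isometric_action)
  obtain K C where K: "1 \<le> K" "0 \<le> C" "\<And>n::int. real_of_int \<bar>n\<bar> / K - C \<le> d x (\<phi> (h [^] n) x)"
    using loxodromicE[OF assms] by metis
  show ?thesis
    by (rule Y.loxodromicI[OF h vertex_point_closed[OF assms(2)] K(1,2)])
      (use h K(3) assms(2) in \<open>simp add: realization_action_vertex vertex_point_dist pow_closed\<close>)
qed

text \<open>\<open>wpd\<close> concerns the base point \<open>x\<close> only, whereas
  \<open>WPD\<close> quantifies over all points of the realization. Moving from \<open>A\<close> to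
  the vertex \<open>x\<close> changes displacements by at most \<open>2 * c\<close>, which the
  radius absorbs.\<close>

lemma realization_WPD:
  assumes lox: "loxodromic h" and x: "x \<in> M"
    and wpd: "\<And>R. R > 0 \<Longrightarrow> \<exists>n::int. n > 0 \<and>
      finite {f \<in> carrier G. d x (\<phi> f x) \<le> R \<and> d (\<phi> (h [^] n) x) (\<phi> f (\<phi> (h [^] n) x)) \<le> R}"
  shows "isometric_action.WPD G realization realization_dist realization_action h"
proof -
  note h = loxodromic_carrier[OF lox]
  interpret Y: isometric_action G realization realization_dist realization_action
      by (rule realization_isometric_action)
  show ?thesis unfolding Y.WPD_def
  proof (intro conjI allI impI ballI)
    show "Y.loxodromic h" by (rule realization_loxodromic[OF lox x])
    fix R :: real and A assume R: "R > 0" and A: "A \<in> realization"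
    define p where "p = vertex_point x"
    have p: "p \<in> realization" unfolding p_def using vertex_point_closed[OF x] .
    define c where "c = realization_dist p A"
    have c: "c \<ge> 0" unfolding c_def by (rule Y.nonneg)
    have move: "realization_dist q (realization_action f q) \<le> realization_dist B (realization_action f
        B) + 2 * realization_dist q B"
      if "f \<in> carrier G" "q \<in> realization" "B \<in> realization" for f q B
      using Y.triangle[of q B "realization_action f q"] Y.triangle[of B "realization_action f B"
          "realization_action f q"]
        Y.isometry[OF that(1,3,2)] Y.act_closed that Y.commute[of B q] by auto
    have "R + 2 * c > 0" using R c by simp
    then obtain n :: int where n: "n > 0"
      "finite {f \<in> carrier G. d x (\<phi> f x) \<le> R + 2 * c \<and> d (\<phi> (h [^] n) x) (\<phi> f (\<phi> (h [^] n) x)) \<le> R +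
          2 * c}" (is "finite ?F")
      using wpd by blast
    have hn: "h [^] n \<in> carrier G" using h by simp
    have "{f \<in> carrier G. realization_dist A (realization_action f A) \<le> R \<and>
        realization_dist (realization_action (h [^] n) A) (realization_action f (realization_action (h
            [^] n) A)) \<le> R} \<subseteq> ?F"
    proof (clarify, intro conjI)
      fix f assume f: "f \<in> carrier G" and A1: "realization_dist A (realization_action f A) \<le> R"
        and A2: "realization_dist (realization_action (h [^] n) A) (realization_action f
            (realization_action (h [^] n) A)) \<le> R"
      show "d x (\<phi> f x) \<le> R + 2 * c"
        using move[OF f p A] A1 f x unfolding c_def[symmetric] unfolding p_def
        by (simp add: realization_action_vertex vertex_point_dist act_closed)
      have "realization_dist (realization_action (h [^] n) p) (realization_action (h [^] n) A) = c"
        using Y.isometry[OF hn p A] unfolding c_def .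
      then have "realization_dist (realization_action (h [^] n) p) (realization_action f
          (realization_action (h [^] n) p)) \<le> R + 2 * c"
        using move[OF f Y.act_closed[OF hn p] Y.act_closed[OF hn A]] A2 by simp
      then show "d (\<phi> (h [^] n) x) (\<phi> f (\<phi> (h [^] n) x)) \<le> R + 2 * c"
        using f hn x unfolding p_def by (simp add: realization_action_vertex vertex_point_dist act_closed)
    qed
    then show "\<exists>n::int. n > 0 \<and> finite {f \<in> carrier G. realization_dist A (realization_action f A) \<le> R \<and>
        realization_dist (realization_action (h [^] n) A) (realization_action f (realization_action (h
            [^] n) A)) \<le> R}"
      using n by (meson finite_subset)
  qed
qed

lemma realization_cobounded:
  assumes x: "x \<in> M" and C: "\<And>p. p \<in> M \<Longrightarrow> \<exists>z\<in>orbit G \<phi> x. d p z \<le> C"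
  shows "isometric_action.cobounded G realization realization_dist realization_action"
proof -
  interpret Y: isometric_action G realization realization_dist realization_action
      by (rule realization_isometric_action)
  have x': "vertex_point x \<in> realization" by (rule vertex_point_closed[OF x])
  have "0 \<le> C" using C[OF x] nonneg order_trans by blast
  have orb: "a \<in> realization" if "a \<in> orbit G realization_action (vertex_point x)" for a
    using that Y.act_closed[OF _ x'] unfolding orbit_def by auto
  show ?thesis unfolding Y.cobounded_def Y.finite_hausdorff_distance_def
  proof (rule bexI[OF _ x'], intro exI[of _ "C + 1"] conjI ballI)
    fix a assume "a \<in> orbit G realization_action (vertex_point x)"
    then show "\<exists>b\<in>realization. realization_dist a b \<le> C + 1"
      using orb \<open>0 \<le> C\<close> by (intro bexI[of _ a]) auto
  next
    fix b assume b: "b \<in> realization"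
    obtain u where u: "u \<in> M" "realization_dist b (vertex_point u) \<le> 1" using near_vertex_point[OF b] by blast
    obtain z where z: "z \<in> orbit G \<phi> x" "d u z \<le> C" using C[OF u(1)] by blast
    obtain f where f: "f \<in> carrier G" "z = \<phi> f x" using z unfolding orbit_def by auto
    have zM: "z \<in> M" using f act_closed x by simp
    have "vertex_point z = realization_action f (vertex_point x)" using f x realization_action_vertex by simp
    then have "vertex_point z \<in> orbit G realization_action (vertex_point x)" unfolding orbit_def
        using f by auto
    moreover have "realization_dist (vertex_point z) b \<le> C + 1"
      using Y.triangle'[of "vertex_point z" "vertex_point u" b] u z zM b vertex_point_closed
          vertex_point_dist[OF zM u(1)]
        commute[of z u] by auto
    ultimately show "\<exists>a\<in>orbit G realization_action (vertex_point x). realization_dist a b \<le> C + 1" by blast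
  qed
qed

end

text \<open>For the case in which nothing is claimed about the elements. The one point is the empty
  set, which exists in every type of realization points.\<close>

lemma point_action:
  assumes "group G"
  defines "Y \<equiv> {{}} :: 'x realization_point set" and "dY \<equiv> \<lambda>_ _. 0 :: real" and "\<psi> \<equiv> \<lambda>_. \<lambda>A\<in>{{}}. A"
  shows "hyperbolic_space Y dY" "isometric_action G Y dY \<psi>" "isometric_action.cobounded G Y dY \<psi>"
proof -
  interpret Y: Metric_space Y dY by unfold_locales (auto simp: Y_def dY_def)
  show "hyperbolic_space Y dY"
  proof
    show "Y.geodesic_space" unfolding Y.geodesic_space_def by (auto simp: Y_def dY_def)
    show "Y.gromov_hyperbolic" by (rule Y.gromov_hyperbolicI[of 0]) (simp only: Y.gromov_product_def,
        simp add: dY_def)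
  qed
  have "group_action G Y \<psi>" by (rule group_actionI[OF assms(1)]) (auto simp: Y_def \<psi>_def)
  then show act: "isometric_action G Y dY \<psi>"
    using Y.Metric_space_axioms by (simp add: isometric_action_def isometric_action_axioms_def dY_def)
  interpret A: isometric_action G Y dY \<psi> by (rule act)
  have "{} \<in> orbit G \<psi> {}" using A.orbit_refl[of "{}"] unfolding Y_def by simp
  then show "A.cobounded" unfolding A.cobounded_def Y.finite_hausdorff_distance_def
    by (intro bexI[of _ "{}"] exI[of _ 0]) (auto simp: Y_def dY_def)
qed

theorem corollaryA2:
  fixes G :: "('g, 'm) monoid_scheme"
    and X :: "'x set" and dX :: "'x \<Rightarrow> 'x \<Rightarrow> real" and \<phi> :: "'g \<Rightarrow> 'x \<Rightarrow> 'x"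
    and n :: nat and g :: "nat \<Rightarrow> 'g"
  assumes "hyperbolic_space X dX"
    and "isometric_action G X dX \<phi>"
    and "\<forall>i\<in>{1..n}. g i \<in> carrier G"
  shows "\<exists>(Y :: 'x realization_point set) dY \<psi>.
      hyperbolic_space Y dY \<and>
      isometric_action G Y dY \<psi> \<and>
      isometric_action.cobounded G Y dY \<psi> \<and>
      ((\<forall>i\<in>{1..n}. isometric_action.loxodromic G X dX \<phi> (g i)) \<longrightarrow>
       (\<forall>i\<in>{1..n}. isometric_action.loxodromic G Y dY \<psi> (g i))) \<and>
      ((\<forall>i\<in>{1..n}. isometric_action.WPD G X dX \<phi> (g i)) \<longrightarrow>
       (\<forall>i\<in>{1..n}. isometric_action.WPD G Y dY \<psi> (g i))) \<and>
      (isometric_action.independent_loxodromics G X dX \<phi> {1..n} g \<longrightarrow>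
       isometric_action.independent_loxodromics G Y dY \<psi> {1..n} g)"
proof -
  obtain \<delta> where "delta_hyperbolic X dX \<delta>" using hyperbolic_space.delta_hyperbolic[OF assms(1)] by blast
  then interpret delta_hyperbolic_action G X dX \<phi> \<delta>
    using assms(2) by (simp add: delta_hyperbolic_action_def)
  show ?thesis
  \<comment> \<open>If some \<open>g i\<close> is not loxodromic, all three premises fail, and for
    \<open>n = 0\<close> all three conclusions are trivial. Otherwise a loxodromic element provides
    a base point; without one \<open>X\<close> might be empty.\<close>
  proof (cases "{1..n} \<noteq> {} \<and> (\<forall>i\<in>{1..n}. loxodromic (g i))")
    case False
    define Y where "Y = ({{}} :: 'x realization_point set)"
    define dY where "dY = (\<lambda>(_ :: 'x realization_point) (_ :: 'x realization_point). 0 :: real)"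
    define \<psi> where "\<psi> = (\<lambda>(_ :: 'g). \<lambda>A\<in>({{}} :: 'x realization_point set). A)"
    have pt: "hyperbolic_space Y dY" "isometric_action G Y dY \<psi>" "isometric_action.cobounded G Y dY \<psi>"
      unfolding Y_def dY_def \<psi>_def by (rule point_action[OF grp.is_group])+
    interpret Y: isometric_action G Y dY \<psi> by (rule pt(2))
    have "{1..n} = {} \<or> \<not> (\<forall>i\<in>{1..n}. loxodromic (g i)) \<and> \<not> (\<forall>i\<in>{1..n}. WPD (g i)) \<and>
        \<not> independent_loxodromics {1..n} g"
      using False unfolding WPD_def independent_loxodromics_def by blast
    then show ?thesis
      by (intro exI[of _ Y] exI[of _ dY] exI[of _ \<psi>])
        (use pt in \<open>auto simp: Y.independent_loxodromics_def\<close>)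
  next
    case True
    then have lox: "\<And>i. i \<in> {1..n} \<Longrightarrow> loxodromic (g i)" by blast
    obtain x where x: "x \<in> X" using True unfolding loxodromic_def by blast
    define Z where "Z = orbit G \<phi> x"
    have Z: "Z \<subseteq> X" "\<And>h z. h \<in> carrier G \<Longrightarrow> z \<in> Z \<Longrightarrow> \<phi> h z \<in> Z" "Z \<noteq> {}"
      unfolding Z_def using orbit_subset[OF x] orbit_closed[OF x] orbit_refl[OF x] by auto
    have "\<forall>i\<in>{1..n}. eventually (\<lambda>r. isometric_action.loxodromic G X (graph_dist (electric_edges Z r))
        \<phi> (g i)) at_top"
      unfolding eventually_at_top_linorder Z_def using electric_loxodromic[OF lox x] by blast
    \<comment> \<open>There are only finitely many elements, so one radius serves them all.\<close>
    then have "eventually (\<lambda>r. \<forall>i\<in>{1..n}. isometric_action.loxodromic G X (graph_dist (electric_edges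
        Z r)) \<phi> (g i)) at_top"
      by (rule eventually_ball_finite[OF finite_atLeastAtMost])
    then obtain r0 where r0: "\<And>r i. r \<ge> r0 \<Longrightarrow> i \<in> {1..n} \<Longrightarrow> isometric_action.loxodromic G X (graph_dist
        (electric_edges Z r)) \<phi> (g i)"
      unfolding eventually_at_top_linorder by blast
    \<comment> \<open>\<open>electric_cobounded\<close> requires a nonnegative radius.\<close>
    define r where "r = max r0 0"
    define E where "E = electric_edges Z r"
    define \<rho> where "\<rho> = graph_dist E"
    interpret V: isometric_action G X \<rho> \<phi> unfolding \<rho>_def E_def by (rule electric_action[OF Z(1,2)])
    obtain A where A: "A \<ge> 0" "coarsely_additive \<rho> A" using electric_additive unfolding \<rho>_def E_def by blast
    interpret additive_action G X dX \<phi> \<delta> \<rho> A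
      by unfold_locales (use A in auto)
    have Vlox: "V.loxodromic (g i)" if "i \<in> {1..n}" for i
      using r0[of r i] that unfolding \<rho>_def E_def r_def by simp
    have path: "\<exists>y n. y 0 = a \<and> y n = b \<and> \<rho> a b = real n \<and> (\<forall>i\<le>n. y i \<in> X) \<and> (\<forall>i<n. \<rho> (y i) (y (Suc i)) \<le> 1)"
      if ab: "a \<in> X" "b \<in> X" for a b
    proof -
      obtain N where N: "\<rho> a b = real N" "(a, b) \<in> E ^^ N" using electric_geodesic[OF ab, of Z r]
          unfolding \<rho>_def E_def by blast
      then obtain y where y: "y 0 = a" "y N = b" "\<And>i. i < N \<Longrightarrow> (y i, y (Suc i)) \<in> E"
        unfolding relpow_fun_conv by blast
      have "\<rho> (y i) (y (Suc i)) \<le> 1" if "i < N" for i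
        using graph_dist_le[of "y i" "y (Suc i)" 1 E] y(3)[OF that] unfolding \<rho>_def by simp
      moreover have "y i \<in> X" if "i \<le> N" for i
      proof (cases i)
        case (Suc j)
        then have "(y j, y i) \<in> E" using y(3)[of j] that by simp
        then show ?thesis unfolding E_def electric_edges_def by auto
      qed (use y ab in simp)
      ultimately show ?thesis using y N by blast
    qed
    interpret Y: isometric_action G V.realization V.realization_dist V.realization_action
      by (rule V.realization_isometric_action)
    have hyp: "hyperbolic_space V.realization V.realization_dist"
    proof
      show "Y.geodesic_space" by (rule V.realization_geodesic[OF path])
      show "Y.gromov_hyperbolic" by (rule V.realization_hyperbolic[OF coarsely_additive_hyperbolic[OF A(2)]])
    qed
    obtain \<delta>' where "delta_hyperbolic V.realization V.realization_dist \<delta>'"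
      using hyperbolic_space.delta_hyperbolic[OF hyp] by blast
    then interpret Y: delta_hyperbolic_action G V.realization V.realization_dist V.realization_action \<delta>'
      using Y.isometric_action_axioms by (simp add: delta_hyperbolic_action_def)
    have Ylox: "Y.loxodromic (g i)" if "i \<in> {1..n}" for i
      by (rule V.realization_loxodromic[OF Vlox[OF that] x])
    have cob: "Y.cobounded"
      by (rule V.realization_cobounded[OF x, of "r + 3"])
        (use electric_cobounded[OF _ Z(1,3), of _ r] in \<open>simp add: r_def Z_def \<rho>_def E_def\<close>)
    have wpd: "Y.WPD (g i)" if i: "i \<in> {1..n}" and "WPD (g i)" for i
      by (rule V.realization_WPD[OF Vlox[OF i] x WPD_transfer[OF that(2) Vlox[OF i] x]])
    obtain B where B: "\<And>w p q. w \<in> X \<Longrightarrow> p \<in> X \<Longrightarrow> q \<in> X \<Longrightarrow> V.gromov_product w p q \<le> gromov_product w p q + B"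
      using coarsely_additive_product[OF A(2)] by blast
    \<comment> \<open>Independence is transferred by contraposition. Vertices embed isometrically,
      so the products of orbit points in the realization are those for \<rho>, and these exceed the
      products in \<open>X\<close> by at most \<open>B\<close>.\<close>
    have disj: "boundary_fixed_points h \<inter> boundary_fixed_points h' \<noteq> {}"
      if ne: "Y.boundary_fixed_points h \<inter> Y.boundary_fixed_points h' \<noteq> {}"
        and l: "loxodromic h" "loxodromic h'" "Y.loxodromic h" "Y.loxodromic h'" for h h'
    proof (rule common_fixed_point_of_unbounded_product[OF l(1,2) x])
      note h = loxodromic_carrier[OF l(1)] loxodromic_carrier[OF l(2)]
      fix C
      obtain \<xi> where \<xi>: "\<xi> \<in> Y.boundary_fixed_points h" "\<xi> \<in> Y.boundary_fixed_points h'" using ne by blast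
      obtain m m' :: int where m: "Y.gromov_product (V.vertex_point x) (V.realization_action (h [^]\<^bsub>G\<^esub>
          m) (V.vertex_point x))
          (V.realization_action (h' [^]\<^bsub>G\<^esub> m') (V.vertex_point x)) > C + B"
        using Y.common_fixed_point_product_unbounded[OF l(3,4) V.vertex_point_closed[OF x] \<xi>] by blast
      have M: "\<phi> (h [^]\<^bsub>G\<^esub> m) x \<in> X" "\<phi> (h' [^]\<^bsub>G\<^esub> m') x \<in> X" using pow_closed h x by auto
      have "V.gromov_product x (\<phi> (h [^]\<^bsub>G\<^esub> m) x) (\<phi> (h' [^]\<^bsub>G\<^esub> m') x) > C + B"
        using m h x M unfolding Y.gromov_product_def V.gromov_product_def
        by (simp add: V.realization_action_vertex V.vertex_point_dist)
      then have "gromov_product x (\<phi> (h [^]\<^bsub>G\<^esub> m) x) (\<phi> (h' [^]\<^bsub>G\<^esub> m') x) > C" using B[OF x M] by linarith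
      then show "\<exists>(m::int) (m'::int). gromov_product x (\<phi> (h [^]\<^bsub>G\<^esub> m) x) (\<phi> (h' [^]\<^bsub>G\<^esub> m') x) > C" by blast
    qed
    have ind: "Y.independent_loxodromics {1..n} g" if "independent_loxodromics {1..n} g"
      unfolding Y.independent_loxodromics_def
    proof (intro conjI ballI impI)
      fix i j assume ij: "i \<in> {1..n}" "j \<in> {1..n}" "i \<noteq> j"
      then have "boundary_fixed_points (g i) \<inter> boundary_fixed_points (g j) = {}"
        using that unfolding independent_loxodromics_def by blast
      then show "Y.boundary_fixed_points (g i) \<inter> Y.boundary_fixed_points (g j) = {}"
        using disj lox Ylox ij by blast
    qed (rule Ylox)
    show ?thesis
      by (intro exI[of _ V.realization] exI[of _ V.realization_dist] exI[of _ V.realization_action]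
          conjI impI ballI
          hyp Y.isometric_action_axioms cob Ylox wpd ind) auto
  qed
qed

end
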